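(* (Non-commutative Wick formula.) Let $\mathcal U$ be a vector superspace and let $a=a(W)$, $b=b(W)$, $c=c(W)$ be three homogeneous $\mathrm{End}(\mathcal U)$-valued fields. Then, both in case W and in case K, $$[a_\Lambda :bc:]\;=\;:[a_\Lambda b]\,c:\;+\;(-1)^{(p(a)+N)p(b)}:b\,[a_\Lambda c]:\;+\;\int_0^\Lambda [[a_\Lambda b]_\Gamma c]\,d\Gamma .$$
   Context: Ground field $\mathbb C$; $N$ is a fixed integer, $N\ge 0$ (case W) or $N\ge1$ (case K). $Z=(z,\theta^1,\dots,\theta^N)$, $W=(w,\zeta^1,\dots,\zeta^N)$, $z,w$ even, $\theta^i,\zeta^i$ odd; odd variables anticommute with each other and supercommute with elements of superspaces. $p(\cdot)$ is parity, $[\ ,\ ]$ the supercommutator. For $J=\{j_1<\dots<j_k\}\subset\{1,\dots,N\}$, $\theta^J=\theta^{j_1}\cdots\theta^{j_k}$, $Z^{j|J}=z^j\theta^J$; in exponents of $-1$, $J$ means $\#J$; "$N$" as a set means $\{1,\dots,N\}$. An $\mathrm{End}(\mathcal U)$-valued field is a formal sum $a(Z)=\sum_{n\in\mathbb Z,I}Z^{n|I}a_{n|I}$, $a_{n|I}\in\mathrm{End}(\mathcal U)$, with $a(Z)v\in\mathcal U((z))[\theta^1,\dots,\theta^N]$ for all $v\in\mathcal U$; it is homogeneous of parity $p$ if $a_{n|I}$ has parity $p+\#I$ for all $n,I$. $\mathrm{res}_Z$ is the coefficient of $z^{-1}\theta^1\cdots\theta^N$ (written to the right of it). Put $a_+(Z)=\sum_{n\ge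 0,I}Z^{n|I}a_{n|I}$, $a_-(Z)=a(Z)-a_+(Z)$, and define the normally ordered product $:a(Z)b(Z):\,=a_+(Z)b(Z)+(-1)^{p(a)p(b)}b(Z)a_-(Z)$. Parameters: $\Lambda=(\lambda,\chi^1,\dots,\chi^N)$, $\lambda$ even, $\chi^i$ odd, $\lambda$ commuting with $\chi^i$, and $\chi^i\chi^j+\chi^j\chi^i=0$ in case W, $\chi^i\chi^j+\chi^j\chi^i=-2\delta_{ij}\lambda$ in case K. The parameters supercommute with all variables and operators. $\Lambda^{j|J}=\lambda^j\chi^{j_1}\cdots\chi^{j_k}$. Put $(Z-W)\Lambda=(z-w)\lambda+\sum_i(\theta^i-\zeta^i)\chi^i$ in case W and $(Z-W)\Lambda=(z-w-\sum_i\theta^i\zeta^i)\lambda+\sum_i(\theta^i-\zeta^i)\chi^i$ in case K. The $\Lambda$-bracket is $$[a_\Lambda b](W)=\mathrm{res}_Z\,\exp((Z-W)\Lambda)\,[a(Z),b(W)],$$ a formal power series $\sum\Lambda^{j|J}f_{j|J}(W)$ whose coefficients are fields. Operations are extended to such series by the sign rule: if $[a_\Lambda b]=\sum\Lambda^{j|J}f_{j|J}$ and $[a_\Lambda c]=\sum\Lambda^{j|J}g_{j|J}$, then $:[a_\Lambda b]c:\,=\sum\Lambda^{j|J}:f_{j|J}c:$, $\;:b[a_\Lambda c]:\,=\sum(-1)^{p(b)J}\Lambda^{j|J}:b\,g_{j|J}:$, and $[[a_\Lambda b]_\Gamma c]=\sum(-1)^{JN}\Lambda^{j|J}[{f_{j|J}}_\Gamma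 c]$, where $\Gamma=(\gamma,\eta^1,\dots,\eta^N)$ is another set of parameters of the same type as $\Lambda$, supercommuting with $\Lambda$. The integral $\int_0^\Lambda(\cdot)\,d\Gamma$ means: write the integrand as $\sum\Lambda^{k|K}\Gamma^{j|J}h_{k|K,j|J}$; apply $\partial_\eta^N=\partial_{\eta^1}\cdots\partial_{\eta^N}$, i.e. $\partial^N_\eta\,\Lambda^{k|K}\Gamma^{j|J}h=0$ if $J\ne\{1,\dots,N\}$ and $\partial^N_\eta\,\Lambda^{k|K}\Gamma^{j|N}h=(-1)^{KN+N(N-1)/2}\Lambda^{k|K}\gamma^jh$; then take the definite integral over $\gamma$ from $0$ to $\lambda$. *)

theory Defs
  imports Complex_Main "HOL-Library.Function_Algebras" "HOL-Library.Groups_Big_Fun"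
begin

section \<open>Complex vector superspaces and their endomorphisms\<close>

class superspace = ab_group_add +
  fixes scaleC :: "complex \<Rightarrow> 'a \<Rightarrow> 'a"  (infixr \<open>*\<^sub>C\<close> 75)
    and even_vectors :: "'a set"
    and odd_vectors :: "'a set"
  assumes scaleC_add_right: "c *\<^sub>C (x + y) = c *\<^sub>C x + c *\<^sub>C y"
    and scaleC_add_left: "(c + d) *\<^sub>C x = c *\<^sub>C x + d *\<^sub>C x"
    and scaleC_scaleC: "c *\<^sub>C (d *\<^sub>C x) = (c * d) *\<^sub>C x"
    and scaleC_one: "1 *\<^sub>C x = x"
    and even_vectors_zero: "0 \<in> even_vectors"
    and even_vectors_add: "x \<in> even_vectors \<Longrightarrow> y \<in> even_vectors \<Longrightarrow> x + y \<in> even_vectors"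
    and even_vectors_scale: "x \<in> even_vectors \<Longrightarrow> c *\<^sub>C x \<in> even_vectors"
    and odd_vectors_zero: "0 \<in> odd_vectors"
    and odd_vectors_add: "x \<in> odd_vectors \<Longrightarrow> y \<in> odd_vectors \<Longrightarrow> x + y \<in> odd_vectors"
    and odd_vectors_scale: "x \<in> odd_vectors \<Longrightarrow> c *\<^sub>C x \<in> odd_vectors"
    and even_odd_Int: "even_vectors \<inter> odd_vectors = {0}"
    and even_odd_span: "\<exists>y\<in>even_vectors. \<exists>z\<in>odd_vectors. x = y + z"

lemma vector_space_scaleC: "vector_space (scaleC :: complex \<Rightarrow> 'u \<Rightarrow> 'u::superspace)"
  by unfold_locales (simp_all add: scaleC_add_right scaleC_add_left scaleC_scaleC scaleC_one)

definition homogeneous_vectors :: "nat \<Rightarrow> 'u::superspace set" where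
  "homogeneous_vectors p = (if even p then even_vectors else odd_vectors)"

text \<open>Operators are functions on \<open>'u\<close>; elements of End(U) are those satisfying \<open>is_endo\<close>.\<close>

type_synonym 'u operator = "'u \<Rightarrow> 'u"

definition is_endo :: "'u::superspace operator \<Rightarrow> bool" where
  "is_endo A \<longleftrightarrow> Vector_Spaces.linear scaleC scaleC A"

definition operator_homogeneous :: "nat \<Rightarrow> 'u::superspace operator \<Rightarrow> bool" where
  "operator_homogeneous p A \<longleftrightarrow>
     (\<forall>q. A ` homogeneous_vectors q \<subseteq> homogeneous_vectors (p + q))"

definition even_part :: "'u::superspace \<Rightarrow> 'u" where
  "even_part x = (THE y. y \<in> even_vectors \<and> x - y \<in> odd_vectors)"

definition parity_involution :: "'u::superspace operator" where
  "parity_involution x = even_part x - (x - even_part x)"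

text \<open>Moving an operator from the left to the right of a product of \<open>k\<close> odd variables:
  \<open>twist k A\<close> is \<open>A\<close> for even \<open>A\<close> and \<open>(-1)^k A\<close> for odd \<open>A\<close>.\<close>

definition twist :: "nat \<Rightarrow> 'u::superspace operator \<Rightarrow> 'u operator" where
  "twist k A = (if even k then A else parity_involution \<circ> A \<circ> parity_involution)"

definition scale_op :: "complex \<Rightarrow> 'u::superspace operator \<Rightarrow> 'u operator" where
  "scale_op c A = (\<lambda>v. c *\<^sub>C A v)"

definition minus_one_power :: "nat \<Rightarrow> 'b::group_add \<Rightarrow> 'b" where
  "minus_one_power k x = (if even k then x else - x)"


section \<open>Fields\<close>

text \<open>\<open>a n I\<close> is the coefficient of \<open>Z^{n|I}\<close>. An operator-valued formal sum in
  \<open>N\<close> odd variables has zero coefficients unless \<open>I \<subseteq> {1..N}\<close>.\<close>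

type_synonym 'u field = "int \<Rightarrow> nat set \<Rightarrow> 'u operator"

definition is_field :: "nat \<Rightarrow> 'u::superspace field \<Rightarrow> bool" where
  "is_field N a \<longleftrightarrow>
     (\<forall>n I. is_endo (a n I)) \<and>
     (\<forall>n I. \<not> I \<subseteq> {1..N} \<longrightarrow> a n I = 0) \<and>
     (\<forall>v. \<exists>M. \<forall>n<M. \<forall>I. a n I v = 0)"

definition field_homogeneous :: "nat \<Rightarrow> 'u::superspace field \<Rightarrow> bool" where
  "field_homogeneous p a \<longleftrightarrow> (\<forall>n I. operator_homogeneous (p + card I) (a n I))"

definition homogeneous :: "'u::superspace field \<Rightarrow> bool" where
  "homogeneous a \<longleftrightarrow> (\<exists>p. field_homogeneous p a)"

text \<open>The parity of a homogeneous field. It is well defined for nonzero fields; the zero field,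
  which is homogeneous of both parities, is given parity 0.\<close>

definition parity :: "'u::superspace field \<Rightarrow> nat" where
  "parity a = (if field_homogeneous 0 a then 0 else 1)"

definition field_plus :: "'u::superspace field \<Rightarrow> 'u field" where
  "field_plus a = (\<lambda>n I. if n \<ge> 0 then a n I else 0)"

definition field_minus :: "'u::superspace field \<Rightarrow> 'u field" where
  "field_minus a = a - field_plus a"


section \<open>Operator-valued formal series in the variables and parameters\<close>

datatype supercase = CaseW | CaseK

text \<open>\<open>Theta i\<close>, \<open>Chi i\<close>, \<open>Zeta i\<close> are the odd variables of \<open>Z\<close>, \<open>\<Lambda>\<close>, \<open>W\<close>.\<close>

datatype generator = Theta nat | Chi nat | Zeta nat

fun precedes :: "generator \<Rightarrow> generator \<Rightarrow> bool" where
  "precedes (Theta i) (Theta j) = (i < j)"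
| "precedes (Theta i) (Chi j) = True"
| "precedes (Theta i) (Zeta j) = True"
| "precedes (Chi i) (Theta j) = False"
| "precedes (Chi i) (Chi j) = (i < j)"
| "precedes (Chi i) (Zeta j) = True"
| "precedes (Zeta i) (Theta j) = False"
| "precedes (Zeta i) (Chi j) = False"
| "precedes (Zeta i) (Zeta j) = (i < j)"

text \<open>\<open>Mon m n k S\<close> is \<open>z^m w^n \<lambda>^k\<close> times the product of the odd generators in \<open>S\<close>, taken in
  the order \<open>precedes\<close>, that is \<open>Z^{m|I} \<Lambda>^{k|J} W^{n|K}\<close> where \<open>I\<close>, \<open>J\<close>, \<open>K\<close> are the sets of
  indices of the \<open>\<theta>\<close>, \<open>\<chi>\<close>, \<open>\<zeta>\<close> in \<open>S\<close>.\<close>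

datatype monomial = Mon int int nat "generator set"

text \<open>The square of an odd generator is \<open>gen_square\<close> times \<open>\<lambda>\<close>: it is zero except that
  \<open>\<chi>\<^sup>i \<chi>\<^sup>i = - \<lambda>\<close> in case K. Distinct generators anticommute. Hence the product of two monomials
  is \<open>mon_sign\<close> times the monomial \<open>mon_times\<close>.\<close>

fun gen_square :: "supercase \<Rightarrow> generator \<Rightarrow> complex" where
  "gen_square CaseK (Chi i) = - 1"
| "gen_square _ _ = 0"

fun mon_times :: "monomial \<Rightarrow> monomial \<Rightarrow> monomial" where
  "mon_times (Mon m n k S) (Mon m' n' k' S') =
     Mon (m + m') (n + n') (k + k' + card (S \<inter> S')) ((S - S') \<union> (S' - S))"

fun mon_sign :: "supercase \<Rightarrow> monomial \<Rightarrow> monomial \<Rightarrow> complex" where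
  "mon_sign \<kappa> (Mon m n k S) (Mon m' n' k' S') =
     (- 1) ^ card {(g, h) \<in> S \<times> S'. precedes h g} * (\<Prod>g\<in>S \<inter> S'. gen_square \<kappa> g)"

fun mon_degree :: "monomial \<Rightarrow> nat" where
  "mon_degree (Mon m n k S) = card S"

text \<open>\<open>F M\<close> is the coefficient, written to the right of the monomial \<open>M\<close>. The coefficients of a
  product are computed pointwise: for fields the sums are infinite, but have finitely many nonzero
  terms once applied to a vector.\<close>

type_synonym 'u series = "monomial \<Rightarrow> 'u operator"

definition series_mult :: "supercase \<Rightarrow> 'u::superspace series \<Rightarrow> 'u series \<Rightarrow> 'u series" where
  "series_mult \<kappa> F G = (\<lambda>M v. Sum_any (\<lambda>(M1, M2).
     if mon_times M1 M2 = M
     then mon_sign \<kappa> M1 M2 *\<^sub>C twist (mon_degree M2) (F M1) (G M2 v) else 0))"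

definition series_monomial :: "monomial \<Rightarrow> 'u::superspace series" where
  "series_monomial M = (\<lambda>M'. if M' = M then id else 0)"

fun series_power :: "supercase \<Rightarrow> 'u::superspace series \<Rightarrow> nat \<Rightarrow> 'u series" where
  "series_power \<kappa> F 0 = series_monomial (Mon 0 0 0 {})"
| "series_power \<kappa> F (Suc n) = series_mult \<kappa> F (series_power \<kappa> F n)"

text \<open>Meaningful for \<open>F\<close> such that each monomial occurs in finitely many powers of \<open>F\<close>, such as
  \<open>(Z - W)\<Lambda>\<close> below.\<close>

definition series_exp :: "supercase \<Rightarrow> 'u::superspace series \<Rightarrow> 'u series" where
  "series_exp \<kappa> F = (\<lambda>M. Sum_any (\<lambda>n. scale_op (1 / fact n) (series_power \<kappa> F n M)))"

definition var_z :: "'u::superspace series" where "var_z = series_monomial (Mon 1 0 0 {})"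
definition var_w :: "'u::superspace series" where "var_w = series_monomial (Mon 0 1 0 {})"
definition var_lambda :: "'u::superspace series" where
  "var_lambda = series_monomial (Mon 0 0 1 {})"
definition var_theta :: "nat \<Rightarrow> 'u::superspace series" where
  "var_theta i = series_monomial (Mon 0 0 0 {Theta i})"
definition var_chi :: "nat \<Rightarrow> 'u::superspace series" where
  "var_chi i = series_monomial (Mon 0 0 0 {Chi i})"
definition var_zeta :: "nat \<Rightarrow> 'u::superspace series" where
  "var_zeta i = series_monomial (Mon 0 0 0 {Zeta i})"

fun Z_minus_W_Lambda :: "supercase \<Rightarrow> nat \<Rightarrow> 'u::superspace series" where
  "Z_minus_W_Lambda CaseW N =
     series_mult CaseW (var_z - var_w) var_lambda
     + (\<Sum>i=1..N. series_mult CaseW (var_theta i - var_zeta i) (var_chi i))"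
| "Z_minus_W_Lambda CaseK N =
     series_mult CaseK
       (var_z - var_w - (\<Sum>i=1..N. series_mult CaseK (var_theta i) (var_zeta i))) var_lambda
     + (\<Sum>i=1..N. series_mult CaseK (var_theta i - var_zeta i) (var_chi i))"

fun in_Z :: "'u::superspace field \<Rightarrow> 'u series" where
  "in_Z a (Mon m n k S) =
     (if n = 0 \<and> k = 0 \<and> S \<subseteq> range Theta then a m {i. Theta i \<in> S} else 0)"

fun in_W :: "'u::superspace field \<Rightarrow> 'u series" where
  "in_W a (Mon m n k S) =
     (if m = 0 \<and> k = 0 \<and> S \<subseteq> range Zeta then a n {i. Zeta i \<in> S} else 0)"


section \<open>Normally ordered product and \<open>\<Lambda>\<close>-bracket\<close>

text \<open>The products involve no \<open>\<chi>\<close>, so that this does not depend on \<open>\<kappa>\<close>.\<close>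

definition normal_product ::
  "supercase \<Rightarrow> 'u::superspace field \<Rightarrow> 'u field \<Rightarrow> 'u field" where
  "normal_product \<kappa> a b = (\<lambda>n I.
     (series_mult \<kappa> (in_Z (field_plus a)) (in_Z b)
      + minus_one_power (parity a * parity b) (series_mult \<kappa> (in_Z b) (in_Z (field_minus a))))
     (Mon n 0 0 (Theta ` I)))"

definition supercommutator ::
  "supercase \<Rightarrow> 'u::superspace field \<Rightarrow> 'u field \<Rightarrow> 'u series" where
  "supercommutator \<kappa> a b =
     series_mult \<kappa> (in_Z a) (in_W b)
     - minus_one_power (parity a * parity b) (series_mult \<kappa> (in_W b) (in_Z a))"

text \<open>\<open>L j J\<close> is the coefficient of \<open>\<Lambda>^{j|J}\<close>, and \<open>H k K j J\<close> that of \<open>\<Lambda>^{k|K} \<Gamma>^{j|J}\<close>.\<close>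

type_synonym 'u lambda_series = "nat \<Rightarrow> nat set \<Rightarrow> 'u field"
type_synonym 'u lambda_gamma_series = "nat \<Rightarrow> nat set \<Rightarrow> 'u lambda_series"

definition lambda_bracket ::
  "supercase \<Rightarrow> nat \<Rightarrow> 'u::superspace field \<Rightarrow> 'u field \<Rightarrow> 'u lambda_series" where
  "lambda_bracket \<kappa> N a b = (\<lambda>j J n I.
     series_mult \<kappa> (series_exp \<kappa> (Z_minus_W_Lambda \<kappa> N)) (supercommutator \<kappa> a b)
       (Mon (- 1) n j (Theta ` {1..N} \<union> Chi ` J \<union> Zeta ` I)))"

definition normal_product_left ::
  "supercase \<Rightarrow> 'u::superspace lambda_series \<Rightarrow> 'u field \<Rightarrow> 'u lambda_series" where
  "normal_product_left \<kappa> L c = (\<lambda>j J. normal_product \<kappa> (L j J) c)"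

definition normal_product_right ::
  "supercase \<Rightarrow> 'u::superspace field \<Rightarrow> 'u lambda_series \<Rightarrow> 'u lambda_series" where
  "normal_product_right \<kappa> b L =
     (\<lambda>j J. minus_one_power (parity b * card J) (normal_product \<kappa> b (L j J)))"

definition gamma_bracket ::
  "supercase \<Rightarrow> nat \<Rightarrow> 'u::superspace lambda_series \<Rightarrow> 'u field \<Rightarrow> 'u lambda_gamma_series" where
  "gamma_bracket \<kappa> N L c = (\<lambda>k K.
     minus_one_power (card K * N) (lambda_bracket \<kappa> N (L k K) c))"

text \<open>The value of \<open>odd_derivative N H\<close> at \<open>k K j\<close> is the coefficient of \<open>\<Lambda>^{k|K} \<gamma>^j\<close>.\<close>

definition odd_derivative ::
  "nat \<Rightarrow> 'u::superspace lambda_gamma_series \<Rightarrow> nat \<Rightarrow> nat set \<Rightarrow> nat \<Rightarrow> 'u field" where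
  "odd_derivative N H =
     (\<lambda>k K j. minus_one_power (card K * N + N * (N - 1) div 2) (H k K j {1..N}))"

text \<open>The integral from \<open>0\<close> to \<open>\<lambda>\<close> of \<open>\<gamma>^j\<close> is \<open>\<lambda>^{j+1} / (j+1)\<close>.\<close>

definition lambda_integral ::
  "nat \<Rightarrow> 'u::superspace lambda_gamma_series \<Rightarrow> 'u lambda_series" where
  "lambda_integral N H = (\<lambda>l K n I.
     \<Sum>(k, j) \<in> {(k, j). k + (j + 1) = l}.
       scale_op (1 / of_nat (j + 1)) (odd_derivative N H k K j n I))"

end

theory Submission
  imports Defs
begin

text \<open>Passing to modes, only the odd variables remain as formal variables, and everything takes place in
  a ring of power series in \<open>\<lambda>\<close> and the odd generators with operator coefficients. The commutator
  \<open>[a, \<cdot>]\<close> is a superderivation, so that \<open>[a\<^sub>\<Lambda> :bc:]\<close> is computed from \<open>b\<^sub>+ c\<close> and \<open>c b\<^sub>-\<close>. The terms with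
  \<open>[a, c]\<close> are \<open>:b[a\<^sub>\<Lambda> c]:\<close>. The terms with \<open>[a, b]\<close> differ from \<open>:[a\<^sub>\<Lambda> b]c:\<close> since multiplication by
  \<open>exp((Z-W)\<Lambda>)\<close> does not commute with taking the \<open>+\<close> part in \<open>w\<close>. The difference is the commutator
  of \<open>c\<close> with the residue in \<open>x\<close> of \<open>[a, b(x)] (e^{(z-x)\<lambda>} - e^{(z-w)\<lambda>}) / (x - w)\<close>, and this is the integral:
  \<open>\<integral>\<^sub>0\<^sup>\<lambda> e^{(x-w)\<gamma>} d\<gamma> = (e^{(x-w)\<lambda>} - 1) / (x - w)\<close>, while \<open>\<partial>\<^sub>\<eta>\<^sup>N\<close> turns the odd part of the exponential into
  the delta function that identifies the odd variables.\<close>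

section \<open>Endomorphisms and parity\<close>

text \<open>Sums over modes are finite only on a given vector, and the exponential is infinite in
  \<lambda>. The ring therefore consists of operator families that are finite on each vector up to
  each power of \<lambda>, and every exchange of summations rests on a joint finiteness condition.
  Both cases are handled at once by writing (Z-W)\<Lambda> = (z-w)\<lambda> + u_1 + ... + u_N, where
  u_i involves only the i-th odd variables and \<lambda>. In either case the u_i commute, square to
  zero and annihilate \<theta>_i - \<zeta>_i, so the exponential is e^{(z-w)\<lambda>} times the
  product of the factors 1 + u_i, and even and odd variables separate. The even half of the integral
  term comes down to a Beta integral. In the odd half the sign (-1)^{N(N-1)/2} arises from sorting
  \<theta>_1 \<chi>_1 ... \<theta>_N \<chi>_N into \<theta>'s before \<chi>'s; it meets the same
  sign in the odd derivative, so that no constant is left. The zero field has parity 0 by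
  convention, so the parity of a product or bracket coefficient may differ from the one computed
  from its factors. Such signs are compared only after multiplication by the modes.\<close>

lemma is_endo_iff:
  "is_endo A \<longleftrightarrow> (\<forall>x y. A (x + y) = A x + A y) \<and> (\<forall>c x. A (c *\<^sub>C x) = c *\<^sub>C A x)"
  unfolding is_endo_def Vector_Spaces.linear_def module_hom_def module_hom_axioms_def
  using vector_space_scaleC[where 'u='a]
  by (auto simp: vector_space_def module_def)

interpretation scaleC: vector_space "scaleC :: complex \<Rightarrow> 'u \<Rightarrow> 'u::superspace"
  by (rule vector_space_scaleC)

lemma is_endoI:
  assumes "\<And>x y. A (x + y) = A x + A y" "\<And>c x. A (c *\<^sub>C x) = c *\<^sub>C A x"
  shows "is_endo A"
  using assms by (auto simp: is_endo_iff)

lemma endo_add: "is_endo A \<Longrightarrow> A (x + y) = A x + A y"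
  and endo_scale: "is_endo A \<Longrightarrow> A (c *\<^sub>C x) = c *\<^sub>C A x"
  by (auto simp: is_endo_iff)

lemma endo_zero: "is_endo A \<Longrightarrow> A 0 = 0"
  by (metis endo_scale scaleC.scale_zero_left)

lemma endo_minus: "is_endo A \<Longrightarrow> A (- x) = - A x"
  by (metis endo_add endo_zero add.right_inverse add_eq_0_iff)

lemma endo_diff: "is_endo A \<Longrightarrow> A (x - y) = A x - A y"
  by (metis endo_add endo_minus diff_conv_add_uminus)

lemma endo_sum: "is_endo A \<Longrightarrow> A (sum f I) = (\<Sum>i\<in>I. A (f i))"
  by (induction I rule: infinite_finite_induct) (auto simp: endo_zero endo_add)

lemma is_endo_zero: "is_endo 0"
  and is_endo_id: "is_endo id"
  and is_endo_comp: "is_endo A \<Longrightarrow> is_endo B \<Longrightarrow> is_endo (A \<circ> B)"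
  by (auto simp: is_endo_iff scaleC_add_right)

lemma is_endo_scale: "is_endo (scaleC c)"
  by (rule is_endoI) (simp_all add: scaleC_add_right scaleC_scaleC mult.commute)

section \<open>The parity involution and homogeneity\<close>

lemma even_odd_unique:
  fixes y z y' z' :: "'u::superspace"
  assumes "y \<in> even_vectors" "z \<in> odd_vectors" "y' \<in> even_vectors" "z' \<in> odd_vectors"
    and "y + z = y' + z'"
  shows "y = y'" "z = z'"
proof -
  have "y - y' \<in> even_vectors"
    using even_vectors_add[OF assms(1) even_vectors_scale[OF assms(3), of "-1"]] by simp
  moreover have "z' - z \<in> odd_vectors"
    using odd_vectors_add[OF assms(4) odd_vectors_scale[OF assms(2), of "-1"]] by simp
  moreover have "y - y' = z' - z"
    using assms(5) by (simp add: algebra_simps)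
  ultimately have "y - y' \<in> even_vectors \<inter> odd_vectors"
    by simp
  then have "y - y' = 0"
    by (simp add: even_odd_Int)
  then show "y = y'" "z = z'"
    using assms(5) by auto
qed

lemma even_part_eq:
  assumes "y \<in> even_vectors" "z \<in> odd_vectors"
  shows "even_part (y + z) = y"
  unfolding even_part_def
proof (rule the_equality)
  fix y' assume "y' \<in> even_vectors \<and> y + z - y' \<in> odd_vectors"
  then show "y' = y"
    using even_odd_unique(1)[of y' "y + z - y'" y z] assms by auto
qed (use assms in auto)

abbreviation pinv :: "'u::superspace operator" (\<open>\<Pi>\<close>) where "\<Pi> \<equiv> parity_involution"

lemma pinv_eq: "y \<in> even_vectors \<Longrightarrow> z \<in> odd_vectors \<Longrightarrow> \<Pi> (y + z) = y - z"
  by (simp add: parity_involution_def even_part_eq)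

lemma even_odd_cases:
  obtains y z where "x = y + z" "y \<in> even_vectors" "z \<in> odd_vectors"
  using even_odd_span by blast

lemma pinv_pinv [simp]: "\<Pi> (\<Pi> x) = x"
proof (cases x rule: even_odd_cases)
  case (1 y z)
  then show ?thesis
    using pinv_eq[of y z] pinv_eq[of y "-z"] odd_vectors_scale[of z "-1"]
    by (simp add: scaleC.scale_minus_left)
qed

lemma is_endo_pinv: "is_endo \<Pi>"
proof (rule is_endoI)
  fix x x' :: 'a and c
  obtain y z where x: "x = y + z" "y \<in> even_vectors" "z \<in> odd_vectors"
    by (rule even_odd_cases)
  obtain y' z' where x': "x' = y' + z'" "y' \<in> even_vectors" "z' \<in> odd_vectors"
    by (rule even_odd_cases)
  have "x + x' = (y + y') + (z + z')"
    by (simp add: x x')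
  then show "\<Pi> (x + x') = \<Pi> x + \<Pi> x'"
    using x x' by (simp only: pinv_eq even_vectors_add odd_vectors_add) simp
  have "c *\<^sub>C x = c *\<^sub>C y + c *\<^sub>C z"
    by (simp add: x scaleC_add_right)
  then show "\<Pi> (c *\<^sub>C x) = c *\<^sub>C \<Pi> x"
    using x by (simp only: pinv_eq even_vectors_scale odd_vectors_scale)
      (simp add: scaleC.scale_right_diff_distrib)
qed

lemma pinv_even_iff: "\<Pi> x = x \<longleftrightarrow> x \<in> even_vectors"
proof (cases x rule: even_odd_cases)
  case (1 y z)
  have "x \<in> even_vectors" if "\<Pi> x = x"
  proof -
    have "y - z = y + z"
      using that 1 pinv_eq by metis
    then have "(2::complex) *\<^sub>C z = 0"
      using scaleC_add_left[of 1 1 z] by (simp add: scaleC_one) (metis add.left_inverse)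
    then show ?thesis
      using 1 by simp
  qed
  moreover have "\<Pi> x = x" if "x \<in> even_vectors"
    using pinv_eq[OF that odd_vectors_zero] by simp
  ultimately show ?thesis by blast
qed

lemma pinv_odd_iff: "\<Pi> x = - x \<longleftrightarrow> x \<in> odd_vectors"
proof (cases x rule: even_odd_cases)
  case (1 y z)
  have "x \<in> odd_vectors" if "\<Pi> x = - x"
  proof -
    have "y - z = - (y + z)"
      using that 1 pinv_eq by metis
    then have "(2::complex) *\<^sub>C y = 0"
      using scaleC_add_left[of 1 1 y]
      by (simp add: scaleC_one algebra_simps) (metis add.left_inverse)
    then show ?thesis
      using 1 by simp
  qed
  moreover have "\<Pi> x = - x" if "x \<in> odd_vectors"
    using pinv_eq[OF even_vectors_zero that] by simp
  ultimately show ?thesis by blast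
qed

abbreviation sgn1 :: "nat \<Rightarrow> complex" where "sgn1 n \<equiv> (- 1) ^ n"

lemma sgn1_mult_self [simp]: "sgn1 n * sgn1 n = 1"
  by (simp flip: power_add)

lemma pinv_homogeneous_iff: "\<Pi> x = sgn1 p *\<^sub>C x \<longleftrightarrow> x \<in> homogeneous_vectors p"
  by (auto simp: homogeneous_vectors_def pinv_even_iff pinv_odd_iff scaleC_one
      minus_one_power_iff)

text \<open>Replaces inclusions between homogeneous subspaces by one identity that is linear in
  \<open>A\<close> and passes through sums and compositions. A general vector is split into its even
  and odd part.\<close>

lemma operator_homogeneous_iff:
  assumes "is_endo A"
  shows "operator_homogeneous p A \<longleftrightarrow> (\<forall>v. \<Pi> (A (\<Pi> v)) = sgn1 p *\<^sub>C A v)"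
proof
  assume hom: "operator_homogeneous p A"
  have *: "\<Pi> (A (\<Pi> x)) = sgn1 p *\<^sub>C A x" if "x \<in> homogeneous_vectors q" for x q
  proof -
    have "A x \<in> homogeneous_vectors (p + q)"
      using hom that by (auto simp: operator_homogeneous_def)
    then have "\<Pi> (A x) = sgn1 (p + q) *\<^sub>C A x"
      by (simp only: pinv_homogeneous_iff)
    moreover have "\<Pi> x = sgn1 q *\<^sub>C x"
      using that by (simp only: pinv_homogeneous_iff)
    ultimately show ?thesis
      by (simp add: endo_scale[OF assms] endo_scale[OF is_endo_pinv] scaleC_scaleC power_add
          mult.left_commute)
  qed
  show "\<forall>v. \<Pi> (A (\<Pi> v)) = sgn1 p *\<^sub>C A v"
  proof
    fix v :: 'a
    obtain y z where v: "v = y + z" "y \<in> even_vectors" "z \<in> odd_vectors"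
      by (rule even_odd_cases)
    then have "y \<in> homogeneous_vectors 0" "z \<in> homogeneous_vectors 1"
      by (auto simp: homogeneous_vectors_def)
    from *[OF this(1)] *[OF this(2)] show "\<Pi> (A (\<Pi> v)) = sgn1 p *\<^sub>C A v"
      by (simp add: v endo_add[OF is_endo_pinv] endo_add[OF assms] scaleC_add_right)
  qed
next
  assume *: "\<forall>v. \<Pi> (A (\<Pi> v)) = sgn1 p *\<^sub>C A v"
  show "operator_homogeneous p A"
    unfolding operator_homogeneous_def
  proof safe
    fix q and x :: 'a assume "x \<in> homogeneous_vectors q"
    then have "\<Pi> x = sgn1 q *\<^sub>C x"
      by (simp only: pinv_homogeneous_iff)
    moreover have "\<Pi> (A x) = sgn1 p *\<^sub>C A (\<Pi> x)"
      using *[rule_format, of "\<Pi> x"] by simp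
    ultimately have "\<Pi> (A x) = sgn1 (p + q) *\<^sub>C A x"
      by (simp add: endo_scale[OF assms] scaleC_scaleC power_add)
    then show "A x \<in> homogeneous_vectors (p + q)"
      by (simp only: pinv_homogeneous_iff)
  qed
qed

text \<open>The power of the parity involution that accompanies a product of \<open>k\<close> odd generators.\<close>

definition pin :: "nat \<Rightarrow> 'u::superspace operator" where
  "pin k = (if even k then id else \<Pi>)"

lemma pin_0 [simp]: "pin 0 = id"
  by (simp add: pin_def)

lemma is_endo_pin: "is_endo (pin k)"
  by (simp add: pin_def is_endo_pinv is_endo_id)

lemma pin_pin: "pin j (pin k v) = pin (j + k) v"
  by (auto simp: pin_def)

lemma pin_self [simp]: "pin k (pin k v) = v"
  by (auto simp: pin_def)

lemma twist_eq: "twist k A v = pin k (A (pin k v))"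
  by (simp add: twist_def pin_def)

lemma pin_eq_iff [simp]: "pin k v = pin k w \<longleftrightarrow> v = w"
  by (metis pin_self)

lemma pin_eq_0_iff [simp]: "pin k v = 0 \<longleftrightarrow> v = 0"
  by (metis pin_self endo_zero is_endo_pin)

lemma pin_cong_parity: "even j = even k \<Longrightarrow> pin j = pin k"
  by (simp add: pin_def)


section \<open>Sums with finitely many nonzero terms\<close>

lemma Sum_any_reindex:
  assumes "inj h" and "\<And>i. i \<notin> range h \<Longrightarrow> f i = 0"
  shows "Sum_any f = Sum_any (\<lambda>j. f (h j))"
proof -
  have "{i. f i \<noteq> 0} = h ` {j. f (h j) \<noteq> 0}"
    using assms(2) by (auto simp: image_iff) (metis rangeE)
  then show ?thesis
    using assms(1) by (simp add: Sum_any.expand_set sum.reindex inj_on_subset)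
qed

text \<open>The index sets need not be in bijection: \<open>h\<close> has to reach only the support
  of \<open>f\<close>. All changes of summation indices below have this form.\<close>

lemma Sum_any_reindex_inv:
  assumes "\<And>j. g (h j) = j" and "\<And>i. f i \<noteq> 0 \<Longrightarrow> h (g i) = i"
  shows "Sum_any f = Sum_any (\<lambda>j. f (h j))"
  by (rule Sum_any_reindex) (metis assms(1) injI, metis assms(2) rangeI)

lemma Sum_any_pair:
  assumes "finite {(i, j). f i j \<noteq> 0}"
  shows "Sum_any (\<lambda>i. Sum_any (f i)) = Sum_any (\<lambda>(i, j). f i j)"
proof (rule Sum_any.cartesian_product)
  have "{i. \<exists>j. f i j \<noteq> 0} \<subseteq> fst ` {(i, j). f i j \<noteq> 0}"
    "{j. \<exists>i. f i j \<noteq> 0} \<subseteq> snd ` {(i, j). f i j \<noteq> 0}"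
    by force+
  then show "finite ({i. \<exists>j. f i j \<noteq> 0} \<times> {j. \<exists>i. f i j \<noteq> 0})"
    using assms by (intro finite_cartesian_product) (auto elim: finite_subset)
qed simp

lemma endo_Sum_any:
  assumes "is_endo A" and "finite {i. f i \<noteq> 0}"
  shows "A (Sum_any f) = Sum_any (\<lambda>i. A (f i))"
proof -
  have "{i. A (f i) \<noteq> 0} \<subseteq> {i. f i \<noteq> 0}"
    using endo_zero[OF assms(1)] by auto
  then show ?thesis
    using assms by (simp add: Sum_any.expand_superset[of "{i. f i \<noteq> 0}"] endo_sum)
qed

lemma Sum_any_add:
  "finite {i. f i \<noteq> 0} \<Longrightarrow> finite {i. g i \<noteq> 0} \<Longrightarrow>
    Sum_any (\<lambda>i. f i + g i) = Sum_any f + Sum_any g"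
  by (rule Sum_any.distrib)

lemma Sum_any_single:
  assumes "\<And>i. i \<noteq> a \<Longrightarrow> f i = 0"
  shows "Sum_any f = f a"
proof -
  have "{i. f i \<noteq> 0} \<subseteq> {a}"
    using assms by auto
  then show ?thesis
    by (simp add: Sum_any.expand_superset[of "{a}"])
qed

section \<open>The cocycle of the odd generators\<close>

text \<open>The generators left in a product of two monomials: those common to both factors are
  squared away.\<close>

definition symdiff :: "'a set \<Rightarrow> 'a set \<Rightarrow> 'a set" (infixl \<open>\<triangle>\<close> 65) where
  "S \<triangle> T = (S - T) \<union> (T - S)"

lemma finite_symdiff [simp]: "finite S \<Longrightarrow> finite T \<Longrightarrow> finite (S \<triangle> T)"
  by (simp add: symdiff_def)

lemma symdiff_assoc: "(S \<triangle> T) \<triangle> U = S \<triangle> (T \<triangle> U)"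
  by (auto simp: symdiff_def)

lemma even_card_symdiff:
  assumes "finite S" "finite T"
  shows "even (card (S \<triangle> T)) \<longleftrightarrow> even (card S + card T)"
proof -
  have "card (S \<triangle> T) = card (S - T) + card (T - S)"
    unfolding symdiff_def using assms by (intro card_Un_disjoint) auto
  moreover have "card S = card (S - T) + card (S \<inter> T)"
    using card_Int_Diff[OF assms(1), of T] by simp
  moreover have "card T = card (T - S) + card (S \<inter> T)"
    using card_Int_Diff[OF assms(2), of S] by (simp add: Int_commute)
  ultimately show ?thesis by simp blast
qed

text \<open>Common elements contribute \<open>f x * f x = 1\<close> on the right and nothing on the
  left.\<close>

lemma prod_symdiff:
  fixes f :: "'a \<Rightarrow> complex"
  assumes "finite S" "finite T" and "\<And>x. f x * f x = 1"
  shows "prod f (S \<triangle> T) = prod f S * prod f T"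
proof -
  have "prod f (S \<triangle> T) = prod f (S - T) * prod f (T - S)"
    unfolding symdiff_def using assms by (intro prod.union_disjoint) auto
  moreover have "prod f S = prod f (S \<inter> T) * prod f (S - T)"
    using assms by (subst prod.union_disjoint[symmetric]) (auto intro: prod.cong)
  moreover have "prod f T = prod f (S \<inter> T) * prod f (T - S)"
    using assms by (subst prod.union_disjoint[symmetric]) (auto intro: prod.cong)
  moreover have "prod f (S \<inter> T) * prod f (S \<inter> T) = 1"
    using assms(3) by (simp flip: prod.distrib)
  ultimately show ?thesis
    by (simp add: mult.assoc mult.left_commute)
qed

text \<open>The sign of sorting the word \<open>S\<close> followed by \<open>T\<close>, as a count
  of inversions.\<close>

definition swap_sign :: "generator set \<Rightarrow> generator set \<Rightarrow> complex" where
  "swap_sign S T = (- 1) ^ card {(g, h) \<in> S \<times> T. precedes h g}"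

lemma swap_sign_eq_prod:
  assumes "finite S" "finite T"
  shows "swap_sign S T = (\<Prod>g\<in>S. \<Prod>h\<in>T. if precedes h g then - 1 else 1)"
proof -
  have "(\<Prod>g\<in>S. \<Prod>h\<in>T. if precedes h g then - 1 else 1)
      = (\<Prod>p\<in>S \<times> T. if precedes (snd p) (fst p) then - 1 else 1 :: complex)"
    by (simp add: prod.cartesian_product split_def)
  also have "\<dots> = (\<Prod>p\<in>{p \<in> S \<times> T. precedes (snd p) (fst p)}. - 1)"
    using assms by (subst prod.inter_filter) auto
  also have "\<dots> = (- 1) ^ card {p \<in> S \<times> T. precedes (snd p) (fst p)}"
    by simp
  also have "{p \<in> S \<times> T. precedes (snd p) (fst p)} = {(g, h) \<in> S \<times> T. precedes h g}"
    by auto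
  finally show ?thesis by (simp add: swap_sign_def)
qed

lemma swap_sign_empty [simp]: "swap_sign {} T = 1" "swap_sign S {} = 1"
  by (simp_all add: swap_sign_def)

text \<open>The sign is a bicharacter on the group of finite sets under symmetric difference, being
  a product of signs over pairs.\<close>

lemma swap_sign_symdiff_left:
  assumes "finite S" "finite S'" "finite T"
  shows "swap_sign (S \<triangle> S') T = swap_sign S T * swap_sign S' T"
proof -
  have "(\<Prod>h\<in>T. c h :: complex) * (\<Prod>h\<in>T. c h) = 1" if "\<And>h. c h * c h = 1" for c
    using that by (simp flip: prod.distrib)
  then show ?thesis
    using assms by (simp add: swap_sign_eq_prod prod_symdiff)
qed

lemma swap_sign_symdiff_right:
  assumes "finite S" "finite T" "finite T'"
  shows "swap_sign S (T \<triangle> T') = swap_sign S T * swap_sign S T'"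
  using assms by (simp add: swap_sign_eq_prod prod_symdiff flip: prod.distrib)

lemma symdiff_disjoint: "S \<inter> T = {} \<Longrightarrow> S \<triangle> T = S \<union> T"
  by (auto simp: symdiff_def)

lemma precedes_total: "g \<noteq> h \<Longrightarrow> precedes g h \<longleftrightarrow> \<not> precedes h g"
  by (cases g; cases h) auto

text \<open>Each of the \<open>card S * card T\<close> pairs is inverted in exactly one of the two
  orders.\<close>

lemma swap_sign_commute:
  assumes "finite S" "finite T" "S \<inter> T = {}"
  shows "swap_sign T S = sgn1 (card S * card T) * swap_sign S T"
proof -
  have "swap_sign S T * swap_sign T S = (\<Prod>g\<in>S. \<Prod>h\<in>T.
      (if precedes h g then - 1 else 1) * (if precedes g h then - 1 else 1))"
    using assms(1,2) prod.swap[of "\<lambda>g h. if precedes h g then - 1 else 1 :: complex" S T]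
    by (simp add: swap_sign_eq_prod prod.swap[of _ T S] prod.distrib)
  also have "\<dots> = (\<Prod>g\<in>S. \<Prod>h\<in>T. - 1)"
  proof (intro prod.cong refl)
    fix g h assume "g \<in> S" "h \<in> T"
    then have "precedes g h \<longleftrightarrow> \<not> precedes h g"
      using assms(3) by (intro precedes_total) auto
    then show "(if precedes h g then - 1 else 1) * (if precedes g h then - 1 else 1) = (- 1 :: complex)"
      by simp
  qed
  also have "\<dots> = sgn1 (card S * card T)"
    by (simp add: mult.commute flip: power_mult)
  finally have *: "swap_sign S T * swap_sign T S = sgn1 (card S * card T)" .
  have "swap_sign S T * swap_sign S T = 1"
    by (simp add: swap_sign_def)
  then show ?thesis
    using * by (metis mult.assoc mult.commute mult_1)
qed

definition square_factor :: "supercase \<Rightarrow> generator set \<Rightarrow> complex" where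
  "square_factor \<kappa> S = (\<Prod>g\<in>S. gen_square \<kappa> g)"

text \<open>The structure constant of the product of two ordered monomials;
  \<open>cocycle_assoc\<close> is the 2-cocycle identity of this twisted group algebra.\<close>

definition cocycle :: "supercase \<Rightarrow> generator set \<Rightarrow> generator set \<Rightarrow> complex" where
  "cocycle \<kappa> S T = swap_sign S T * square_factor \<kappa> (S \<inter> T)"

lemma cocycle_empty [simp]: "cocycle \<kappa> {} T = 1" "cocycle \<kappa> S {} = 1"
  by (simp_all add: cocycle_def square_factor_def)

text \<open>In either bracketing of a triple product the generators squared away are those lying in
  at least two of the three sets, each exactly once. Both the exponent of \<lambda> and the factor
  from the squares are therefore associative.\<close>

lemma
  shows pairwise_Int_left: "(S \<inter> T) \<union> ((S \<triangle> T) \<inter> U) = (S \<inter> T) \<union> (S \<inter> U) \<union> (T \<inter> U)"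
    and pairwise_Int_right: "(T \<inter> U) \<union> (S \<inter> (T \<triangle> U)) = (S \<inter> T) \<union> (S \<inter> U) \<union> (T \<inter> U)"
    and disjoint_Int_left: "(S \<inter> T) \<inter> ((S \<triangle> T) \<inter> U) = {}"
    and disjoint_Int_right: "(T \<inter> U) \<inter> (S \<inter> (T \<triangle> U)) = {}"
  by (auto simp: symdiff_def)

lemma card_Int_assoc:
  assumes "finite S" "finite T" "finite U"
  shows "card (S \<inter> T) + card ((S \<triangle> T) \<inter> U) = card (T \<inter> U) + card (S \<inter> (T \<triangle> U))"
proof -
  have "card (S \<inter> T) + card ((S \<triangle> T) \<inter> U) = card ((S \<inter> T) \<union> ((S \<triangle> T) \<inter> U))"
    using assms disjoint_Int_left[of S T U] by (intro card_Un_disjoint[symmetric]) auto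
  also have "\<dots> = card ((T \<inter> U) \<union> (S \<inter> (T \<triangle> U)))"
    by (simp only: pairwise_Int_left pairwise_Int_right)
  also have "\<dots> = card (T \<inter> U) + card (S \<inter> (T \<triangle> U))"
    using assms disjoint_Int_right[of T U S] by (intro card_Un_disjoint) auto
  finally show ?thesis .
qed

text \<open>The sorting signs agree because they form a bicharacter; for the squares see the two
  decompositions of the set of repeated generators.\<close>

lemma cocycle_assoc:
  assumes "finite S" "finite T" "finite U"
  shows "cocycle \<kappa> S T * cocycle \<kappa> (S \<triangle> T) U = cocycle \<kappa> T U * cocycle \<kappa> S (T \<triangle> U)"
proof -
  have "square_factor \<kappa> (S \<inter> T) * square_factor \<kappa> ((S \<triangle> T) \<inter> U)
      = square_factor \<kappa> ((S \<inter> T) \<union> ((S \<triangle> T) \<inter> U))"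
    unfolding square_factor_def using assms disjoint_Int_left[of S T U]
    by (intro prod.union_disjoint[symmetric]) auto
  also have "\<dots> = square_factor \<kappa> ((T \<inter> U) \<union> (S \<inter> (T \<triangle> U)))"
    by (simp only: pairwise_Int_left pairwise_Int_right)
  also have "\<dots> = square_factor \<kappa> (T \<inter> U) * square_factor \<kappa> (S \<inter> (T \<triangle> U))"
    unfolding square_factor_def using assms disjoint_Int_right[of T U S]
    by (intro prod.union_disjoint) auto
  finally show ?thesis
    using assms by (simp add: cocycle_def swap_sign_symdiff_left swap_sign_symdiff_right mult_ac)
qed


section \<open>The ring of operator-valued series in the parameter and the odd generators\<close>

text \<open>The pair \<open>(k, S)\<close> stands for \<open>\<lambda>^k\<close> times the ordered product of the generators in \<open>S\<close>.\<close>

type_synonym odd_monomial = "nat \<times> generator set"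

text \<open>Every repeated generator raises the power of \<lambda> by one. Where its square is zero
  this exponent is harmless, since the coefficient in \<open>cocycle\<close> vanishes.\<close>

definition om_times :: "odd_monomial \<Rightarrow> odd_monomial \<Rightarrow> odd_monomial" where
  "om_times s t = (fst s + fst t + card (snd s \<inter> snd t), snd s \<triangle> snd t)"

lemma om_times_empty [simp]: "om_times (0, {}) t = t" "om_times t (0, {}) = t"
  by (simp_all add: om_times_def symdiff_def)

lemma om_times_assoc:
  assumes "finite (snd s)" "finite (snd t)" "finite (snd u)"
  shows "om_times (om_times s t) u = om_times s (om_times t u)"
  using card_Int_assoc[OF assms] by (simp add: om_times_def symdiff_assoc)

text \<open>Powers of \<lambda> never drop in a product, so a bound on the power in a product bounds
  it in the factors. All finiteness arguments for products use this.\<close>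

lemma om_times_le: "fst s \<le> fst (om_times s t)" "fst t \<le> fst (om_times s t)"
  by (simp_all add: om_times_def)

class case_index =
  fixes index_case :: "'a itself \<Rightarrow> supercase"

text \<open>Finiteness is asked only on one vector and up to a bounded power of \<lambda>: that is
  all that sums over modes and the exponential offer, and it survives composition. Infinite
  generator sets are excluded because their cardinality, hence any sign, is meaningless.\<close>

definition locally_finite :: "(odd_monomial \<Rightarrow> 'u::superspace operator) \<Rightarrow> bool" where
  "locally_finite F \<longleftrightarrow> (\<forall>t. is_endo (F t)) \<and> (\<forall>t. infinite (snd t) \<longrightarrow> F t = 0) \<and>
     (\<forall>k v. finite {t. fst t \<le> k \<and> F t v \<noteq> 0})"

text \<open>The phantom type \<open>'k\<close> selects the relations of the generators, so that both cases give
  rings in the sense of type classes. The component at \<open>(k, S)\<close> is \<open>\<Pi>\<^sup>|\<^sup>S\<^sup>|\<close> composed with the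
  coefficient of the monomial: in these coordinates no sign arises from moving an operator past
  odd generators.\<close>

typedef (overloaded) ('k, 'u) opseries =
    "{F :: odd_monomial \<Rightarrow> 'u::superspace operator. locally_finite F}"
  morphisms coef Opseries
  by (rule exI[of _ 0]) (simp add: locally_finite_def is_endo_zero)

lemma coef_Opseries: "locally_finite F \<Longrightarrow> coef (Opseries F) = F"
  by (simp add: Opseries_inverse)

lemma locally_finite_coef: "locally_finite (coef x)"
  using coef by auto

lemma is_endo_coef: "is_endo (coef x t)"
  and coef_infinite: "infinite (snd t) \<Longrightarrow> coef x t = 0"
  and finite_coef: "finite {t. fst t \<le> k \<and> coef x t v \<noteq> 0}"
  using locally_finite_coef[of x] unfolding locally_finite_def by blast+

lemma opseries_eqI: "(\<And>k S v. finite S \<Longrightarrow> coef x (k, S) v = coef y (k, S) v) \<Longrightarrow> x = y"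
  by (metis coef_inject coef_infinite ext prod.collapse)

lemmas coef_zero [simp] = endo_zero[OF is_endo_coef]
lemmas coef_scale = endo_scale[OF is_endo_coef]

lemma coef_finite: "coef x t v \<noteq> 0 \<Longrightarrow> finite (snd t)"
  using coef_infinite[of t x] by fastforce

text \<open>On \<open>v\<close> the series \<open>y\<close> yields finitely many vectors, and on
  each of these \<open>x\<close> has finitely many terms.\<close>

lemma finite_coef2:
  "finite {(s, t). fst s \<le> k \<and> fst t \<le> k \<and> coef x s (coef y t v) \<noteq> 0}"
proof -
  let ?B = "{t. fst t \<le> k \<and> coef y t v \<noteq> 0}"
  have "{(s, t). fst s \<le> k \<and> fst t \<le> k \<and> coef x s (coef y t v) \<noteq> 0}
      \<subseteq> (\<Union>t\<in>?B. (\<lambda>s. (s, t)) ` {s. fst s \<le> k \<and> coef x s (coef y t v) \<noteq> 0})"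
    by (auto simp: image_iff)
  then show ?thesis
    by (rule finite_subset) (intro finite_UN_I finite_imageI finite_coef)
qed

lemma finite_coef3:
  "finite {(r, s, t). fst r \<le> k \<and> fst s \<le> k \<and> fst t \<le> k \<and> coef x r (coef y s (coef z t v)) \<noteq> 0}"
proof -
  let ?B = "{t. fst t \<le> k \<and> coef z t v \<noteq> 0}"
  have "{(r, s, t). fst r \<le> k \<and> fst s \<le> k \<and> fst t \<le> k \<and> coef x r (coef y s (coef z t v)) \<noteq> 0}
      \<subseteq> (\<Union>t\<in>?B. (\<lambda>(r, s). (r, s, t)) `
          {(r, s). fst r \<le> k \<and> fst s \<le> k \<and> coef x r (coef y s (coef z t v)) \<noteq> 0})"
    by (auto simp: image_iff)
  then show ?thesis
    by (rule finite_subset) (intro finite_UN_I finite_imageI finite_coef finite_coef2)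
qed

instantiation opseries :: (case_index, superspace) "{ab_group_add, times, one}"
begin

definition "0 = Opseries (\<lambda>t v. 0)"
definition "x + y = Opseries (\<lambda>t v. coef x t v + coef y t v)"
definition "- x = Opseries (\<lambda>t v. - coef x t v)"
definition "x - y = Opseries (\<lambda>t v. coef x t v - coef y t v)"
definition "1 = Opseries (\<lambda>t. if t = (0, {}) then id else 0)"
definition times_opseries :: "('a, 'b) opseries \<Rightarrow> ('a, 'b) opseries \<Rightarrow> ('a, 'b) opseries" where
  "x * y = Opseries (\<lambda>u v. Sum_any (\<lambda>(s, t). if om_times s t = u
     then cocycle (index_case TYPE('a)) (snd s) (snd t) *\<^sub>C coef x s (coef y t v) else 0))"

lemma coef_0' [simp]: "coef (0 :: ('a, 'b) opseries) t v = 0"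
  unfolding zero_opseries_def
  by (subst coef_Opseries) (auto simp: locally_finite_def is_endo_iff fun_eq_iff)

lemma coef_plus' [simp]: "coef (x + y :: ('a, 'b) opseries) t v = coef x t v + coef y t v"
  unfolding plus_opseries_def
proof (subst coef_Opseries)
  have "finite {t. fst t \<le> k \<and> coef x t v + coef y t v \<noteq> 0}" for k v
    by (rule finite_subset[OF _ finite_UnI[OF finite_coef[of k x v] finite_coef[of k y v]]]) auto
  then show "locally_finite (\<lambda>t v. coef x t v + coef y t v)"
    by (auto simp: locally_finite_def is_endo_iff fun_eq_iff coef_infinite
      endo_add[OF is_endo_coef] coef_scale scaleC_add_right)
qed simp

lemma coef_uminus' [simp]: "coef (- x :: ('a, 'b) opseries) t v = - coef x t v"
  unfolding uminus_opseries_def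
  using finite_coef[of _ x]
  by (subst coef_Opseries) (auto simp: locally_finite_def is_endo_iff fun_eq_iff coef_infinite
      endo_add[OF is_endo_coef] coef_scale)

lemma minus_opseries_eq: "x - y = x + (- y :: ('a, 'b) opseries)"
  by (simp add: minus_opseries_def plus_opseries_def)

instance
  by standard (auto intro!: opseries_eqI simp: minus_opseries_eq)

end

lemma coef_0 [simp]: "coef 0 t v = 0"
  by (rule coef_0')

lemma coef_plus [simp]: "coef (x + y) t v = coef x t v + coef y t v"
  by (rule coef_plus')

lemma coef_uminus [simp]: "coef (- x) t v = - coef x t v"
  by (rule coef_uminus')

lemma coef_minus [simp]: "coef (x - y) t v = coef x t v - coef y t v"
  by (simp only: minus_opseries_eq coef_plus coef_uminus) simp

lemma coef_sum: "coef (sum f I) t v = (\<Sum>i\<in>I. coef (f i) t v)"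
  by (induction I rule: infinite_finite_induct) auto

lemma coef_1: "coef (1 :: ('k::case_index, 'u::superspace) opseries) t v = (if t = (0, {}) then v else 0)"
proof -
  have fin: "finite {t. fst t \<le> k \<and> (if t = (0, {}) then id else 0) v \<noteq> (0::'u)}"
    for k and v :: 'u
    by (rule finite_subset[of _ "{(0, {})}"]) auto
  have "locally_finite (\<lambda>t. if t = (0, {}) then id else (0 :: 'u operator))"
    unfolding locally_finite_def using fin by (simp add: is_endo_id is_endo_zero)
  then show ?thesis
    by (simp add: one_opseries_def coef_Opseries)
qed

lemma finite_product_terms:
  "finite {p. (case p of (s, t) \<Rightarrow>
    if om_times s t = u then c s t *\<^sub>C coef x s (coef y t v) else 0) \<noteq> 0}"
  by (rule finite_subset[OF _ finite_coef2[of "fst u" x y v]])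
    (auto split: if_splits dest: arg_cong[of _ _ fst] simp: om_times_def scaleC.scale_eq_0_iff)

lemma coef_times:
  fixes x y :: "('k::case_index, 'u::superspace) opseries"
  shows "coef (x * y) u v = Sum_any (\<lambda>(s, t). if om_times s t = u
     then cocycle (index_case TYPE('k)) (snd s) (snd t) *\<^sub>C coef x s (coef y t v) else 0)"
proof -
  let ?F = "\<lambda>u v. Sum_any (\<lambda>(s, t). if om_times s t = u
     then cocycle (index_case TYPE('k)) (snd s) (snd t) *\<^sub>C coef x s (coef y t v) else 0)"
  let ?c = "\<lambda>s t. cocycle (index_case TYPE('k)) (snd s) (snd t)"
  note fin = finite_product_terms[of _ ?c x y, unfolded split_def]
  have "is_endo (?F u)" for u
  proof (rule is_endoI)
    fix v w c
    show "?F u (v + w) = ?F u v + ?F u w"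
      unfolding split_def
      by (subst Sum_any_add[symmetric, OF fin fin], rule Sum_any.cong)
        (auto simp: endo_add[OF is_endo_coef] scaleC_add_right)
    show "?F u (c *\<^sub>C v) = c *\<^sub>C ?F u v"
      unfolding split_def
      by (subst endo_Sum_any[OF is_endo_scale fin], rule Sum_any.cong)
        (auto simp: coef_scale scaleC_scaleC mult.commute)
  qed
  moreover have "?F u = 0" if "infinite (snd u)" for u
  proof
    fix v
    have "(\<lambda>(s, t). if om_times s t = u then ?c s t *\<^sub>C coef x s (coef y t v) else 0) = (\<lambda>_. 0)"
    proof (rule ext, safe)
      fix s t :: odd_monomial
      have "coef x s (coef y t v) = 0" if "om_times s t = u"
        using \<open>infinite (snd u)\<close> that[symmetric] coef_infinite[of s x] coef_infinite[of t y]
        by (cases "finite (snd s)"; cases "finite (snd t)") (auto simp: om_times_def)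
      then show "(if om_times s t = u then ?c s t *\<^sub>C coef x s (coef y t v) else 0) = 0"
        by simp
    qed
    then show "?F u v = 0 v"
      by simp
  qed
  moreover have "finite {u. fst u \<le> k \<and> ?F u v \<noteq> 0}" for k v
  proof (rule finite_subset)
    show "{u. fst u \<le> k \<and> ?F u v \<noteq> 0} \<subseteq> (\<lambda>(s, t). om_times s t) `
        {(s, t). fst s \<le> k \<and> fst t \<le> k \<and> coef x s (coef y t v) \<noteq> 0}"
    proof
      fix u assume u: "u \<in> {u. fst u \<le> k \<and> ?F u v \<noteq> 0}"
      then obtain p where p: "(case p of (s, t) \<Rightarrow> if om_times s t = u
          then ?c s t *\<^sub>C coef x s (coef y t v) else 0) \<noteq> 0"
        using Sum_any.not_neutral_obtains_not_neutral by (metis (mono_tags, lifting) mem_Collect_eq)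
      then show "u \<in> (\<lambda>(s, t). om_times s t) `
          {(s, t). fst s \<le> k \<and> fst t \<le> k \<and> coef x s (coef y t v) \<noteq> 0}"
        using u om_times_le(1)[of "fst p" "snd p"] om_times_le(2)[of "snd p" "fst p"]
        by (intro image_eqI[of _ _ p]) (auto split: prod.splits if_splits)
    qed
  qed (intro finite_imageI finite_coef2)
  ultimately have "locally_finite ?F"
    by (auto simp: locally_finite_def)
  then show ?thesis
    unfolding times_opseries_def by (simp only: coef_Opseries)
qed

text \<open>Both sides are brought to one sum over triples of monomials. The nested sums flatten
  because finitely many triples contribute, and the coefficients agree by
  \<open>cocycle_assoc\<close>.\<close>

lemma opseries_mult_assoc:
  fixes x y z :: "('k::case_index, 'u::superspace) opseries"
  shows "(x * y) * z = x * (y * z)"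
proof (rule opseries_eqI)
  fix k :: nat and S :: "generator set" and v :: 'u
  let ?u = "(k, S)"
  define c where "c = (\<lambda>(s :: odd_monomial) (t :: odd_monomial). cocycle (index_case TYPE('k)) (snd s) (snd t))"
  define T where "T = (\<lambda>(r, s, t). if om_times (om_times r s) t = ?u
    then (c r s * c (om_times r s) t) *\<^sub>C coef x r (coef y s (coef z t v)) else 0)"
  have ct: "coef (x * y) u v = Sum_any (\<lambda>(s, t). if om_times s t = u
     then c s t *\<^sub>C coef x s (coef y t v) else 0)" for x y :: "('k, 'u) opseries" and u v
    unfolding coef_times c_def ..
  have fin_c: "finite (snd r)" "finite (snd s)" "finite (snd t)"
    if "coef x r (coef y s (coef z t v)) \<noteq> 0" for r s t
    using that coef_finite by (metis coef_zero)+
  have "coef ((x * y) * z) ?u v = Sum_any (\<lambda>p. Sum_any (\<lambda>q.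
      if om_times (fst p) (snd p) = ?u \<and> om_times (fst q) (snd q) = fst p
      then (c (fst q) (snd q) * c (fst p) (snd p)) *\<^sub>C
        coef x (fst q) (coef y (snd q) (coef z (snd p) v)) else 0))"
    unfolding ct[of "x * y"] split_def
  proof (rule Sum_any.cong)
    fix p :: "odd_monomial \<times> odd_monomial"
    show "(if om_times (fst p) (snd p) = ?u
          then c (fst p) (snd p) *\<^sub>C coef (x * y) (fst p) (coef z (snd p) v) else 0)
      = Sum_any (\<lambda>q. if om_times (fst p) (snd p) = ?u \<and> om_times (fst q) (snd q) = fst p
      then (c (fst q) (snd q) * c (fst p) (snd p)) *\<^sub>C
        coef x (fst q) (coef y (snd q) (coef z (snd p) v)) else 0)"
      unfolding ct[of x y] split_def
      by (subst endo_Sum_any[OF is_endo_scale finite_product_terms[unfolded split_def]])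
        (auto intro!: Sum_any.cong simp: scaleC_scaleC mult.commute)
  qed
  also have "\<dots> = Sum_any (\<lambda>(p, q).
      if om_times (fst p) (snd p) = ?u \<and> om_times (fst q) (snd q) = fst p
      then (c (fst q) (snd q) * c (fst p) (snd p)) *\<^sub>C
        coef x (fst q) (coef y (snd q) (coef z (snd p) v)) else 0)"
  \<comment> \<open>Here p = (rs, t) and q = (r, s); the first entry of p is determined by q, so
    contributing pairs are images of contributing triples.\<close>
  proof (rule Sum_any_pair, rule finite_subset)
    show "finite ((\<lambda>(r, s, t). ((om_times r s, t), (r, s))) ` {(r, s, t). fst r \<le> k \<and> fst s \<le> k
        \<and> fst t \<le> k \<and> coef x r (coef y s (coef z t v)) \<noteq> 0})"
      by (intro finite_imageI finite_coef3)
  next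
    show "{(p, q). (if om_times (fst p) (snd p) = ?u \<and> om_times (fst q) (snd q) = fst p
      then (c (fst q) (snd q) * c (fst p) (snd p)) *\<^sub>C
        coef x (fst q) (coef y (snd q) (coef z (snd p) v)) else 0) \<noteq> 0} \<subseteq> (\<lambda>(r, s, t). ((om_times r s, t), (r, s))) ` {(r, s, t). fst r \<le> k \<and> fst s \<le> k
        \<and> fst t \<le> k \<and> coef x r (coef y s (coef z t v)) \<noteq> 0}"
    proof (rule subsetI, clarify)
      fix a b a' b' c1 d1 c2 d2
      let ?p = "((a, b), (a', b')) :: odd_monomial \<times> odd_monomial"
      let ?q = "((c1, d1), (c2, d2)) :: odd_monomial \<times> odd_monomial"
      assume ne: "(if om_times (fst ?p) (snd ?p) = ?u \<and> om_times (fst ?q) (snd ?q) = fst ?p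
      then (c (fst ?q) (snd ?q) * c (fst ?p) (snd ?p)) *\<^sub>C
        coef x (fst ?q) (coef y (snd ?q) (coef z (snd ?p) v)) else 0) \<noteq> 0"
      show "(?p, ?q) \<in> (\<lambda>(r, s, t). ((om_times r s, t), (r, s))) ` {(r, s, t). fst r \<le> k \<and> fst s \<le> k
        \<and> fst t \<le> k \<and> coef x r (coef y s (coef z t v)) \<noteq> 0}"
        using ne by (intro image_eqI[of _ _ "(fst ?q, snd ?q, snd ?p)"])
          (auto simp: om_times_def split: if_splits)
    qed
  qed
  also have "\<dots> = Sum_any T"
    by (subst Sum_any_reindex_inv[of "\<lambda>(p, q). (fst q, snd q, snd p)"
          "\<lambda>(r, s, t). ((om_times r s, t), (r, s))"])
      (auto simp: T_def intro!: Sum_any.cong split: if_splits)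
  finally have left: "coef ((x * y) * z) ?u v = Sum_any T" .
  have "coef (x * (y * z)) ?u v = Sum_any (\<lambda>p. Sum_any (\<lambda>q.
      if om_times (fst p) (snd p) = ?u \<and> om_times (fst q) (snd q) = snd p
      then (c (fst q) (snd q) * c (fst p) (snd p)) *\<^sub>C
        coef x (fst p) (coef y (fst q) (coef z (snd q) v)) else 0))"
    unfolding ct[of x "y * z"] split_def
  proof (rule Sum_any.cong)
    fix p :: "odd_monomial \<times> odd_monomial"
    show "(if om_times (fst p) (snd p) = ?u
          then c (fst p) (snd p) *\<^sub>C coef x (fst p) (coef (y * z) (snd p) v) else 0)
      = Sum_any (\<lambda>q. if om_times (fst p) (snd p) = ?u \<and> om_times (fst q) (snd q) = snd p
      then (c (fst q) (snd q) * c (fst p) (snd p)) *\<^sub>C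
        coef x (fst p) (coef y (fst q) (coef z (snd q) v)) else 0)"
      unfolding ct[of y z] split_def
      by (subst endo_Sum_any[OF is_endo_comp[OF is_endo_scale is_endo_coef],
            unfolded comp_def, OF finite_product_terms[unfolded split_def]])
        (auto intro!: Sum_any.cong simp: scaleC_scaleC coef_scale mult.commute)
  qed
  also have "\<dots> = Sum_any (\<lambda>(p, q).
      if om_times (fst p) (snd p) = ?u \<and> om_times (fst q) (snd q) = snd p
      then (c (fst q) (snd q) * c (fst p) (snd p)) *\<^sub>C
        coef x (fst p) (coef y (fst q) (coef z (snd q) v)) else 0)"
  proof (rule Sum_any_pair, rule finite_subset)
    show "finite ((\<lambda>(r, s, t). ((r, om_times s t), (s, t))) ` {(r, s, t). fst r \<le> k \<and> fst s \<le> k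
        \<and> fst t \<le> k \<and> coef x r (coef y s (coef z t v)) \<noteq> 0})"
      by (intro finite_imageI finite_coef3)
  next
    show "{(p, q). (if om_times (fst p) (snd p) = ?u \<and> om_times (fst q) (snd q) = snd p
      then (c (fst q) (snd q) * c (fst p) (snd p)) *\<^sub>C
        coef x (fst p) (coef y (fst q) (coef z (snd q) v)) else 0) \<noteq> 0} \<subseteq> (\<lambda>(r, s, t). ((r, om_times s t), (s, t))) ` {(r, s, t). fst r \<le> k \<and> fst s \<le> k
        \<and> fst t \<le> k \<and> coef x r (coef y s (coef z t v)) \<noteq> 0}"
    proof (rule subsetI, clarify)
      fix a b a' b' c1 d1 c2 d2
      let ?p = "((a, b), (a', b')) :: odd_monomial \<times> odd_monomial"
      let ?q = "((c1, d1), (c2, d2)) :: odd_monomial \<times> odd_monomial"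
      assume ne: "(if om_times (fst ?p) (snd ?p) = ?u \<and> om_times (fst ?q) (snd ?q) = snd ?p
      then (c (fst ?q) (snd ?q) * c (fst ?p) (snd ?p)) *\<^sub>C
        coef x (fst ?p) (coef y (fst ?q) (coef z (snd ?q) v)) else 0) \<noteq> 0"
      show "(?p, ?q) \<in> (\<lambda>(r, s, t). ((r, om_times s t), (s, t))) ` {(r, s, t). fst r \<le> k \<and> fst s \<le> k
        \<and> fst t \<le> k \<and> coef x r (coef y s (coef z t v)) \<noteq> 0}"
        using ne by (intro image_eqI[of _ _ "(fst ?p, fst ?q, snd ?q)"])
          (auto simp: om_times_def split: if_splits)
    qed
  qed
  also have "\<dots> = Sum_any (\<lambda>(r, s, t). if om_times r (om_times s t) = ?u
    then (c s t * c r (om_times s t)) *\<^sub>C coef x r (coef y s (coef z t v)) else 0)"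
    by (subst Sum_any_reindex_inv[of "\<lambda>(p, q). (fst p, fst q, snd q)"
          "\<lambda>(r, s, t). ((r, om_times s t), (s, t))"])
      (auto intro!: Sum_any.cong split: if_splits)
  also have "\<dots> = Sum_any T"
  proof (rule Sum_any.cong)
    fix p :: "odd_monomial \<times> odd_monomial \<times> odd_monomial"
    obtain r s t where p: "p = (r, s, t)"
      by (cases p) auto
    show "(case p of (r, s, t) \<Rightarrow> if om_times r (om_times s t) = ?u
      then (c s t * c r (om_times s t)) *\<^sub>C coef x r (coef y s (coef z t v)) else 0) = T p"
    proof (cases "coef x r (coef y s (coef z t v)) = 0")
      case False
      then have "finite (snd r)" "finite (snd s)" "finite (snd t)"
        by (rule fin_c)+
      then show ?thesis
        using cocycle_assoc[of "snd r" "snd s" "snd t"]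
        by (simp add: p T_def om_times_assoc c_def) (simp add: om_times_def)
    qed (simp add: p T_def)
  qed
  finally show "coef ((x * y) * z) ?u v = coef (x * (y * z)) ?u v"
    using left by simp
qed

instance opseries :: (case_index, superspace) "{ring, monoid_mult}"
proof
  fix x y z :: "('a, 'b) opseries"
  show "(x * y) * z = x * (y * z)"
    by (rule opseries_mult_assoc)
  show "(x + y) * z = x * z + y * z"
    by (rule opseries_eqI, simp only: coef_times coef_plus,
        subst Sum_any_add[symmetric, OF finite_product_terms finite_product_terms])
      (auto intro!: Sum_any.cong simp: scaleC_add_right)
  show "x * (y + z) = x * y + x * z"
    by (rule opseries_eqI, simp only: coef_times coef_plus,
        subst Sum_any_add[symmetric, OF finite_product_terms finite_product_terms])
      (auto intro!: Sum_any.cong simp: scaleC_add_right endo_add[OF is_endo_coef])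
  show "1 * x = x"
  proof (rule opseries_eqI)
    fix k S and v :: 'b
    show "coef (1 * x) (k, S) v = coef x (k, S) v"
      unfolding coef_times
      by (subst Sum_any_single[of "((0, {}), (k, S))"]) (auto simp: coef_1 scaleC_one split: if_splits)
  qed
  show "x * 1 = x"
  proof (rule opseries_eqI)
    fix k S and v :: 'b
    show "coef (x * 1) (k, S) v = coef x (k, S) v"
      unfolding coef_times
      by (subst Sum_any_single[of "((k, S), (0, {}))"]) (auto simp: coef_1 scaleC_one split: if_splits)
  qed
qed

section \<open>Monomials and generators\<close>

definition single :: "odd_monomial \<Rightarrow> 'u operator \<Rightarrow> ('k::case_index, 'u::superspace) opseries" where
  "single t A = Opseries (\<lambda>s. if s = t then A else 0)"

lemma coef_single:
  assumes "is_endo A" "finite (snd t)"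
  shows "coef (single t A) s v = (if s = t then A v else 0)"
proof -
  have fin: "finite {s. fst s \<le> k \<and> (if s = t then A else 0) v \<noteq> 0}" for k v
    by (rule finite_subset[of _ "{t}"]) auto
  have "locally_finite (\<lambda>s. if s = t then A else 0)"
    unfolding locally_finite_def using fin assms by (cases t) (auto simp: is_endo_zero)
  then show ?thesis
    by (simp add: single_def coef_Opseries)
qed

lemma coef_single_times:
  fixes x :: "('k::case_index, 'u::superspace) opseries"
  assumes "is_endo A" "finite (snd s)"
  shows "coef (single s A * x) u v = Sum_any (\<lambda>t. if om_times s t = u
    then cocycle (index_case TYPE('k)) (snd s) (snd t) *\<^sub>C A (coef x t v) else 0)"
  unfolding coef_times
  by (subst Sum_any_reindex_inv[of snd "\<lambda>t. (s, t)"])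
    (auto simp: coef_single[OF assms] split: if_splits cong: if_cong)

lemma coef_times_single:
  fixes x :: "('k::case_index, 'u::superspace) opseries"
  assumes "is_endo A" "finite (snd s)"
  shows "coef (x * single s A) u v = Sum_any (\<lambda>t. if om_times t s = u
    then cocycle (index_case TYPE('k)) (snd t) (snd s) *\<^sub>C coef x t (A v) else 0)"
  unfolding coef_times
  by (subst Sum_any_reindex_inv[of fst "\<lambda>t. (t, s)"])
    (auto simp: coef_single[OF assms] split: if_splits cong: if_cong)

lemma single_times_single:
  assumes "is_endo A" "is_endo B" "finite (snd s)" "finite (snd t)"
  shows "(single s A * single t B :: ('k::case_index, 'u::superspace) opseries)
    = single (om_times s t) (scaleC (cocycle (index_case TYPE('k)) (snd s) (snd t)) \<circ> A \<circ> B)"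
proof (rule opseries_eqI)
  fix k S and v :: 'u
  have "finite (snd (om_times s t))"
    using assms by (simp add: om_times_def)
  moreover have "coef (single s A * single t B :: ('k::case_index, 'u::superspace) opseries) (k, S) v
    = (if om_times s t = (k, S)
       then cocycle (index_case TYPE('k)) (snd s) (snd t) *\<^sub>C A (B v) else 0)"
    unfolding coef_single_times[OF assms(1,3)] using assms
    by (subst Sum_any_single[of t]) (auto simp: coef_single endo_zero)
  ultimately show "coef (single s A * single t B :: ('k::case_index, 'u::superspace) opseries) (k, S) v
    = coef (single (om_times s t) (scaleC (cocycle (index_case TYPE('k)) (snd s) (snd t)) \<circ> A \<circ> B)
        :: ('k::case_index, 'u::superspace) opseries) (k, S) v"
    using assms by (simp add: coef_single is_endo_comp is_endo_scale)
qed

text \<open>The central element c \<lambda>^k. In particular \<open>lam 0 c\<close> is the scalar c,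
  so that scalars and signs can be moved about inside the ring.\<close>

definition lam :: "nat \<Rightarrow> complex \<Rightarrow> ('k::case_index, 'u::superspace) opseries" where
  "lam k c = single (k, {}) (scaleC c)"

lemma om_times_lam: "om_times (k, {}) t = (k + fst t, snd t)" "om_times t (k, {}) = (k + fst t, snd t)"
  by (auto simp: om_times_def symdiff_def)

lemma coef_lam_times: "coef (lam k c * x) (l, S) v = (if k \<le> l then c *\<^sub>C coef x (l - k, S) v else 0)"
  unfolding lam_def
  by (simp add: coef_single_times is_endo_scale om_times_lam, subst Sum_any_single[of "(l - k, S)"])
    (auto simp: scaleC_one prod_eq_iff)

lemma coef_times_lam: "coef (x * lam k c) (l, S) v = (if k \<le> l then c *\<^sub>C coef x (l - k, S) v else 0)"
  unfolding lam_def
  by (simp add: coef_times_single is_endo_scale om_times_lam, subst Sum_any_single[of "(l - k, S)"])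
    (auto simp: scaleC_one prod_eq_iff coef_scale)

lemma lam_commute: "x * lam k c = lam k c * x"
  by (rule opseries_eqI) (simp add: coef_lam_times coef_times_lam)

lemma lam_mult: "lam j c * lam k d = lam (j + k) (c * d)"
  unfolding lam_def
  by (subst single_times_single)
    (auto simp: is_endo_scale om_times_lam scaleC_scaleC scaleC_one comp_def add.commute intro!: arg_cong[of _ _ "single _"])

lemma coef_lam: "coef (lam k c) t v = (if t = (k, {}) then c *\<^sub>C v else 0)"
  by (simp add: lam_def coef_single is_endo_scale)

lemma lam_add: "lam k (c + d) = lam k c + lam k d"
  by (rule opseries_eqI) (simp add: coef_lam scaleC_add_left)

lemma lam_minus: "lam k (- c) = - lam k c"
  by (rule opseries_eqI) (simp add: coef_lam)

lemma lam_zero [simp]: "lam k 0 = 0"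
  by (rule opseries_eqI) (simp add: coef_lam)

lemma lam_one [simp]: "lam 0 1 = 1"
  by (rule opseries_eqI) (simp add: coef_lam coef_1 scaleC_one)

lemma lam_sum: "lam k (sum f I) = (\<Sum>i\<in>I. lam k (f i))"
  by (induction I rule: infinite_finite_induct) (auto simp: lam_add)

lemma lam_left_commute: "x * (lam k c * y) = lam k c * (x * y)"
  by (metis lam_commute mult.assoc)

lemma lam_mult': "lam j c * (lam k d * x) = lam (j + k) (c * d) * x"
  by (simp add: lam_mult flip: mult.assoc)

lemma sgn_lam_cancel [simp]: "lam 0 (sgn1 p) * (lam 0 (sgn1 p) * x) = x"
  by (simp add: lam_mult')

text \<open>In the chosen coordinates a single odd generator with coefficient 1 has the component
  \<Pi>.\<close>

definition gen :: "generator \<Rightarrow> ('k::case_index, 'u::superspace) opseries" where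
  "gen g = single (0, {g}) \<Pi>"

lemma gen_anticommute: "g \<noteq> h \<Longrightarrow> gen g * gen h = - (gen h * gen g)"
proof (rule opseries_eqI)
  fix k S and v :: 'b
  assume "g \<noteq> h"
  then have "swap_sign {h} {g} = - swap_sign {g} {h}"
    by (subst swap_sign_commute) auto
  moreover have "om_times (0, {g}) (0, {h}) = om_times (0, {h}) (0, {g})"
    by (auto simp: om_times_def symdiff_def Int_commute)
  moreover have "finite (snd (om_times (0, {h}) (0, {g})))"
    by (simp add: om_times_def)
  ultimately show "coef (gen g * gen h :: ('a, 'b) opseries) (k, S) v
      = coef (- (gen h * gen g) :: ('a, 'b) opseries) (k, S) v"
    using \<open>g \<noteq> h\<close>
    by (simp add: gen_def single_times_single is_endo_pinv cocycle_def square_factor_def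
        coef_single is_endo_comp is_endo_scale)
qed

lemma gen_square_eq:
  "gen g * gen g = (lam 1 (gen_square (index_case TYPE('k)) g) :: ('k::case_index, 'u::superspace) opseries)"
proof -
  have "{(x, h) \<in> {g} \<times> {g}. precedes h x} = {}"
    by (cases g) auto
  then have "swap_sign {g} {g} = 1"
    unfolding swap_sign_def by (simp only: card.empty power_0)
  then show ?thesis
    by (simp add: gen_def single_times_single is_endo_pinv cocycle_def square_factor_def lam_def
        om_times_def symdiff_def comp_def)
qed


section \<open>Parity\<close>

text \<open>Total parity: an operator of parity \<open>p + card S\<close> together with
  \<open>card S\<close> odd generators has parity \<open>p\<close>. The power of \<Pi> in the
  coordinates is even and changes nothing.\<close>

definition has_parity :: "nat \<Rightarrow> ('k::case_index, 'u::superspace) opseries \<Rightarrow> bool" where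
  "has_parity p x \<longleftrightarrow> (\<forall>t v. \<Pi> (coef x t (\<Pi> v)) = sgn1 (p + card (snd t)) *\<^sub>C coef x t v)"

lemma has_parityD: "has_parity p x \<Longrightarrow> \<Pi> (coef x t v) = sgn1 (p + card (snd t)) *\<^sub>C coef x t (\<Pi> v)"
  unfolding has_parity_def by (metis pinv_pinv)

lemma has_parity_pin:
  assumes "has_parity p x"
  shows "pin j (coef x t v) = sgn1 (j * (p + card (snd t))) *\<^sub>C coef x t (pin j v)"
  using has_parityD[OF assms, of t v] by (auto simp: pin_def scaleC_one minus_one_power_iff)

lemma has_parity_cong: "has_parity p x \<Longrightarrow> even p = even q \<Longrightarrow> has_parity q x"
  by (simp add: has_parity_def minus_one_power_iff)

lemma has_parity_zero: "has_parity p 0"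
  by (simp add: has_parity_def endo_zero[OF is_endo_pinv])

lemma has_parity_add: "has_parity p x \<Longrightarrow> has_parity p y \<Longrightarrow> has_parity p (x + y)"
  by (simp add: has_parity_def endo_add[OF is_endo_pinv] scaleC_add_right)

lemma has_parity_uminus: "has_parity p x \<Longrightarrow> has_parity p (- x)"
  by (simp add: has_parity_def endo_minus[OF is_endo_pinv])

lemma has_parity_diff: "has_parity p x \<Longrightarrow> has_parity p y \<Longrightarrow> has_parity p (x - y)"
  using has_parity_add[of p x "- y"] by (simp add: has_parity_uminus)

lemma has_parity_lam: "has_parity 0 (lam k c)"
  by (simp add: has_parity_def coef_lam endo_zero[OF is_endo_pinv] endo_scale[OF is_endo_pinv] scaleC_one)

lemma has_parity_gen: "has_parity 1 (gen g)"
  by (simp add: has_parity_def gen_def coef_single is_endo_pinv endo_zero[OF is_endo_pinv] scaleC_one)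

lemma has_parity_mult:
  fixes x y :: "('k::case_index, 'u::superspace) opseries"
  assumes "has_parity p x" "has_parity q y"
  shows "has_parity (p + q) (x * y)"
  unfolding has_parity_def
proof (intro allI)
  fix u :: odd_monomial and v :: 'u
  let ?c = "\<lambda>s t. cocycle (index_case TYPE('k)) (snd s) (snd t)"
  let ?\<sigma> = "sgn1 (p + q + card (snd u))"
  have "\<Pi> (coef (x * y) u (\<Pi> v)) = Sum_any (\<lambda>a. \<Pi> (case a of (s, t) \<Rightarrow>
      if om_times s t = u then ?c s t *\<^sub>C coef x s (coef y t (\<Pi> v)) else 0))"
    unfolding coef_times by (rule endo_Sum_any[OF is_endo_pinv finite_product_terms])
  also have "\<dots> = Sum_any (\<lambda>a. ?\<sigma> *\<^sub>C (case a of (s, t) \<Rightarrow>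
      if om_times s t = u then ?c s t *\<^sub>C coef x s (coef y t v) else 0))"
  proof (rule Sum_any.cong)
    fix a :: "odd_monomial \<times> odd_monomial"
    obtain s t where a: "a = (s, t)" by (cases a)
    show "\<Pi> (case a of (s, t) \<Rightarrow>
        if om_times s t = u then ?c s t *\<^sub>C coef x s (coef y t (\<Pi> v)) else 0)
      = ?\<sigma> *\<^sub>C (case a of (s, t) \<Rightarrow>
        if om_times s t = u then ?c s t *\<^sub>C coef x s (coef y t v) else 0)"
    \<comment> \<open>Cardinalities add up modulo 2 only for finite sets. A nonzero term guarantees
      finiteness; a zero term must be shown to vanish at \<Pi> \<open>v\<close> as well.\<close>
    proof (cases "om_times s t = u \<and> coef x s (coef y t v) \<noteq> 0")
      case True
      then have "finite (snd s)" "finite (snd t)"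
        using coef_finite by (metis coef_zero)+
      then have "sgn1 (p + card (snd s)) * sgn1 (q + card (snd t)) = ?\<sigma>"
        using True even_card_symdiff[of "snd s" "snd t"]
        by (auto simp: om_times_def minus_one_power_iff)
      then show ?thesis
        using True by (auto simp: a endo_scale[OF is_endo_pinv] has_parityD[OF assms(1)]
          has_parityD[OF assms(2)] coef_scale scaleC_scaleC mult.commute mult.left_commute)
    next
      case False
      moreover have "coef x s (coef y t (\<Pi> v)) = 0" if "coef x s (coef y t v) = 0"
      proof -
        have "\<Pi> (coef x s (coef y t (\<Pi> v))) = 0"
          by (simp add: has_parityD[OF assms(1)] has_parityD[OF assms(2)] coef_scale that)
        then show ?thesis
          by (metis pinv_pinv endo_zero is_endo_pinv)
      qed
      ultimately show ?thesis
        by (auto simp: a endo_zero[OF is_endo_pinv])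
    qed
  qed
  also have "\<dots> = ?\<sigma> *\<^sub>C coef (x * y) u v"
    unfolding coef_times by (rule endo_Sum_any[OF is_endo_scale finite_product_terms, symmetric])
  finally show "\<Pi> (coef (x * y) u (\<Pi> v)) = ?\<sigma> *\<^sub>C coef (x * y) u v" .
qed

lemma has_parity_lam_mult: "has_parity p x \<Longrightarrow> has_parity p (lam k c * x)"
  using has_parity_mult[OF has_parity_lam, of p x k c] by simp

text \<open>Passing the generators \<open>S\<close> of a term gives (-1)^|S| and passing its
  operator gives (-1)^(p+|S|), together (-1)^p. If the term contains \<open>g\<close> the count is
  off by one, but then the second hypothesis makes both products vanish.\<close>

lemma gen_supercommute:
  fixes x :: "('k::case_index, 'u::superspace) opseries"
  assumes "has_parity p x"
    and "\<And>t v. coef x t v \<noteq> 0 \<Longrightarrow> g \<in> snd t \<Longrightarrow> gen_square (index_case TYPE('k)) g = 0"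
  shows "gen g * x = lam 0 (sgn1 p) * (x * gen g)"
proof (rule opseries_eqI)
  fix k S and v :: 'u
  let ?c = "cocycle (index_case TYPE('k))"
  have fin: "finite {t. (if om_times t (0, {g}) = (k, S)
      then ?c (snd t) {g} *\<^sub>C coef x t (\<Pi> v) else 0) \<noteq> 0}"
    by (rule finite_subset[OF _ finite_coef[of k x "\<Pi> v"]])
      (auto split: if_splits simp: om_times_def scaleC.scale_eq_0_iff)
  have "coef (gen g * x) (k, S) v
    = Sum_any (\<lambda>t. if om_times (0, {g}) t = (k, S) then ?c {g} (snd t) *\<^sub>C \<Pi> (coef x t v) else 0)"
    by (simp add: gen_def coef_single_times is_endo_pinv cong: if_cong)
  also have "\<dots> = Sum_any (\<lambda>t. sgn1 p *\<^sub>C (if om_times t (0, {g}) = (k, S)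
      then ?c (snd t) {g} *\<^sub>C coef x t (\<Pi> v) else 0))"
  proof (rule Sum_any.cong)
    fix t :: odd_monomial
    have comm: "om_times (0, {g}) t = om_times t (0, {g})"
      by (simp add: om_times_def symdiff_def Int_commute Un_commute)
    show "(if om_times (0, {g}) t = (k, S) then ?c {g} (snd t) *\<^sub>C \<Pi> (coef x t v) else 0)
      = sgn1 p *\<^sub>C (if om_times t (0, {g}) = (k, S)
      then ?c (snd t) {g} *\<^sub>C coef x t (\<Pi> v) else 0)"
    proof (cases "coef x t (\<Pi> v) = 0")
      case False
      then have "finite (snd t)"
        by (rule coef_finite)
      show ?thesis
      proof (cases "g \<in> snd t")
        case True
        then show ?thesis
          using assms(2)[OF False] \<open>finite (snd t)\<close> by (simp add: cocycle_def square_factor_def)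
      next
        case g: False
        then have "swap_sign {g} (snd t) = sgn1 (card (snd t)) * swap_sign (snd t) {g}"
          using swap_sign_commute[of "snd t" "{g}"] \<open>finite (snd t)\<close> by simp
        then have "?c {g} (snd t) = sgn1 (card (snd t)) * ?c (snd t) {g}"
          using g by (simp add: cocycle_def)
        then show ?thesis
          by (simp add: has_parityD[OF assms(1)] comm scaleC_scaleC power_add mult_ac)
      qed
    qed (simp add: has_parityD[OF assms(1)])
  qed
  also have "\<dots> = sgn1 p *\<^sub>C coef (x * gen g) (k, S) v"
    using endo_Sum_any[OF is_endo_scale fin] by (simp add: gen_def coef_times_single is_endo_pinv cong: if_cong)
  finally show "coef (gen g * x) (k, S) v = coef (lam 0 (sgn1 p) * (x * gen g)) (k, S) v"
    by (simp add: coef_lam_times)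
qed

section \<open>Locally finite sums\<close>

text \<open>Finiteness is joint in index and monomial, so that the sum is again locally
  finite.\<close>

definition lsummable :: "('i \<Rightarrow> ('k::case_index, 'u::superspace) opseries) \<Rightarrow> bool" where
  "lsummable f \<longleftrightarrow> (\<forall>k v. finite {(i, t). fst t \<le> k \<and> coef (f i) t v \<noteq> 0})"

definition lsum :: "('i \<Rightarrow> ('k::case_index, 'u::superspace) opseries) \<Rightarrow> ('k, 'u) opseries" where
  "lsum f = Opseries (\<lambda>t v. Sum_any (\<lambda>i. coef (f i) t v))"

lemma lsummable_finite:
  assumes "lsummable f"
  shows "finite {i. coef (f i) t v \<noteq> 0}"
proof -
  have "finite {(i, s). fst s \<le> fst t \<and> coef (f i) s v \<noteq> 0}"
    using assms by (auto simp: lsummable_def)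
  then show ?thesis
    by (rule finite_surj[of _ _ fst]) (auto intro!: image_eqI[of _ fst "(_, t)"])
qed

lemma coef_lsum:
  fixes f :: "'i \<Rightarrow> ('k::case_index, 'u::superspace) opseries"
  assumes "lsummable f"
  shows "coef (lsum f) t v = Sum_any (\<lambda>i. coef (f i) t v)"
proof -
  note fin = lsummable_finite[OF assms]
  have "is_endo (\<lambda>v. Sum_any (\<lambda>i. coef (f i) t v))" for t
  proof (rule is_endoI)
    fix v w :: 'u and c
    show "Sum_any (\<lambda>i. coef (f i) t (v + w)) = Sum_any (\<lambda>i. coef (f i) t v) + Sum_any (\<lambda>i. coef (f i) t w)"
      by (simp add: endo_add[OF is_endo_coef] Sum_any_add[OF fin fin])
    show "Sum_any (\<lambda>i. coef (f i) t (c *\<^sub>C v)) = c *\<^sub>C Sum_any (\<lambda>i. coef (f i) t v)"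
      by (simp add: coef_scale endo_Sum_any[OF is_endo_scale fin])
  qed
  moreover have "(\<lambda>v. Sum_any (\<lambda>i. coef (f i) t v)) = 0" if "infinite (snd t)" for t
    using that by (simp add: coef_infinite fun_eq_iff)
  moreover have "finite {t. fst t \<le> k \<and> Sum_any (\<lambda>i. coef (f i) t v) \<noteq> 0}" for k v
  proof (rule finite_surj[of _ _ snd])
    show "finite {(i, t). fst t \<le> k \<and> coef (f i) t v \<noteq> 0}"
      using assms by (auto simp: lsummable_def)
    show "{t. fst t \<le> k \<and> Sum_any (\<lambda>i. coef (f i) t v) \<noteq> 0}
        \<subseteq> snd ` {(i, t). fst t \<le> k \<and> coef (f i) t v \<noteq> 0}"
    proof
      fix t assume t: "t \<in> {t. fst t \<le> k \<and> Sum_any (\<lambda>i. coef (f i) t v) \<noteq> 0}"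
      then obtain i where "coef (f i) t v \<noteq> 0"
        by (metis (mono_tags, lifting) Sum_any.not_neutral_obtains_not_neutral mem_Collect_eq)
      then show "t \<in> snd ` {(i, t). fst t \<le> k \<and> coef (f i) t v \<noteq> 0}"
        using t by (intro image_eqI[of _ _ "(i, t)"]) auto
    qed
  qed
  ultimately have "locally_finite (\<lambda>t v. Sum_any (\<lambda>i. coef (f i) t v))"
    unfolding locally_finite_def by blast
  then show ?thesis
    by (simp add: lsum_def coef_Opseries)
qed

text \<open>Stronger than summability of the products, since terms of a product may cancel.\<close>

definition lsummable2 :: "('i \<Rightarrow> ('k::case_index, 'u::superspace) opseries) \<Rightarrow> ('i \<Rightarrow> ('k, 'u) opseries) \<Rightarrow> bool" where
  "lsummable2 f g \<longleftrightarrow> (\<forall>k v. finite {(i, s, t). fst s \<le> k \<and> fst t \<le> k \<and> coef (f i) s (coef (g i) t v) \<noteq> 0})"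

text \<open>For each single index the pairs of monomials are finite in number anyway, so only the
  indices have to be bounded.\<close>

lemma lsummable2I:
  fixes f g :: "'i \<Rightarrow> ('k::case_index, 'u::superspace) opseries"
  assumes "\<And>k v. \<exists>A. finite A \<and>
    (\<forall>i s t. fst s \<le> k \<longrightarrow> fst t \<le> k \<longrightarrow> coef (f i) s (coef (g i) t v) \<noteq> 0 \<longrightarrow> i \<in> A)"
  shows "lsummable2 f g"
  unfolding lsummable2_def
proof (intro allI)
  fix k and v :: 'u
  obtain A where A: "finite A"
    "\<forall>i s t. fst s \<le> k \<longrightarrow> fst t \<le> k \<longrightarrow> coef (f i) s (coef (g i) t v) \<noteq> 0 \<longrightarrow> i \<in> A"
    using assms[of k v] by blast
  have "{(i, s, t). fst s \<le> k \<and> fst t \<le> k \<and> coef (f i) s (coef (g i) t v) \<noteq> 0}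
    \<subseteq> (\<Union>i\<in>A. Pair i ` {(s, t). fst s \<le> k \<and> fst t \<le> k \<and> coef (f i) s (coef (g i) t v) \<noteq> 0})"
    using A(2) by blast
  then show "finite {(i, s, t). fst s \<le> k \<and> fst t \<le> k \<and> coef (f i) s (coef (g i) t v) \<noteq> 0}"
    by (rule finite_subset) (intro finite_UN_I finite_imageI finite_coef2 A(1))
qed

lemma coef_times_nonzero:
  fixes x y :: "('k::case_index, 'u::superspace) opseries"
  assumes "coef (x * y) u v \<noteq> 0"
  obtains s t where "om_times s t = u" "coef x s (coef y t v) \<noteq> 0"
proof -
  obtain p where "(case p of (s, t) \<Rightarrow> if om_times s t = u
     then cocycle (index_case TYPE('k)) (snd s) (snd t) *\<^sub>C coef x s (coef y t v) else 0) \<noteq> 0"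
    using assms unfolding coef_times by (rule Sum_any.not_neutral_obtains_not_neutral)
  then show ?thesis
    by (auto split: prod.splits if_splits intro: that)
qed

lemma lsummable2_times:
  assumes "lsummable2 f g"
  shows "lsummable (\<lambda>i. f i * g i)"
  unfolding lsummable_def
proof (intro allI)
  fix k v
  show "finite {(i, u). fst u \<le> k \<and> coef (f i * g i) u v \<noteq> 0}"
  proof (rule finite_surj[of _ _ "\<lambda>(i, s, t). (i, om_times s t)"])
    show "finite {(i, s, t). fst s \<le> k \<and> fst t \<le> k \<and> coef (f i) s (coef (g i) t v) \<noteq> 0}"
      using assms by (auto simp: lsummable2_def)
    show "{(i, u). fst u \<le> k \<and> coef (f i * g i) u v \<noteq> 0} \<subseteq> (\<lambda>(i, s, t). (i, om_times s t)) `
        {(i, s, t). fst s \<le> k \<and> fst t \<le> k \<and> coef (f i) s (coef (g i) t v) \<noteq> 0}"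
    proof (rule subsetI, clarify)
      fix i a b assume "fst (a, b) \<le> k" and ne: "coef (f i * g i) (a, b) v \<noteq> 0"
      obtain s t where st: "om_times s t = (a, b)" "coef (f i) s (coef (g i) t v) \<noteq> 0"
        using ne by (rule coef_times_nonzero)
      then have "fst s \<le> k" "fst t \<le> k"
        using \<open>fst (a, b) \<le> k\<close> om_times_le(1)[of s t] om_times_le(2)[of t s] by auto
      then show "(i, (a, b)) \<in> (\<lambda>(i, s, t). (i, om_times s t)) `
        {(i, s, t). fst s \<le> k \<and> fst t \<le> k \<and> coef (f i) s (coef (g i) t v) \<noteq> 0}"
        using st by (intro image_eqI[of _ _ "(i, s, t)"]) auto
    qed
  qed
qed

lemma finite_product_terms2:
  assumes "lsummable2 f g"
  shows "finite {(i, p). (case p of (s, t) \<Rightarrow>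
    if om_times s t = u then c s t *\<^sub>C coef (f i) s (coef (g i) t v) else 0) \<noteq> 0}"
proof -
  have "finite {(i, s, t). fst s \<le> fst u \<and> fst t \<le> fst u \<and> coef (f i) s (coef (g i) t v) \<noteq> 0}"
    using assms by (auto simp: lsummable2_def)
  then show ?thesis
    by (rule rev_finite_subset) (auto split: if_splits simp: om_times_def)
qed

lemma coef_lsum_times:
  fixes f g :: "'i \<Rightarrow> ('k::case_index, 'u::superspace) opseries"
  assumes "lsummable2 f g"
  shows "coef (lsum (\<lambda>i. f i * g i)) u v = Sum_any (\<lambda>(i, p). case p of (s, t) \<Rightarrow>
    if om_times s t = u then cocycle (index_case TYPE('k)) (snd s) (snd t) *\<^sub>C
      coef (f i) s (coef (g i) t v) else 0)"
  unfolding coef_lsum[OF lsummable2_times[OF assms]] coef_times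
  by (rule Sum_any_pair[OF finite_product_terms2[OF assms]])

lemma lsummable2_left:
  assumes "lsummable f"
  shows "lsummable2 (\<lambda>i. x) f"
  unfolding lsummable2_def
proof (intro allI)
  fix k v
  let ?B = "{(i, t). fst t \<le> k \<and> coef (f i) t v \<noteq> 0}"
  have "{(i, s, t). fst s \<le> k \<and> fst t \<le> k \<and> coef x s (coef (f i) t v) \<noteq> 0}
      \<subseteq> (\<Union>(i, t)\<in>?B. (\<lambda>s. (i, s, t)) ` {s. fst s \<le> k \<and> coef x s (coef (f i) t v) \<noteq> 0})"
    by (auto simp: image_iff)
  moreover have "finite ?B"
    using assms by (auto simp: lsummable_def)
  ultimately show "finite {(i, s, t). fst s \<le> k \<and> fst t \<le> k \<and> coef x s (coef (f i) t v) \<noteq> 0}"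
    by (auto elim!: finite_subset simp: finite_coef)
qed

lemma lsummable2_right:
  assumes "lsummable f"
  shows "lsummable2 f (\<lambda>i. x)"
  unfolding lsummable2_def
proof (intro allI)
  fix k v
  let ?B = "{t. fst t \<le> k \<and> coef x t v \<noteq> 0}"
  have "{(i, s, t). fst s \<le> k \<and> fst t \<le> k \<and> coef (f i) s (coef x t v) \<noteq> 0}
      \<subseteq> (\<Union>t\<in>?B. (\<lambda>(i, s). (i, s, t)) ` {(i, s). fst s \<le> k \<and> coef (f i) s (coef x t v) \<noteq> 0})"
    by (auto simp: image_iff)
  moreover have "finite {(i, s). fst s \<le> k \<and> coef (f i) s w \<noteq> 0}" for w
    using assms by (auto simp: lsummable_def)
  ultimately show "finite {(i, s, t). fst s \<le> k \<and> fst t \<le> k \<and> coef (f i) s (coef x t v) \<noteq> 0}"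
    by (auto elim!: finite_subset simp: finite_coef)
qed

lemmas lsummable_times_left = lsummable2_times[OF lsummable2_left]
lemmas lsummable_times_right = lsummable2_times[OF lsummable2_right]

text \<open>Infinite distributivity: the sum over \<open>i\<close> is exchanged with the one over
  pairs of monomials, which \<open>lsummable2\<close> permits.\<close>

lemma times_lsum:
  fixes x :: "('k::case_index, 'u::superspace) opseries"
  assumes "lsummable f"
  shows "x * lsum f = lsum (\<lambda>i. x * f i)"
proof (rule opseries_eqI)
  fix k :: nat and S :: "generator set" and v :: 'u
  let ?T = "\<lambda>i p. case p of (s, t) \<Rightarrow> if om_times s t = (k, S) then
    cocycle (index_case TYPE('k)) (snd s) (snd t) *\<^sub>C coef x s (coef (f i) t v) else 0"
  note fin = finite_product_terms2[OF lsummable2_left[OF assms],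
      of "(k, S)" "\<lambda>s t. cocycle (index_case TYPE('k)) (snd s) (snd t)" x v]
  have "finite {(p, i). ?T i p \<noteq> 0}"
    using finite_imageI[OF fin, of prod.swap] by (rule rev_finite_subset) force
  then have swap: "Sum_any (\<lambda>p. Sum_any (\<lambda>i. ?T i p)) = Sum_any (\<lambda>(p, i). ?T i p)"
    by (rule Sum_any_pair)
  have "coef (x * lsum f) (k, S) v = Sum_any (\<lambda>p. Sum_any (\<lambda>i. ?T i p))"
    unfolding coef_times
  proof (rule Sum_any.cong)
    fix p :: "odd_monomial \<times> odd_monomial"
    obtain s t where p: "p = (s, t)" by (cases p)
    show "(case p of (s, t) \<Rightarrow> if om_times s t = (k, S) then
      cocycle (index_case TYPE('k)) (snd s) (snd t) *\<^sub>C coef x s (coef (lsum f) t v) else 0)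
      = Sum_any (\<lambda>i. ?T i p)"
      using endo_Sum_any[OF is_endo_comp[OF is_endo_scale is_endo_coef] lsummable_finite[OF assms],
          of "cocycle (index_case TYPE('k)) (snd s) (snd t)" x s t v]
      by (auto simp: p coef_lsum[OF assms])
  qed
  also have "\<dots> = Sum_any (\<lambda>(i, p). ?T i p)"
    unfolding swap
    by (subst Sum_any_reindex_inv[of prod.swap prod.swap])
      (auto simp: split_def cong: if_cong intro!: Sum_any.cong)
  finally show "coef (x * lsum f) (k, S) v = coef (lsum (\<lambda>i. x * f i)) (k, S) v"
    by (simp only: coef_lsum_times[OF lsummable2_left[OF assms]])
qed

lemma lsum_times:
  fixes x :: "('k::case_index, 'u::superspace) opseries"
  assumes "lsummable f"
  shows "lsum f * x = lsum (\<lambda>i. f i * x)"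
proof (rule opseries_eqI)
  fix k :: nat and S :: "generator set" and v :: 'u
  let ?T = "\<lambda>i p. case p of (s, t) \<Rightarrow> if om_times s t = (k, S) then
    cocycle (index_case TYPE('k)) (snd s) (snd t) *\<^sub>C coef (f i) s (coef x t v) else 0"
  note fin = finite_product_terms2[OF lsummable2_right[OF assms],
      of "(k, S)" "\<lambda>s t. cocycle (index_case TYPE('k)) (snd s) (snd t)" x v]
  have "finite {(p, i). ?T i p \<noteq> 0}"
    using finite_imageI[OF fin, of prod.swap] by (rule rev_finite_subset) force
  then have swap: "Sum_any (\<lambda>p. Sum_any (\<lambda>i. ?T i p)) = Sum_any (\<lambda>(p, i). ?T i p)"
    by (rule Sum_any_pair)
  have "coef (lsum f * x) (k, S) v = Sum_any (\<lambda>p. Sum_any (\<lambda>i. ?T i p))"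
    unfolding coef_times
  proof (rule Sum_any.cong)
    fix p :: "odd_monomial \<times> odd_monomial"
    obtain s t where p: "p = (s, t)" by (cases p)
    show "(case p of (s, t) \<Rightarrow> if om_times s t = (k, S) then
      cocycle (index_case TYPE('k)) (snd s) (snd t) *\<^sub>C coef (lsum f) s (coef x t v) else 0)
      = Sum_any (\<lambda>i. ?T i p)"
      using endo_Sum_any[OF is_endo_scale lsummable_finite[OF assms],
          of "cocycle (index_case TYPE('k)) (snd s) (snd t)" s "coef x t v"]
      by (auto simp: p coef_lsum[OF assms])
  qed
  also have "\<dots> = Sum_any (\<lambda>(i, p). ?T i p)"
    unfolding swap
    by (subst Sum_any_reindex_inv[of prod.swap prod.swap])
      (auto simp: split_def cong: if_cong intro!: Sum_any.cong)
  finally show "coef (lsum f * x) (k, S) v = coef (lsum (\<lambda>i. f i * x)) (k, S) v"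
    by (simp only: coef_lsum_times[OF lsummable2_right[OF assms]])
qed

lemma lsummable_add:
  assumes "lsummable f" "lsummable g"
  shows "lsummable (\<lambda>i. f i + g i)"
  unfolding lsummable_def
proof (intro allI)
  fix k v
  have "finite ({(i, t). fst t \<le> k \<and> coef (f i) t v \<noteq> 0} \<union> {(i, t). fst t \<le> k \<and> coef (g i) t v \<noteq> 0})"
    using assms by (simp add: lsummable_def)
  then show "finite {(i, t). fst t \<le> k \<and> coef (f i + g i) t v \<noteq> 0}"
    by (rule rev_finite_subset) auto
qed

lemma lsum_add: "lsummable f \<Longrightarrow> lsummable g \<Longrightarrow> lsum (\<lambda>i. f i + g i) = lsum f + lsum g"
  by (rule opseries_eqI) (simp add: coef_lsum lsummable_add Sum_any_add lsummable_finite)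

lemma lsummable_uminus: "lsummable f \<Longrightarrow> lsummable (\<lambda>i. - f i)"
  by (simp add: lsummable_def)

lemma lsum_uminus: "lsummable f \<Longrightarrow> lsum (\<lambda>i. - f i) = - lsum f"
  using lsum_add[of f "\<lambda>i. - f i"] lsummable_uminus[of f]
  by (simp add: lsum_def) (metis (mono_tags, lifting) add.commute add_eq_0_iff zero_opseries_def)

lemma lsummable_diff: "lsummable f \<Longrightarrow> lsummable g \<Longrightarrow> lsummable (\<lambda>i. f i - g i)"
  using lsummable_add[of f "\<lambda>i. - g i"] by (simp add: lsummable_uminus)

lemma lsum_diff: "lsummable f \<Longrightarrow> lsummable g \<Longrightarrow> lsum (\<lambda>i. f i - g i) = lsum f - lsum g"
  using lsum_add[of f "\<lambda>i. - g i"] by (simp add: lsummable_uminus lsum_uminus)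

lemma lsummable_pair:
  assumes "lsummable (\<lambda>(i, j). f i j)"
  shows "lsummable (f i)" and "lsummable (\<lambda>i. lsum (f i))"
proof -
  have fin: "finite {((i, j), t). fst t \<le> k \<and> coef (f i j) t v \<noteq> 0}" for k v
    using assms by (auto simp: lsummable_def split_def)
  show *: "lsummable (f i)" for i
    unfolding lsummable_def
  proof (intro allI)
    fix k v
    show "finite {(j, t). fst t \<le> k \<and> coef (f i j) t v \<noteq> 0}"
      by (rule finite_surj[OF fin[of k v], of _ "\<lambda>((i, j), t). (j, t)"]) (force simp: image_iff)
  qed
  show "lsummable (\<lambda>i. lsum (f i))"
    unfolding lsummable_def
  proof (intro allI)
    fix k v
    show "finite {(i, t). fst t \<le> k \<and> coef (lsum (f i)) t v \<noteq> 0}"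
    proof (rule finite_surj[OF fin[of k v], of _ "\<lambda>((i, j), t). (i, t)"], rule subsetI, clarify)
      fix i a b assume ab: "fst (a, b) \<le> k" "coef (lsum (f i)) (a, b) v \<noteq> 0"
      then obtain j where "coef (f i j) (a, b) v \<noteq> 0"
        unfolding coef_lsum[OF *] by (metis Sum_any.not_neutral_obtains_not_neutral)
      then show "(i, (a, b)) \<in> (\<lambda>((i, j), t). (i, t)) ` {((i, j), t). fst t \<le> k \<and> coef (f i j) t v \<noteq> 0}"
        using ab by (intro image_eqI[of _ _ "((i, j), (a, b))"]) auto
    qed
  qed
qed

lemma lsum_pair:
  assumes "lsummable (\<lambda>(i, j). f i j)"
  shows "lsum (\<lambda>i. lsum (f i)) = lsum (\<lambda>(i, j). f i j)"
proof (rule opseries_eqI)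
  fix k :: nat and S v
  have "finite {(i, j). coef (f i j) (k, S) v \<noteq> 0}"
    using lsummable_finite[OF assms, of "(k, S)" v] by (simp add: split_def)
  then show "coef (lsum (\<lambda>i. lsum (f i))) (k, S) v = coef (lsum (\<lambda>(i, j). f i j)) (k, S) v"
    unfolding coef_lsum[OF lsummable_pair(2)[OF assms]] coef_lsum[OF lsummable_pair(1)[OF assms]]
      coef_lsum[OF assms]
    by (simp add: Sum_any_pair split_def)
qed

lemma lsum_reindex_inv:
  assumes "\<And>j. g (h j) = j" and "\<And>i. f i \<noteq> 0 \<Longrightarrow> h (g i) = i"
  shows "lsum f = lsum (\<lambda>j. f (h j))"
proof -
  have "(\<lambda>t v. Sum_any (\<lambda>i. coef (f i) t v)) = (\<lambda>t v. Sum_any (\<lambda>j. coef (f (h j)) t v))"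
    by (intro ext Sum_any_reindex_inv[of g h] assms) auto
  then show ?thesis
    by (simp add: lsum_def)
qed

lemma lsummable_reindex:
  assumes "lsummable f" "inj h"
  shows "lsummable (\<lambda>j. f (h j))"
  unfolding lsummable_def
proof (intro allI)
  fix k v
  have "{(j, t). fst t \<le> k \<and> coef (f (h j)) t v \<noteq> 0}
      = (\<lambda>(j, t). (h j, t)) -` {(i, t). fst t \<le> k \<and> coef (f i) t v \<noteq> 0}"
    by auto
  moreover have "inj (\<lambda>(j, t :: odd_monomial). (h j, t))"
    using assms(2) by (auto simp: inj_on_def)
  ultimately show "finite {(j, t). fst t \<le> k \<and> coef (f (h j)) t v \<noteq> 0}"
    using assms(1) unfolding lsummable_def by (metis (no_types, lifting) finite_vimageI)
qed

lemma lsummable_swap: "lsummable (\<lambda>(i, j). f i j) \<Longrightarrow> lsummable (\<lambda>(j, i). f i j)"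
  using lsummable_reindex[of "\<lambda>(i, j). f i j" prod.swap] by (simp add: split_def)

lemma lsum_swap:
  assumes "lsummable (\<lambda>(i, j). f i j)"
  shows "lsum (\<lambda>i. lsum (f i)) = lsum (\<lambda>j. lsum (\<lambda>i. f i j))"
  unfolding lsum_pair[OF assms] lsum_pair[OF lsummable_swap[OF assms]]
  by (subst lsum_reindex_inv[of prod.swap prod.swap]) (simp_all add: split_def)

lemma lsummable_finite_support:
  assumes "finite A" "\<And>i. i \<notin> A \<Longrightarrow> f i = 0"
  shows "lsummable f"
  unfolding lsummable_def
proof (intro allI)
  fix k v
  have "{(i, t). fst t \<le> k \<and> coef (f i) t v \<noteq> 0}
      \<subseteq> (\<Union>i\<in>A. Pair i ` {t. fst t \<le> k \<and> coef (f i) t v \<noteq> 0})"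
    using assms(2) by fastforce
  then show "finite {(i, t). fst t \<le> k \<and> coef (f i) t v \<noteq> 0}"
    by (rule finite_subset) (intro finite_UN_I finite_imageI finite_coef assms)
qed

lemma lsum_finite_support:
  assumes "finite A" "\<And>i. i \<notin> A \<Longrightarrow> f i = 0"
  shows "lsum f = sum f A"
proof (rule opseries_eqI)
  fix k S v
  have "{i. coef (f i) (k, S) v \<noteq> 0} \<subseteq> A"
    using assms(2) by force
  then show "coef (lsum f) (k, S) v = coef (sum f A) (k, S) v"
    by (simp add: coef_lsum[OF lsummable_finite_support[OF assms]] coef_sum
      Sum_any.expand_superset[OF assms(1)])
qed

lemma lsummable_zero [simp]: "lsummable (\<lambda>i. 0)"
  by (simp add: lsummable_def)

lemma lsum_zero [simp]: "lsum (\<lambda>i. 0) = 0"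
  by (rule opseries_eqI) (simp add: coef_lsum)

lemma lsum_single: "(\<And>i. i \<noteq> a \<Longrightarrow> f i = 0) \<Longrightarrow> lsum f = f a"
  using lsum_finite_support[of "{a}" f] by simp

lemma has_parity_lsum:
  assumes "lsummable f" "\<And>i. has_parity p (f i)"
  shows "has_parity p (lsum f)"
  using assms(2) lsummable_finite[OF assms(1)]
  by (simp add: has_parity_def coef_lsum[OF assms(1)] endo_Sum_any is_endo_pinv is_endo_scale)

section \<open>Convergence in powers of \<lambda>\<close>

definition lambda_order :: "nat \<Rightarrow> ('k::case_index, 'u::superspace) opseries \<Rightarrow> bool" where
  "lambda_order d x \<longleftrightarrow> (\<forall>t v. fst t < d \<longrightarrow> coef x t v = 0)"

lemma lambda_order_lam: "lambda_order k (lam k c * x)"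
  by (auto simp: lambda_order_def coef_lam_times)

text \<open>If the orders tend to infinity, each power of \<lambda> receives contributions from
  finitely many terms only.\<close>

lemma lsummable_lambda_order:
  assumes "\<And>i. lambda_order (d i) (f i)" "\<And>k. finite {i. d i \<le> k}"
  shows "lsummable f"
  unfolding lsummable_def
proof (intro allI)
  fix k v
  have "{(i, t). fst t \<le> k \<and> coef (f i) t v \<noteq> 0}
      \<subseteq> (\<Union>i\<in>{i. d i \<le> k}. Pair i ` {t. fst t \<le> k \<and> coef (f i) t v \<noteq> 0})"
  proof (rule subsetI, clarify)
    fix i a b assume *: "fst (a, b) \<le> k" "coef (f i) (a, b) v \<noteq> 0"
    then have "d i \<le> a"
      using assms(1)[of i] by (auto simp: lambda_order_def not_less[symmetric])
    then show "(i, (a, b)) \<in> (\<Union>i\<in>{i. d i \<le> k}. Pair i ` {t. fst t \<le> k \<and> coef (f i) t v \<noteq> 0})"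
      using * by (intro UN_I[of i] image_eqI[of _ _ "(a, b)"]) auto
  qed
  then show "finite {(i, t). fst t \<le> k \<and> coef (f i) t v \<noteq> 0}"
    by (rule finite_subset) (intro finite_UN_I finite_imageI finite_coef assms)
qed

text \<open>Up to \<lambda>^k only finitely many \<open>i\<close> matter, so summability in
  \<open>j\<close> for each fixed \<open>i\<close> is enough.\<close>

lemma lsummable_pair_lambda_order:
  assumes "\<And>i j. lambda_order (d i) (f i j)" "\<And>k. finite {i. d i \<le> k}" "\<And>i. lsummable (f i)"
  shows "lsummable (\<lambda>(i, j). f i j)"
  unfolding lsummable_def
proof (intro allI)
  fix k v
  have "{(p, t). fst t \<le> k \<and> coef (case p of (i, j) \<Rightarrow> f i j) t v \<noteq> 0}
      \<subseteq> (\<Union>i\<in>{i. d i \<le> k}. (\<lambda>(j, t). ((i, j), t)) ` {(j, t). fst t \<le> k \<and> coef (f i j) t v \<noteq> 0})"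
  proof (rule subsetI, clarify)
    fix i j a b assume *: "fst (a, b) \<le> k" "coef (f i j) (a, b) v \<noteq> 0"
    then have "d i \<le> a"
      using assms(1)[of i j] by (auto simp: lambda_order_def not_less[symmetric])
    then show "((i, j), (a, b)) \<in> (\<Union>i\<in>{i. d i \<le> k}. (\<lambda>(j, t). ((i, j), t)) `
        {(j, t). fst t \<le> k \<and> coef (f i j) t v \<noteq> 0})"
      using * by (force simp: image_iff)
  qed
  moreover have "finite {(j, t). fst t \<le> k \<and> coef (f i j) t v \<noteq> 0}" for i
    using assms(3)[of i] by (auto simp: lsummable_def)
  ultimately show "finite {(p, t). fst t \<le> k \<and> coef (case p of (i, j) \<Rightarrow> f i j) t v \<noteq> 0}"
    by (auto elim!: finite_subset intro!: finite_UN_I assms(2))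
qed

lemma finite_pair_sum_le: "finite {p :: nat \<times> nat. fst p + snd p \<le> k}"
  by (rule finite_subset[of _ "{..k} \<times> {..k}"]) auto


section \<open>Sequences bounded below\<close>

text \<open>The condition of a field that it be a Laurent series on each vector. The bound may
  depend on the power of \<lambda>: in a bracket, higher powers bring in further modes of a, each
  with its own bound.\<close>

definition bounded_below :: "(int \<Rightarrow> ('k::case_index, 'u::superspace) opseries) \<Rightarrow> bool" where
  "bounded_below x \<longleftrightarrow> (\<forall>k v. \<exists>M. \<forall>n<M. \<forall>t. fst t \<le> k \<longrightarrow> coef (x n) t v = 0)"

lemma bounded_belowD:
  "bounded_below x \<Longrightarrow> \<exists>M. \<forall>n<M. \<forall>t. fst t \<le> k \<longrightarrow> coef (x n) t v = 0"
  by (simp add: bounded_below_def)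

lemma bounded_below_finite_set:
  assumes "bounded_below x" "finite B"
  shows "\<exists>M. \<forall>v\<in>B. \<forall>n<M. \<forall>t. fst t \<le> k \<longrightarrow> coef (x n) t v = 0"
  using assms(2)
proof induction
  case (insert w B)
  then obtain M where M: "\<forall>v\<in>B. \<forall>n<M. \<forall>t. fst t \<le> k \<longrightarrow> coef (x n) t v = 0"
    by blast
  obtain M' where "\<And>n t. n < M' \<Longrightarrow> fst t \<le> k \<Longrightarrow> coef (x n) t w = 0"
    using bounded_belowD[OF assms(1), of k w] by blast
  with M show ?case
    by (intro exI[of _ "min M M'"]) auto
qed simp

lemma bounded_below_left: "bounded_below x \<Longrightarrow> bounded_below (\<lambda>n. y * x n)"
  unfolding bounded_below_def
proof (intro allI)
  fix k v assume x: "\<forall>k v. \<exists>M. \<forall>n<M. \<forall>t. fst t \<le> k \<longrightarrow> coef (x n) t v = 0"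
  obtain M where M: "\<And>n t. n < M \<Longrightarrow> fst t \<le> k \<Longrightarrow> coef (x n) t v = 0"
    using x by blast
  have "coef (y * x n) u v = 0" if "n < M" "fst u \<le> k" for n u
  proof (rule ccontr)
    assume "coef (y * x n) u v \<noteq> 0"
    then obtain s t where st: "om_times s t = u" "coef y s (coef (x n) t v) \<noteq> 0"
      by (rule coef_times_nonzero)
    then have "coef (x n) t v = 0"
      using M[of n t] that om_times_le(2)[of t s] by auto
    with st(2) show False
      by simp
  qed
  then show "\<exists>M. \<forall>n<M. \<forall>t. fst t \<le> k \<longrightarrow> coef (y * x n) t v = 0"
    by blast
qed

text \<open>The bound depends on the vector, and \<open>y\<close> replaces \<open>v\<close> by
  finitely many vectors, over which a common bound is taken.\<close>

lemma bounded_below_right: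
  assumes "bounded_below x"
  shows "bounded_below (\<lambda>n. x n * y)"
  unfolding bounded_below_def
proof (intro allI)
  fix k v
  define B where "B = (\<lambda>t. coef y t v) ` {t. fst t \<le> k \<and> coef y t v \<noteq> 0}"
  have "finite B"
    unfolding B_def by (intro finite_imageI finite_coef)
  from bounded_below_finite_set[OF assms this, of k]
  obtain M where M: "\<forall>w\<in>B. \<forall>n<M. \<forall>t. fst t \<le> k \<longrightarrow> coef (x n) t w = 0"
    by blast
  have "coef (x n * y) u v = 0" if "n < M" "fst u \<le> k" for n u
  proof (rule ccontr)
    assume "coef (x n * y) u v \<noteq> 0"
    then obtain s t where st: "om_times s t = u" "coef (x n) s (coef y t v) \<noteq> 0"
      by (rule coef_times_nonzero)
    moreover have "coef y t v \<noteq> 0"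
      using st(2) by auto
    moreover have "fst s \<le> k" "fst t \<le> k"
      using st(1) that om_times_le(1)[of s t] om_times_le(2)[of t s] by auto
    ultimately show False
      using M \<open>n < M\<close> by (auto simp: B_def)
  qed
  then show "\<exists>M. \<forall>n<M. \<forall>t. fst t \<le> k \<longrightarrow> coef (x n * y) t v = 0"
    by blast
qed

lemma bounded_below_diff:
  assumes "bounded_below x" "bounded_below y"
  shows "bounded_below (\<lambda>n. x n - y n)"
  unfolding bounded_below_def
proof (intro allI)
  fix k v
  obtain M where "\<And>n t. n < M \<Longrightarrow> fst t \<le> k \<Longrightarrow> coef (x n) t v = 0"
    using bounded_belowD[OF assms(1), of k v] by blast
  moreover obtain M' where "\<And>n t. n < M' \<Longrightarrow> fst t \<le> k \<Longrightarrow> coef (y n) t v = 0"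
    using bounded_belowD[OF assms(2), of k v] by blast
  ultimately show "\<exists>M. \<forall>n<M. \<forall>t. fst t \<le> k \<longrightarrow> coef (x n - y n) t v = 0"
    by (intro exI[of _ "min M M'"]) simp
qed

lemma bounded_below_shift: "bounded_below x \<Longrightarrow> bounded_below (\<lambda>n. x (n - m))"
  unfolding bounded_below_def
proof (intro allI)
  fix k v assume "\<forall>k v. \<exists>M. \<forall>n<M. \<forall>t. fst t \<le> k \<longrightarrow> coef (x n) t v = 0"
  then obtain M where "\<forall>n<M. \<forall>t. fst t \<le> k \<longrightarrow> coef (x n) t v = 0"
    by blast
  then show "\<exists>M. \<forall>n<M. \<forall>t. fst t \<le> k \<longrightarrow> coef (x (n - m)) t v = 0"
    by (intro exI[of _ "M + m"]) auto
qed

lemma bounded_below_lsum: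
  fixes x :: "'i \<Rightarrow> int \<Rightarrow> ('k::case_index, 'u::superspace) opseries"
  assumes "\<And>i n. lambda_order (d i) (x i n)" "\<And>k. finite {i. d i \<le> k}" "\<And>i. bounded_below (x i)"
  shows "bounded_below (\<lambda>n. lsum (\<lambda>i. x i n))"
  unfolding bounded_below_def
proof (intro allI)
  fix k and v :: 'u
  have "\<exists>M. \<forall>i\<in>I. \<forall>n<M. \<forall>t. fst t \<le> k \<longrightarrow> coef (x i n) t v = 0" if "finite I" for I
    using that
  proof induction
    case (insert j I)
    then obtain M where M: "\<forall>i\<in>I. \<forall>n<M. \<forall>t. fst t \<le> k \<longrightarrow> coef (x i n) t v = 0"
      by blast
    obtain M' where "\<And>n t. n < M' \<Longrightarrow> fst t \<le> k \<Longrightarrow> coef (x j n) t v = 0"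
      using bounded_belowD[OF assms(3)[of j], of k v] by blast
    with M show ?case
      by (intro exI[of _ "min M M'"]) auto
  qed simp
  from this[OF assms(2)[of k]]
  obtain M where M: "\<forall>i\<in>{i. d i \<le> k}. \<forall>n<M. \<forall>t. fst t \<le> k \<longrightarrow> coef (x i n) t v = 0"
    by blast
  have "coef (lsum (\<lambda>i. x i n)) t v = 0" if "n < M" "fst t \<le> k" for n t
  proof -
    have "coef (x i n) t v = 0" for i
      using M that assms(1)[of i n] by (cases t; cases "d i \<le> k") (auto simp: lambda_order_def)
    then show ?thesis
      by (simp add: coef_lsum[OF lsummable_lambda_order[OF assms(1,2)]])
  qed
  then show "\<exists>M. \<forall>n<M. \<forall>t. fst t \<le> k \<longrightarrow> coef (lsum (\<lambda>i. x i n)) t v = 0"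
    by blast
qed

text \<open>With the next lemma, the reason why normally ordered products exist. In both halves the
  factor that acts first bounds the free side of the range: for m \<ge> m0 the factor y_{n-m} kills
  \<open>v\<close> when m is large, for m < m0 the factor y_m kills it when m is very
  negative.\<close>

lemma lsummable2_plus:
  assumes "bounded_below y"
  shows "lsummable2 (\<lambda>m. if m \<ge> m0 then x m else 0) (\<lambda>m. y (n - m))"
proof (rule lsummable2I)
  fix k v
  obtain M where M: "\<And>n t. n < M \<Longrightarrow> fst t \<le> k \<Longrightarrow> coef (y n) t v = 0"
    using bounded_belowD[OF assms, of k v] by blast
  have "m \<in> {m0..n - M}"
    if "fst t \<le> k" "coef (if m \<ge> m0 then x m else 0) s (coef (y (n - m)) t v) \<noteq> 0" for m s t
  proof -
    have "m \<ge> m0" "coef (y (n - m)) t v \<noteq> 0"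
      using that(2) by (auto split: if_splits)
    then show ?thesis
      using M[of "n - m" t] that(1) by (cases "n - m < M") auto
  qed
  then show "\<exists>A. finite A \<and> (\<forall>m s t. fst s \<le> k \<longrightarrow> fst t \<le> k \<longrightarrow>
      coef (if m \<ge> m0 then x m else 0) s (coef (y (n - m)) t v) \<noteq> 0 \<longrightarrow> m \<in> A)"
    by (intro exI[of _ "{m0..n - M}"] conjI finite_atLeastAtMost_int) blast
qed

lemma lsummable2_minus:
  assumes "bounded_below y"
  shows "lsummable2 (\<lambda>m. x (n - m)) (\<lambda>m. if m < m0 then y m else 0)"
proof (rule lsummable2I)
  fix k v
  obtain M where M: "\<And>n t. n < M \<Longrightarrow> fst t \<le> k \<Longrightarrow> coef (y n) t v = 0"
    using bounded_belowD[OF assms, of k v] by blast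
  have "m \<in> {M..m0}"
    if "fst t \<le> k" "coef (x (n - m)) s (coef (if m < m0 then y m else 0) t v) \<noteq> 0" for m s t
  proof -
    have "m < m0" "coef (y m) t v \<noteq> 0"
      using that(2) by (auto split: if_splits)
    then show ?thesis
      using M[of m t] that(1) by (cases "m < M") auto
  qed
  then show "\<exists>A. finite A \<and> (\<forall>m s t. fst s \<le> k \<longrightarrow> fst t \<le> k \<longrightarrow>
      coef (x (n - m)) s (coef (if m < m0 then y m else 0) t v) \<noteq> 0 \<longrightarrow> m \<in> A)"
    by (intro exI[of _ "{M..m0}"] conjI finite_atLeastAtMost_int) blast
qed

section \<open>Extracting coefficients\<close>

definition supported :: "generator set \<Rightarrow> ('k::case_index, 'u::superspace) opseries \<Rightarrow> bool" where
  "supported Q x \<longleftrightarrow> (\<forall>t v. coef x t v \<noteq> 0 \<longrightarrow> fst t = 0 \<and> snd t \<subseteq> Q)"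

lemma supportedD:
  assumes "supported Q x" "coef x t v \<noteq> 0"
  shows "fst t = 0" "snd t \<subseteq> Q"
  using assms unfolding supported_def by blast+

definition square_free :: "generator set \<Rightarrow> bool" where
  "square_free Q \<longleftrightarrow> (\<forall>\<kappa>. \<forall>g\<in>Q. gen_square \<kappa> g = 0)"

lemma gen_square_simps [simp]: "gen_square \<kappa> (Theta i) = 0" "gen_square \<kappa> (Zeta i) = 0"
  by (cases \<kappa>; simp)+

lemma square_free_Theta: "square_free (range Theta)"
  and square_free_Zeta: "square_free (range Zeta)"
  by (auto simp: square_free_def)

lemma cocycle_square_free:
  assumes "square_free Q" "T \<subseteq> Q" "finite T"
  shows "cocycle \<kappa> S T = (if S \<inter> T = {} then swap_sign S T else 0)"
    and "cocycle \<kappa> T S = (if T \<inter> S = {} then swap_sign T S else 0)"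
proof -
  have "square_factor \<kappa> (S \<inter> T) = 0" if "S \<inter> T \<noteq> {}"
    using assms that by (fastforce simp: square_factor_def square_free_def)
  then show "cocycle \<kappa> S T = (if S \<inter> T = {} then swap_sign S T else 0)"
    "cocycle \<kappa> T S = (if T \<inter> S = {} then swap_sign T S else 0)"
    by (auto simp: cocycle_def square_factor_def Int_commute)
qed

lemma om_times_disjoint_eq:
  assumes "om_times s t = (l, S)" "snd s \<inter> snd t = {}"
  shows "fst s + fst t = l" "snd t \<subseteq> S" "snd s = S - snd t" "snd s \<subseteq> S" "snd t = S - snd s"
  using assms by (auto simp: om_times_def symdiff_def)

text \<open>A generator of \<open>y\<close> that also occurs in \<open>x\<close> kills the term, so
  the monomial \<open>S\<close> arises only by splitting it into disjoint parts, and the infinite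
  sum becomes one over the subsets contributed by \<open>y\<close>.\<close>

lemma coef_times_supported:
  fixes x y :: "('k::case_index, 'u::superspace) opseries"
  assumes "supported Q y" "square_free Q" "finite S"
  shows "coef (x * y) (l, S) v
      = (\<Sum>T\<in>Pow S. swap_sign (S - T) T *\<^sub>C coef x (l, S - T) (coef y (0, T) v))"
proof -
  let ?f = "\<lambda>(s, t). if om_times s t = (l, S)
     then cocycle (index_case TYPE('k)) (snd s) (snd t) *\<^sub>C coef x s (coef y t v) else 0"
  let ?h = "\<lambda>T. ((l, S - T), (0, T)) :: odd_monomial \<times> odd_monomial"
  have "{p. ?f p \<noteq> 0} \<subseteq> ?h ` Pow S"
  proof
    fix p assume p: "p \<in> {p. ?f p \<noteq> 0}"
    obtain s t where st: "p = (s, t)" by (cases p)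
    have *: "om_times s t = (l, S)" "coef y t v \<noteq> 0"
      "cocycle (index_case TYPE('k)) (snd s) (snd t) \<noteq> 0"
      using p by (auto simp: st split: if_splits)
    have t: "fst t = 0" "snd t \<subseteq> Q" "finite (snd t)"
      by (rule supportedD[OF assms(1) *(2)] coef_finite[OF *(2)])+
    then have "snd s \<inter> snd t = {}"
      using *(3) cocycle_square_free(1)[OF assms(2) t(2,3)] by (auto split: if_splits)
    from om_times_disjoint_eq(1-3)[OF *(1) this] show "p \<in> ?h ` Pow S"
      using t by (intro image_eqI[of _ _ "snd t"]) (auto simp: st prod_eq_iff)
  qed
  then have "Sum_any ?f = sum ?f (?h ` Pow S)"
    using assms(3) by (intro Sum_any.expand_superset) auto
  also have "\<dots> = (\<Sum>T\<in>Pow S. ?f (?h T))"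
    by (subst sum.reindex) (auto simp: inj_on_def)
  also have "\<dots> = (\<Sum>T\<in>Pow S. swap_sign (S - T) T *\<^sub>C coef x (l, S - T) (coef y (0, T) v))"
  proof (rule sum.cong[OF refl])
    fix T assume "T \<in> Pow S"
    then have T: "T \<subseteq> S" "finite T"
      using assms(3) finite_subset by auto
    have "S - T \<triangle> T = S"
      using T by (auto simp: symdiff_def)
    moreover have "cocycle (index_case TYPE('k)) (S - T) T = swap_sign (S - T) T" if "T \<subseteq> Q"
      using cocycle_square_free(1)[OF assms(2) that T(2)] by auto
    moreover have "coef y (0, T) v = 0" if "\<not> T \<subseteq> Q"
      using assms(1) that by (auto simp: supported_def)
    moreover have "(S - T) \<inter> T = {}"
      by auto
    ultimately show "?f (?h T) = swap_sign (S - T) T *\<^sub>C coef x (l, S - T) (coef y (0, T) v)"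
      by (cases "T \<subseteq> Q") (simp_all add: om_times_def)
  qed
  finally show ?thesis
    by (simp only: coef_times)
qed

lemma coef_supported_times:
  fixes x y :: "('k::case_index, 'u::superspace) opseries"
  assumes "supported Q y" "square_free Q" "finite S"
  shows "coef (y * x) (l, S) v
      = (\<Sum>T\<in>Pow S. swap_sign T (S - T) *\<^sub>C coef y (0, T) (coef x (l, S - T) v))"
proof -
  let ?f = "\<lambda>(s, t). if om_times s t = (l, S)
     then cocycle (index_case TYPE('k)) (snd s) (snd t) *\<^sub>C coef y s (coef x t v) else 0"
  let ?h = "\<lambda>T. ((0, T), (l, S - T)) :: odd_monomial \<times> odd_monomial"
  have "{p. ?f p \<noteq> 0} \<subseteq> ?h ` Pow S"
  proof
    fix p assume p: "p \<in> {p. ?f p \<noteq> 0}"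
    obtain t s where st: "p = (t, s)" by (cases p)
    have *: "om_times t s = (l, S)" "coef y t (coef x s v) \<noteq> 0"
      "cocycle (index_case TYPE('k)) (snd t) (snd s) \<noteq> 0"
      using p by (auto simp: st split: if_splits)
    have t: "fst t = 0" "snd t \<subseteq> Q" "finite (snd t)"
      by (rule supportedD[OF assms(1) *(2)] coef_finite[OF *(2)])+
    then have "snd t \<inter> snd s = {}"
      using *(3) cocycle_square_free(2)[OF assms(2) t(2,3)] by (auto split: if_splits)
    from om_times_disjoint_eq(1,4,5)[OF *(1) this] show "p \<in> ?h ` Pow S"
      using t by (intro image_eqI[of _ _ "snd t"]) (auto simp: st prod_eq_iff)
  qed
  then have "Sum_any ?f = sum ?f (?h ` Pow S)"
    using assms(3) by (intro Sum_any.expand_superset) auto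
  also have "\<dots> = (\<Sum>T\<in>Pow S. ?f (?h T))"
    by (subst sum.reindex) (auto simp: inj_on_def)
  also have "\<dots> = (\<Sum>T\<in>Pow S. swap_sign T (S - T) *\<^sub>C coef y (0, T) (coef x (l, S - T) v))"
  proof (rule sum.cong[OF refl])
    fix T assume "T \<in> Pow S"
    then have T: "T \<subseteq> S" "finite T"
      using assms(3) finite_subset by auto
    have "T \<triangle> (S - T) = S"
      using T by (auto simp: symdiff_def)
    moreover have "cocycle (index_case TYPE('k)) T (S - T) = swap_sign T (S - T)" if "T \<subseteq> Q"
      using cocycle_square_free(2)[OF assms(2) that T(2)] by auto
    moreover have "coef y (0, T) w = 0" if "\<not> T \<subseteq> Q" for w
      using assms(1) that by (auto simp: supported_def)
    moreover have "T \<inter> (S - T) = {}"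
      by auto
    ultimately show "?f (?h T) = swap_sign T (S - T) *\<^sub>C coef y (0, T) (coef x (l, S - T) v)"
      by (cases "T \<subseteq> Q") (simp_all add: om_times_def)
  qed
  finally show ?thesis
    by (simp only: coef_times)
qed

text \<open>\<open>part T x\<close> collects the terms of \<open>x\<close> that consist of the product of \<open>T\<close> followed by
  generators \<open>\<zeta>\<close>.\<close>

definition part :: "generator set \<Rightarrow> ('k::case_index, 'u::superspace) opseries \<Rightarrow> ('k, 'u) opseries" where
  "part T x = Opseries (\<lambda>t v. if snd t \<subseteq> range Zeta \<and> snd t \<inter> T = {}
     then pin (card T) (coef x (fst t, T \<union> snd t) v) else 0)"

lemma coef_part:
  fixes x :: "('k::case_index, 'u::superspace) opseries"
  shows "coef (part T x) (k, S) v = (if S \<subseteq> range Zeta \<and> S \<inter> T = {}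
     then pin (card T) (coef x (k, T \<union> S) v) else 0)"
proof -
  let ?F = "\<lambda>t v. if snd t \<subseteq> range Zeta \<and> snd t \<inter> T = {}
     then pin (card T) (coef x (fst t, T \<union> snd t) v) else 0"
  have "finite {t. fst t \<le> k \<and> ?F t v \<noteq> 0}" for k v
    by (rule finite_surj[OF finite_coef[of k x v], of _ "\<lambda>t. (fst t, snd t - T)"])
      (auto split: if_splits intro!: image_eqI[of _ _ "(_, T \<union> _)"])
  moreover have "?F t = 0" if "infinite (snd t)" for t
    using that by (auto simp: fun_eq_iff coef_infinite)
  moreover have "is_endo (?F t)" for t
    by (rule is_endoI) (auto simp: endo_add[OF is_endo_coef] endo_add[OF is_endo_pin]
      endo_scale[OF is_endo_pin] coef_scale)
  ultimately have "locally_finite ?F"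
    unfolding locally_finite_def by blast
  then show ?thesis
    by (simp add: part_def coef_Opseries)
qed

lemma part_infinite: "infinite T \<Longrightarrow> part T x = 0"
  by (rule opseries_eqI) (simp add: coef_part coef_infinite)

text \<open>Such generators precede every \<zeta> in the ordering, so they can be split off on the
  left of a monomial without sorting.\<close>

definition front :: "generator set \<Rightarrow> bool" where
  "front T \<longleftrightarrow> T \<inter> range Zeta = {}"

lemma front_precedes: "front T \<Longrightarrow> g \<in> T \<Longrightarrow> \<not> precedes (Zeta i) g"
  by (cases g) (auto simp: front_def)

lemma swap_sign_front:
  assumes "front T" "U \<subseteq> range Zeta"
  shows "swap_sign T U = 1"
proof -
  have "{(g, h) \<in> T \<times> U. precedes h g} = {}"
    using assms front_precedes by blast
  then show ?thesis
    unfolding swap_sign_def by (simp only: card.empty power_0)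
qed

text \<open>A right factor in the \<zeta>'s alone does not reach the prefix
  \<open>T\<close>.\<close>

lemma part_times:
  assumes "supported (range Zeta) y" "front T"
  shows "part T (x * y) = part T x * y"
proof (cases "finite T")
  case False
  then show ?thesis by (simp add: part_infinite)
next
  case True
  show ?thesis
  proof (rule opseries_eqI)
    fix l S v assume S: "finite (S :: generator set)"
    note right = coef_times_supported[OF assms(1) square_free_Zeta]
    have y0: "coef y (0, U) v = 0" if "\<not> U \<subseteq> range Zeta" for U
      using assms(1) that by (auto simp: supported_def)
    show "coef (part T (x * y)) (l, S) v = coef (part T x * y) (l, S) v"
    proof (cases "S \<subseteq> range Zeta")
      case False
      then have "(swap_sign (S - U) U *\<^sub>C coef (part T x) (l, S - U) (coef y (0, U) v)) = 0" for U
        using y0[of U] by (cases "U \<subseteq> range Zeta") (auto simp: coef_part)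
      then show ?thesis
        using False S by (simp only: coef_part right sum.neutral_const simp_thms if_False)
    next
      case Z: True
      then have ST: "S \<inter> T = {}"
        using assms(2) by (auto simp: front_def)
      have "coef (part T (x * y)) (l, S) v = pin (card T) (\<Sum>U\<in>Pow (T \<union> S).
          swap_sign (T \<union> S - U) U *\<^sub>C coef x (l, T \<union> S - U) (coef y (0, U) v))"
        using Z ST S True by (simp add: coef_part right)
      also have "\<dots> = (\<Sum>U\<in>Pow (T \<union> S).
          pin (card T) (swap_sign (T \<union> S - U) U *\<^sub>C coef x (l, T \<union> S - U) (coef y (0, U) v)))"
        by (rule endo_sum[OF is_endo_pin])
      also have "\<dots> = (\<Sum>U\<in>Pow S.
          pin (card T) (swap_sign (T \<union> S - U) U *\<^sub>C coef x (l, T \<union> S - U) (coef y (0, U) v)))"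
      proof (rule sum.mono_neutral_right)
        show "\<forall>U\<in>Pow (T \<union> S) - Pow S. pin (card T)
            (swap_sign (T \<union> S - U) U *\<^sub>C coef x (l, T \<union> S - U) (coef y (0, U) v)) = 0"
        proof
          fix U assume "U \<in> Pow (T \<union> S) - Pow S"
          then have "\<not> U \<subseteq> range Zeta"
            using assms(2) by (auto simp: front_def)
          then show "pin (card T)
            (swap_sign (T \<union> S - U) U *\<^sub>C coef x (l, T \<union> S - U) (coef y (0, U) v)) = 0"
            by (simp add: y0)
        qed
      qed (use S True in auto)
      also have "\<dots> = (\<Sum>U\<in>Pow S. swap_sign (S - U) U *\<^sub>C coef (part T x) (l, S - U) (coef y (0, U) v))"
      proof (rule sum.cong[OF refl])
        fix U assume "U \<in> Pow S"
        then have U: "U \<subseteq> S" "U \<subseteq> range Zeta" "S - U \<subseteq> range Zeta" "(S - U) \<inter> T = {}" "finite U"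
          using Z ST finite_subset[OF _ S] by auto
        have eq: "T \<union> S - U = T \<union> (S - U)"
          using U ST by auto
        have "T \<union> (S - U) = T \<triangle> (S - U)"
          using ST by (intro symdiff_disjoint[symmetric]) auto
        then have "swap_sign (T \<union> (S - U)) U = swap_sign (S - U) U"
          using swap_sign_symdiff_left[of T "S - U" U] U S True swap_sign_front[OF assms(2) U(2)]
          by simp
        then show "pin (card T) (swap_sign (T \<union> S - U) U *\<^sub>C coef x (l, T \<union> S - U) (coef y (0, U) v))
            = swap_sign (S - U) U *\<^sub>C coef (part T x) (l, S - U) (coef y (0, U) v)"
          using U by (simp add: coef_part eq endo_scale[OF is_endo_pin])
      qed
      also have "\<dots> = coef (part T x * y) (l, S) v"
        using S by (simp add: right)
      finally show ?thesis .
    qed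
  qed
qed

text \<open>A term of \<open>y\<close> with generators \<open>U\<close> passes \<open>T\<close> with
  sign (-1)^(|T||U|), and its operator passes the power of \<Pi> split off with \<open>T\<close>
  with sign (-1)^(|T|(p+|U|)); together (-1)^(p|T|).\<close>

lemma times_part:
  assumes "supported (range Zeta) y" "front T" "has_parity p y"
  shows "part T (y * x) = lam 0 (sgn1 (p * card T)) * (y * part T x)"
proof (cases "finite T")
  case False
  then show ?thesis by (simp add: part_infinite)
next
  case True
  show ?thesis
  proof (rule opseries_eqI)
    fix l S v assume S: "finite (S :: generator set)"
    note left = coef_supported_times[OF assms(1) square_free_Zeta]
    have y0: "coef y (0, U) w = 0" if "\<not> U \<subseteq> range Zeta" for U w
      using assms(1) that by (auto simp: supported_def)
    show "coef (part T (y * x)) (l, S) v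
      = coef (lam 0 (sgn1 (p * card T)) * (y * part T x)) (l, S) v"
    proof (cases "S \<subseteq> range Zeta")
      case False
      then have "(swap_sign U (S - U) *\<^sub>C coef y (0, U) (coef (part T x) (l, S - U) v)) = 0" for U
        using y0[of U] by (cases "U \<subseteq> range Zeta") (auto simp: coef_part)
      then show ?thesis
        using False S by (simp only: coef_part left coef_lam_times sum.neutral_const simp_thms if_False
            le0 if_True scaleC.scale_zero_right diff_zero)
    next
      case Z: True
      then have ST: "S \<inter> T = {}"
        using assms(2) by (auto simp: front_def)
      have "coef (part T (y * x)) (l, S) v = pin (card T) (\<Sum>U\<in>Pow (T \<union> S).
          swap_sign U (T \<union> S - U) *\<^sub>C coef y (0, U) (coef x (l, T \<union> S - U) v))"
        using Z ST S True by (simp add: coef_part left)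
      also have "\<dots> = (\<Sum>U\<in>Pow (T \<union> S).
          pin (card T) (swap_sign U (T \<union> S - U) *\<^sub>C coef y (0, U) (coef x (l, T \<union> S - U) v)))"
        by (rule endo_sum[OF is_endo_pin])
      also have "\<dots> = (\<Sum>U\<in>Pow S.
          pin (card T) (swap_sign U (T \<union> S - U) *\<^sub>C coef y (0, U) (coef x (l, T \<union> S - U) v)))"
      proof (rule sum.mono_neutral_right)
        show "\<forall>U\<in>Pow (T \<union> S) - Pow S. pin (card T)
            (swap_sign U (T \<union> S - U) *\<^sub>C coef y (0, U) (coef x (l, T \<union> S - U) v)) = 0"
        proof
          fix U assume "U \<in> Pow (T \<union> S) - Pow S"
          then have "\<not> U \<subseteq> range Zeta"
            using assms(2) by (auto simp: front_def)
          then show "pin (card T)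
            (swap_sign U (T \<union> S - U) *\<^sub>C coef y (0, U) (coef x (l, T \<union> S - U) v)) = 0"
            by (simp add: y0)
        qed
      qed (use S True in auto)
      also have "\<dots> = (\<Sum>U\<in>Pow S. sgn1 (p * card T) *\<^sub>C
          (swap_sign U (S - U) *\<^sub>C coef y (0, U) (coef (part T x) (l, S - U) v)))"
      proof (rule sum.cong[OF refl])
        fix U assume "U \<in> Pow S"
        then have U: "U \<subseteq> S" "U \<subseteq> range Zeta" "S - U \<subseteq> range Zeta" "(S - U) \<inter> T = {}" "finite U"
          "T \<inter> U = {}"
          using Z ST finite_subset[OF _ S] by auto
        have eq: "T \<union> S - U = T \<union> (S - U)"
          using U ST by auto
        have "T \<union> (S - U) = T \<triangle> (S - U)"
          using ST by (intro symdiff_disjoint[symmetric]) auto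
        then have "swap_sign U (T \<union> (S - U)) = sgn1 (card T * card U) * swap_sign U (S - U)"
          using swap_sign_symdiff_right[of U T "S - U"] U S True swap_sign_front[OF assms(2) U(2)]
            swap_sign_commute[OF True U(5,6)]
          by simp
        moreover have "pin (card T) (coef y (0, U) w)
            = (sgn1 (p * card T) * sgn1 (card T * card U)) *\<^sub>C coef y (0, U) (pin (card T) w)" for w
          using has_parity_pin[OF assms(3), of "card T" "(0, U)" w]
          by (simp add: power_add algebra_simps)
        ultimately show "pin (card T) (swap_sign U (T \<union> S - U) *\<^sub>C coef y (0, U) (coef x (l, T \<union> S - U) v))
            = sgn1 (p * card T) *\<^sub>C
              (swap_sign U (S - U) *\<^sub>C coef y (0, U) (coef (part T x) (l, S - U) v))"
          using U by (simp add: coef_part eq endo_scale[OF is_endo_pin] scaleC_scaleC mult_ac)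
      qed
      also have "\<dots> = coef (lam 0 (sgn1 (p * card T)) * (y * part T x)) (l, S) v"
        using S by (simp add: left coef_lam_times endo_sum[OF is_endo_scale])
      finally show ?thesis .
    qed
  qed
qed

lemma part_add: "part T (x + y) = part T x + part T y"
  and part_uminus: "part T (- x) = - part T x"
  and part_zero [simp]: "part T 0 = 0"
  by (rule opseries_eqI; simp add: coef_part endo_add[OF is_endo_pin] endo_minus[OF is_endo_pin])+

lemma part_diff: "part T (x - y) = part T x - part T y"
  using part_add[of T x "- y"] by (simp add: part_uminus)

lemma part_lam_times: "part T (lam k c * x) = lam k c * part T x"
  by (rule opseries_eqI) (simp add: coef_part coef_lam_times endo_scale[OF is_endo_pin])

lemma lsummable_part:
  assumes "lsummable f"
  shows "lsummable (\<lambda>i. part T (f i))"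
  unfolding lsummable_def
proof (intro allI)
  fix k v
  have fin: "finite {(i, t). fst t \<le> k \<and> coef (f i) t v \<noteq> 0}"
    using assms by (simp add: lsummable_def)
  show "finite {(i, t). fst t \<le> k \<and> coef (part T (f i)) t v \<noteq> 0}"
  proof (rule finite_surj[OF fin, of _ "\<lambda>(i, t). (i, (fst t, snd t - T))"], rule subsetI, clarify)
    fix i l S assume "fst (l, S) \<le> k" "coef (part T (f i)) (l, S) v \<noteq> 0"
    then have "l \<le> k" "S \<inter> T = {}" "coef (f i) (l, T \<union> S) v \<noteq> 0"
      by (auto simp: coef_part split: if_splits)
    then show "(i, l, S) \<in> (\<lambda>(i, t). (i, (fst t, snd t - T))) ` {(i, t). fst t \<le> k \<and> coef (f i) t v \<noteq> 0}"
      by (intro image_eqI[of _ _ "(i, (l, T \<union> S))"]) auto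
  qed
qed

lemma part_lsum:
  assumes "lsummable f"
  shows "part T (lsum f) = lsum (\<lambda>i. part T (f i))"
proof (rule opseries_eqI)
  fix k S v
  show "coef (part T (lsum f)) (k, S) v = coef (lsum (\<lambda>i. part T (f i))) (k, S) v"
    by (cases "S \<subseteq> range Zeta \<and> S \<inter> T = {}")
      (simp_all only: coef_lsum[OF assms] coef_lsum[OF lsummable_part[OF assms]] coef_part if_True
        if_False endo_Sum_any[OF is_endo_pin] lsummable_finite[OF assms] Sum_any.neutral simp_thms)
qed

lemma bounded_below_part:
  assumes "bounded_below x"
  shows "bounded_below (\<lambda>n. part T (x n))"
  unfolding bounded_below_def
proof (intro allI)
  fix k v
  obtain M where "\<forall>n<M. \<forall>t. fst t \<le> k \<longrightarrow> coef (x n) t v = 0"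
    using bounded_belowD[OF assms, of k v] by blast
  then show "\<exists>M. \<forall>n<M. \<forall>t. fst t \<le> k \<longrightarrow> coef (part T (x n)) t v = 0"
    by (intro exI[of _ M]) (auto simp: coef_part)
qed

lemma has_parity_part:
  assumes "has_parity p x"
  shows "has_parity (p + card T) (part T x)"
proof (cases "finite T")
  case True
  have pp: "\<Pi> (pin n w) = pin n (\<Pi> w)" for n and w :: 'b
    by (simp add: pin_def)
  have card: "card (T \<union> S) = card T + card S" if "coef x (k, T \<union> S) v \<noteq> 0" "S \<inter> T = {}" for k S v
    using coef_finite[OF that(1)] that(2) by (intro card_Un_disjoint) auto
  have "\<Pi> (coef (part T x) (k, S) (\<Pi> v)) = sgn1 (p + card T + card S) *\<^sub>C coef (part T x) (k, S) v" for k S v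
    using card[of k S v] has_parityD[OF assms, of "(k, T \<union> S)" "\<Pi> v"]
    by (cases "coef x (k, T \<union> S) v = 0")
      (auto simp: coef_part pp endo_zero[OF is_endo_pinv] endo_zero[OF is_endo_pin]
        endo_scale[OF is_endo_pin] add.assoc)
  then show ?thesis
    by (simp add: has_parity_def)
qed (simp add: part_infinite has_parity_zero)

text \<open>The coefficient is stored at \<lambda>^0, so that a coefficient of a bracket can be
  treated like a mode of a field.\<close>

definition lambda_coeff :: "nat \<Rightarrow> ('k::case_index, 'u::superspace) opseries \<Rightarrow> ('k, 'u) opseries" where
  "lambda_coeff l x = Opseries (\<lambda>t v. if fst t = 0 then coef x (l, snd t) v else 0)"

lemma coef_lambda_coeff:
  fixes x :: "('k::case_index, 'u::superspace) opseries"
  shows "coef (lambda_coeff l x) (k, S) v = (if k = 0 then coef x (l, S) v else 0)"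
proof -
  let ?F = "\<lambda>t v. if fst t = 0 then coef x (l, snd t) v else 0"
  have "finite {t. fst t \<le> k \<and> ?F t v \<noteq> 0}" for k v
    by (rule finite_surj[OF finite_coef[of l x v], of _ "\<lambda>t. (0, snd t)"])
      (auto split: if_splits intro!: image_eqI[of _ _ "(l, _)"])
  moreover have "?F t = 0" if "infinite (snd t)" for t
    using that by (auto simp: fun_eq_iff coef_infinite)
  moreover have "is_endo (?F t)" for t
    by (rule is_endoI) (auto simp: endo_add[OF is_endo_coef] coef_scale)
  ultimately have "locally_finite ?F"
    unfolding locally_finite_def by blast
  then show ?thesis
    by (simp add: lambda_coeff_def coef_Opseries)
qed

lemma lambda_coeff_times:
  assumes "supported Q y" "square_free Q"
  shows "lambda_coeff l (x * y) = lambda_coeff l x * y"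
  using assms
  by (intro opseries_eqI) (simp add: coef_lambda_coeff coef_times_supported)

lemma times_lambda_coeff:
  assumes "supported Q y" "square_free Q"
  shows "lambda_coeff l (y * x) = y * lambda_coeff l x"
  using assms
  by (intro opseries_eqI) (simp add: coef_lambda_coeff coef_supported_times)

lemma has_parity_lambda_coeff: "has_parity p x \<Longrightarrow> has_parity p (lambda_coeff l x)"
  by (auto simp: has_parity_def coef_lambda_coeff endo_zero[OF is_endo_pinv])

lemma lambda_coeff_add: "lambda_coeff l (x + y) = lambda_coeff l x + lambda_coeff l y"
  and lambda_coeff_uminus: "lambda_coeff l (- x) = - lambda_coeff l x"
  and lambda_coeff_zero [simp]: "lambda_coeff l 0 = 0"
  by (rule opseries_eqI; simp add: coef_lambda_coeff)+

lemma lsummable_lambda_coeff: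
  assumes "lsummable f"
  shows "lsummable (\<lambda>i. lambda_coeff l (f i))"
  unfolding lsummable_def
proof (intro allI)
  fix k v
  have fin: "finite {(i, t). fst t \<le> l \<and> coef (f i) t v \<noteq> 0}"
    using assms by (simp add: lsummable_def)
  show "finite {(i, t). fst t \<le> k \<and> coef (lambda_coeff l (f i)) t v \<noteq> 0}"
  proof (rule finite_surj[OF fin, of _ "\<lambda>(i, t). (i, (0, snd t))"], rule subsetI, clarify)
    fix i m S assume "coef (lambda_coeff l (f i)) (m, S) v \<noteq> 0"
    then have "m = 0" "coef (f i) (l, S) v \<noteq> 0"
      by (auto simp: coef_lambda_coeff split: if_splits)
    then show "(i, m, S) \<in> (\<lambda>(i, t). (i, (0, snd t))) ` {(i, t). fst t \<le> l \<and> coef (f i) t v \<noteq> 0}"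
      by (intro image_eqI[of _ _ "(i, (l, S))"]) auto
  qed
qed

lemma lambda_coeff_lsum:
  assumes "lsummable f"
  shows "lambda_coeff l (lsum f) = lsum (\<lambda>i. lambda_coeff l (f i))"
  by (rule opseries_eqI) (simp add: coef_lsum assms lsummable_lambda_coeff coef_lambda_coeff)


section \<open>Modes of fields\<close>

text \<open>The odd variables are named by \<open>V\<close> because the same field occurs both in
  \<theta> and in \<zeta>; comparing the two is the task of the odd delta function.\<close>

definition mode :: "(nat \<Rightarrow> generator) \<Rightarrow> 'u field \<Rightarrow> int \<Rightarrow> ('k::case_index, 'u::superspace) opseries" where
  "mode V f m = Opseries (\<lambda>t v. if fst t = 0 \<and> snd t \<subseteq> range V
     then pin (card (snd t)) (f m {i. V i \<in> snd t} v) else 0)"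

lemma inj_Theta: "inj Theta" and inj_Zeta: "inj Zeta"
  by (auto simp: inj_on_def)

lemma is_fieldD:
  assumes "is_field N f"
  shows "is_endo (f m I)" "\<not> I \<subseteq> {1..N} \<Longrightarrow> f m I = 0" "\<exists>M. \<forall>n<M. \<forall>I. f n I v = 0"
proof -
  have *: "\<forall>n I. is_endo (f n I)" "\<forall>n I. \<not> I \<subseteq> {1..N} \<longrightarrow> f n I = 0"
    "\<forall>v. \<exists>M. \<forall>n<M. \<forall>I. f n I v = 0"
    using assms unfolding is_field_def by simp_all
  show "is_endo (f m I)" "\<not> I \<subseteq> {1..N} \<Longrightarrow> f m I = 0"
    using *(1,2) by simp_all
  show "\<exists>M. \<forall>n<M. \<forall>I. f n I v = 0"
    by (rule *(3)[THEN spec])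
qed

lemma coef_mode:
  fixes f :: "'u::superspace field"
  assumes "is_field N f" "inj V"
  shows "coef (mode V f m :: ('k::case_index, 'u) opseries) (k, S) v
    = (if k = 0 \<and> S \<subseteq> range V then pin (card S) (f m {i. V i \<in> S} v) else 0)"
proof -
  let ?F = "\<lambda>(t :: odd_monomial) v. if fst t = 0 \<and> snd t \<subseteq> range V
     then pin (card (snd t)) (f m {i. V i \<in> snd t} v) else 0"
  have supp: "snd t \<subseteq> V ` {1..N}" if ne: "?F t v \<noteq> 0" for t v
  proof
    fix g assume "g \<in> snd t"
    have t: "snd t \<subseteq> range V" "f m {i. V i \<in> snd t} \<noteq> 0"
      using ne by (auto split: if_splits)
    obtain i where i: "g = V i"
      using t(1) \<open>g \<in> snd t\<close> by blast
    have "{i. V i \<in> snd t} \<subseteq> {1..N}"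
      using t(2) is_fieldD(2)[OF assms(1)] by metis
    then show "g \<in> V ` {1..N}"
      using \<open>g \<in> snd t\<close> i by blast
  qed
  have endo: "is_endo (f m I)" for I
    by (rule is_fieldD(1)[OF assms(1)])
  have "finite {t. fst t \<le> k \<and> ?F t v \<noteq> 0}" for k v
  proof (rule finite_subset)
    show "{t. fst t \<le> k \<and> ?F t v \<noteq> 0} \<subseteq> {..k} \<times> Pow (V ` {1..N})"
    proof (rule subsetI)
      fix t assume "t \<in> {t. fst t \<le> k \<and> ?F t v \<noteq> 0}"
      then have "fst t \<le> k" "?F t v \<noteq> 0"
        by simp_all
      from this(1) supp[OF this(2)] show "t \<in> {..k} \<times> Pow (V ` {1..N})"
        by (simp only: mem_Times_iff atMost_iff Pow_iff simp_thms)
    qed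
  qed auto
  moreover have "?F t = 0" if "infinite (snd t)" for t
  proof
    fix v
    have "\<not> snd t \<subseteq> V ` {1..N}"
      using that finite_subset by blast
    then show "?F t v = 0 v"
      using supp[of t v] unfolding zero_fun_apply by blast
  qed
  moreover have "is_endo (?F t)" for t
    by (rule is_endoI) (simp_all add: endo_add[OF endo] endo_scale[OF endo] endo_add[OF is_endo_pin]
      endo_scale[OF is_endo_pin])
  ultimately have "locally_finite ?F"
    unfolding locally_finite_def by blast
  then show ?thesis
    by (simp add: mode_def coef_Opseries)
qed

lemma supported_mode: "is_field N f \<Longrightarrow> inj V \<Longrightarrow> supported (range V) (mode V f m)"
  by (auto simp: supported_def coef_mode split: if_splits)

lemma bounded_below_mode:
  assumes "is_field N f" "inj V"
  shows "bounded_below (mode V f)"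
  unfolding bounded_below_def
proof (intro allI)
  fix k v
  obtain M where "\<forall>n<M. \<forall>I. f n I v = 0"
    using is_fieldD(3)[OF assms(1)] by blast
  then show "\<exists>M. \<forall>n<M. \<forall>t. fst t \<le> k \<longrightarrow> coef (mode V f n) t v = 0"
    by (intro exI[of _ M]) (auto simp: coef_mode[OF assms])
qed

lemma pinv_pin: "\<Pi> (pin n w) = pin n (\<Pi> w)"
  by (simp add: pin_def)

lemma has_parity_mode:
  assumes "is_field N f" "inj V" "field_homogeneous p f"
  shows "has_parity p (mode V f m)"
  unfolding has_parity_def
proof (intro allI)
  fix t :: odd_monomial and v
  obtain k S where t: "t = (k, S)" by (cases t)
  let ?I = "{i. V i \<in> S}"
  have "\<Pi> (f m ?I (\<Pi> v)) = sgn1 (p + card ?I) *\<^sub>C f m ?I v"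
    using assms operator_homogeneous_iff[of "f m ?I" "p + card ?I"]
    by (simp add: field_homogeneous_def is_field_def)
  moreover have "card ?I = card S" if "S \<subseteq> range V"
  proof -
    have "V ` ?I = S"
      using that by auto
    then show ?thesis
      using card_image[of V ?I] assms(2) by (simp add: inj_on_subset)
  qed
  ultimately show "\<Pi> (coef (mode V f m) t (\<Pi> v)) = sgn1 (p + card (snd t)) *\<^sub>C coef (mode V f m) t v"
    by (auto simp: t coef_mode[OF assms(1,2)] pinv_pin endo_scale[OF is_endo_pin] endo_zero[OF is_endo_pinv])
qed

text \<open>For normally ordered products and brackets, homogeneity is first known of the
  modes.\<close>

lemma field_homogeneous_if_has_parity:
  assumes "is_field N f" "\<And>m. has_parity p (mode Zeta f m :: ('k::case_index, 'u::superspace) opseries)"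
  shows "field_homogeneous p f"
  unfolding field_homogeneous_def
proof (intro allI)
  fix n I
  have endo: "is_endo (f n I)"
    using assms(1) by (simp add: is_field_def)
  have I: "{i. Zeta i \<in> Zeta ` I} = I" "card (Zeta ` I) = card I"
    by (auto intro!: card_image inj_on_subset[OF inj_Zeta])
  have "\<Pi> (f n I (\<Pi> v)) = sgn1 (p + card I) *\<^sub>C f n I v" for v
    using assms(2)[of n, unfolded has_parity_def, rule_format, of "(0, Zeta ` I)" v]
    by (simp add: coef_mode[OF assms(1) inj_Zeta] I image_mono pinv_pin flip: endo_scale[OF is_endo_pin])
  then show "operator_homogeneous (p + card I) (f n I)"
    by (simp add: operator_homogeneous_iff[OF endo])
qed

section \<open>Formal series in terms of their components\<close>

text \<open>The dictionary between formal series in all variables and families, indexed by the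
  exponents of z and w, in the ring. The factor \<open>pin (card S)\<close> converts ring
  coordinates back into coefficients.\<close>

definition represents :: "'u::superspace series \<Rightarrow> (int \<Rightarrow> int \<Rightarrow> ('k::case_index, 'u) opseries) \<Rightarrow> bool" where
  "represents F x \<longleftrightarrow> (\<forall>m n k S v. F (Mon m n k S) v = pin (card S) (coef (x m n) (k, S) v))"

lemma representsD: "represents F x \<Longrightarrow> F (Mon m n k S) v = pin (card S) (coef (x m n) (k, S) v)"
  by (simp add: represents_def)

lemma represents_add: "represents F x \<Longrightarrow> represents G y \<Longrightarrow> represents (F + G) (\<lambda>m n. x m n + y m n)"
  by (simp add: represents_def endo_add[OF is_endo_pin])

lemma represents_diff: "represents F x \<Longrightarrow> represents G y \<Longrightarrow> represents (F - G) (\<lambda>m n. x m n - y m n)"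
  by (simp add: represents_def endo_diff[OF is_endo_pin])

lemma represents_zero: "represents 0 (\<lambda>m n. 0)"
  by (simp add: represents_def endo_zero[OF is_endo_pin])

lemma represents_sum:
  "finite I \<Longrightarrow> (\<And>i. i \<in> I \<Longrightarrow> represents (F i) (x i)) \<Longrightarrow> represents (sum F I) (\<lambda>m n. \<Sum>i\<in>I. x i m n)"
  by (induction I rule: finite_induct) (simp_all add: represents_add represents_zero)

lemma represents_minus_one_power:
  "represents F x \<Longrightarrow> represents (minus_one_power p F) (\<lambda>m n. lam 0 (sgn1 p) * x m n)"
  by (auto simp: represents_def minus_one_power_def coef_lam_times scaleC_one endo_minus[OF is_endo_pin])

text \<open>The purpose of the coordinates: with F = \<Pi>^|S| x and G = \<Pi>^|T| y, the twisted
  product \<Pi>^|T| F \<Pi>^|T| G equals \<Pi>^(|S|+|T|) x y, and |S|+|T| has the parity of the size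
  of the symmetric difference. The twist thus becomes plain composition.\<close>

lemma represents_mult:
  fixes x y :: "int \<Rightarrow> int \<Rightarrow> ('k::case_index, 'u::superspace) opseries"
  assumes "represents F x" "represents G y"
    and "\<And>m n. lsummable2 (\<lambda>(p, q). x p q) (\<lambda>(p, q). y (m - p) (n - q))"
  shows "represents (series_mult (index_case TYPE('k)) F G)
    (\<lambda>m n. lsum (\<lambda>(p, q). x p q * y (m - p) (n - q)))"
  unfolding represents_def
proof (intro allI)
  fix m n :: int and k S and v :: 'u
  let ?\<kappa> = "index_case TYPE('k)"
  let ?c = "\<lambda>s t :: odd_monomial. cocycle ?\<kappa> (snd s) (snd t)"
  let ?f = "\<lambda>(M1, M2). if mon_times M1 M2 = Mon m n k S
     then mon_sign ?\<kappa> M1 M2 *\<^sub>C twist (mon_degree M2) (F M1) (G M2 v) else 0"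
  let ?h = "\<lambda>(i, p). case i of (m1, n1) \<Rightarrow> case p of (s, t) \<Rightarrow>
     (Mon m1 n1 (fst s) (snd s), Mon (m - m1) (n - n1) (fst t) (snd t))"
  let ?g = "\<lambda>(M1, M2). case M1 of Mon m1 n1 k1 S1 \<Rightarrow> case M2 of Mon m2 n2 k2 S2 \<Rightarrow>
     ((m1, n1), ((k1, S1), (k2, S2)))"
  let ?T = "\<lambda>(i, p). case p of (s, t) \<Rightarrow> if om_times s t = (k, S) then
     ?c s t *\<^sub>C coef (case i of (p, q) \<Rightarrow> x p q) s (coef (case i of (p, q) \<Rightarrow> y (m - p) (n - q)) t v) else 0"
  note fin = finite_product_terms2[OF assms(3)[of m n], of "(k, S)" ?c v]
  have "Sum_any ?f = Sum_any (\<lambda>j. ?f (?h j))"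
  proof (rule Sum_any_reindex_inv[of ?g])
    fix i assume i: "?f i \<noteq> 0"
    obtain m1 n1 k1 S1 m2 n2 k2 S2 where "i = (Mon m1 n1 k1 S1, Mon m2 n2 k2 S2)"
      by (metis mon_degree.cases surj_pair)
    with i show "?h (?g i) = i"
      by (auto split: if_splits)
  qed (auto split: prod.split)
  also have "\<dots> = Sum_any (\<lambda>j. pin (card S) (?T j))"
  proof (rule Sum_any.cong)
    fix j :: "(int \<times> int) \<times> odd_monomial \<times> odd_monomial"
    obtain m1 n1 s t where j: "j = ((m1, n1), (s, t))"
      by (metis surj_pair)
    let ?w = "coef (x m1 n1) s (coef (y (m - m1) (n - n1)) t v)"
    show "?f (?h j) = pin (card S) (?T j)"
    proof (cases "om_times s t = (k, S) \<and> ?w \<noteq> 0")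
      case True
      then have fin: "finite (snd s)" "finite (snd t)"
        using coef_finite by (metis coef_zero)+
      have "even (card (snd t) + card (snd s)) = even (card S)"
        using even_card_symdiff[OF fin] True by (auto simp: om_times_def)
      then have "pin (card (snd t) + card (snd s)) = (pin (card S) :: 'u operator)"
        by (rule pin_cong_parity)
      then show ?thesis
        using True
        by (simp add: j om_times_def twist_eq representsD[OF assms(1)] representsD[OF assms(2)]
            pin_pin cocycle_def swap_sign_def square_factor_def endo_scale[OF is_endo_pin] symdiff_def)
    next
      case False
      then show ?thesis
        by (auto simp: j om_times_def twist_eq representsD[OF assms(1)] representsD[OF assms(2)]
            endo_zero[OF is_endo_pin] symdiff_def split: if_splits)
    qed
  qed
  also have "\<dots> = pin (card S) (Sum_any ?T)"
    using fin by (intro endo_Sum_any[OF is_endo_pin, symmetric]) (simp add: split_def)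
  also have "Sum_any ?T = coef (lsum (\<lambda>i. (case i of (p, q) \<Rightarrow> x p q) * (case i of (p, q) \<Rightarrow> y (m - p) (n - q)))) (k, S) v"
    unfolding coef_lsum_times[OF assms(3)] ..
  also have "(\<lambda>i. (case i of (p, q) \<Rightarrow> x p q) * (case i of (p, q) \<Rightarrow> y (m - p) (n - q)))
      = (\<lambda>(p, q). x p q * y (m - p) (n - q))"
    by (simp add: split_def)
  finally show "series_mult ?\<kappa> F G (Mon m n k S) v
      = pin (card S) (coef (lsum (\<lambda>(p, q). x p q * y (m - p) (n - q))) (k, S) v)"
    unfolding series_mult_def .
qed

lemma lsummable2_finite_support:
  assumes "finite A" "\<And>i. i \<notin> A \<Longrightarrow> f i = 0 \<or> g i = 0"
  shows "lsummable2 f g"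
proof (rule lsummable2I)
  fix k v
  have "coef (f i) s (coef (g i) t v) = 0" if "i \<notin> A" for i s t
    using assms(2)[OF that] by (elim disjE) simp_all
  then show "\<exists>A. finite A \<and> (\<forall>i s t. fst s \<le> k \<longrightarrow> fst t \<le> k \<longrightarrow>
      coef (f i) s (coef (g i) t v) \<noteq> 0 \<longrightarrow> i \<in> A)"
    using assms(1) by blast
qed

lemma represents_mult_finite:
  fixes x y :: "int \<Rightarrow> int \<Rightarrow> ('k::case_index, 'u::superspace) opseries"
  assumes "represents F x" "represents G y" "finite A" "\<And>p q. (p, q) \<notin> A \<Longrightarrow> x p q = 0"
  shows "represents (series_mult (index_case TYPE('k)) F G)
    (\<lambda>m n. \<Sum>(p, q)\<in>A. x p q * y (m - p) (n - q))"
proof -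
  have "lsummable2 (\<lambda>(p, q). x p q) (\<lambda>(p, q). y (m - p) (n - q))" for m n
    using assms(4) by (intro lsummable2_finite_support[OF assms(3)]) auto
  moreover have "lsum (\<lambda>(p, q). x p q * y (m - p) (n - q)) = (\<Sum>(p, q)\<in>A. x p q * y (m - p) (n - q))"
    for m n
    using assms(4) by (intro lsum_finite_support[OF assms(3)]) auto
  ultimately show ?thesis
    using represents_mult[OF assms(1,2)] by simp
qed

definition at_zero :: "'a::zero \<Rightarrow> int \<Rightarrow> int \<Rightarrow> 'a" where
  "at_zero x m n = (if m = 0 \<and> n = 0 then x else 0)"

lemma represents_mult_at_zero:
  fixes x :: "int \<Rightarrow> int \<Rightarrow> ('k::case_index, 'u::superspace) opseries"
  assumes "represents F x" "represents G (at_zero y)"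
  shows "represents (series_mult (index_case TYPE('k)) F G) (\<lambda>m n. x m n * y)"
proof -
  have "lsummable2 (\<lambda>(p, q). x p q) (\<lambda>(p, q). at_zero y (m - p) (n - q))" for m n
    by (intro lsummable2_finite_support[of "{(m, n)}"]) (auto simp: at_zero_def split: if_splits)
  moreover have "lsum (\<lambda>(p, q). x p q * at_zero y (m - p) (n - q)) = x m n * y" for m n
    by (subst lsum_single[of "(m, n)"]) (auto simp: at_zero_def split: if_splits)
  ultimately show ?thesis
    using represents_mult[OF assms] by simp
qed

lemma represents_monomial:
  assumes "finite S"
  shows "represents (series_monomial (Mon m n k S))
    (\<lambda>m' n'. if m' = m \<and> n' = n then single (k, S) (pin (card S)) else 0)"
  using assms by (auto simp: represents_def series_monomial_def coef_single is_endo_pin endo_zero[OF is_endo_pin])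

lemma represents_gen: "represents (series_monomial (Mon 0 0 0 {g})) (at_zero (gen g))"
proof -
  have gen: "gen g = single (0, {g}) (pin (card {g}))"
    by (simp add: gen_def pin_def)
  show ?thesis
    unfolding at_zero_def[abs_def] gen by (rule represents_monomial) simp
qed

lemma represents_theta: "represents (var_theta i) (at_zero (gen (Theta i)))"
  and represents_zeta: "represents (var_zeta i) (at_zero (gen (Zeta i)))"
  and represents_chi: "represents (var_chi i) (at_zero (gen (Chi i)))"
  by (simp_all only: var_theta_def var_zeta_def var_chi_def represents_gen)

lemma scaleC_1: "scaleC 1 = id"
  by (auto simp: scaleC_one)

lemma represents_unit:
  "represents (series_monomial (Mon m n k {})) (\<lambda>m' n'. if m' = m \<and> n' = n then lam k 1 else 0)"
proof -
  have lam: "lam k 1 = single (k, {}) (pin (card ({} :: generator set)))"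
    by (simp add: lam_def scaleC_1)
  show ?thesis
    unfolding lam by (rule represents_monomial) simp
qed

lemma represents_lambda: "represents var_lambda (at_zero (lam 1 1))"
  unfolding var_lambda_def at_zero_def[abs_def] by (rule represents_unit)

lemma represents_z: "represents var_z (\<lambda>m n. if m = 1 \<and> n = 0 then 1 else 0)"
  and represents_w: "represents var_w (\<lambda>m n. if m = 0 \<and> n = 1 then 1 else 0)"
  and represents_one: "represents (series_monomial (Mon 0 0 0 {})) (at_zero 1)"
  unfolding var_z_def var_w_def at_zero_def[abs_def] lam_one[symmetric] by (rule represents_unit)+

lemma represents_mult_at_zero2:
  fixes x y :: "('k::case_index, 'u::superspace) opseries"
  assumes "represents F (at_zero x)" "represents G (at_zero y)"
  shows "represents (series_mult (index_case TYPE('k)) F G) (at_zero (x * y))"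
proof -
  have "(\<lambda>m n. at_zero x m n * y) = at_zero (x * y)"
    by (auto simp: fun_eq_iff at_zero_def)
  then show ?thesis
    using represents_mult_at_zero[OF assms] by simp
qed

lemma represents_sum_at_zero:
  assumes "finite I" "\<And>i. i \<in> I \<Longrightarrow> represents (F i) (at_zero (x i))"
  shows "represents (sum F I) (at_zero (sum x I))"
proof -
  have "(\<lambda>m n. \<Sum>i\<in>I. at_zero (x i) m n) = at_zero (sum x I)"
    by (auto simp: fun_eq_iff at_zero_def)
  then show ?thesis
    using represents_sum[of I F "\<lambda>i. at_zero (x i)", OF assms] by simp
qed

lemma represents_in_Z: "is_field N f \<Longrightarrow> represents (in_Z f) (\<lambda>m n. if n = 0 then mode Theta f m else 0)"
  by (auto simp: represents_def coef_mode[OF _ inj_Theta] endo_zero[OF is_endo_pin])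

lemma represents_in_W: "is_field N f \<Longrightarrow> represents (in_W f) (\<lambda>m n. if m = 0 then mode Zeta f n else 0)"
  by (auto simp: represents_def coef_mode[OF _ inj_Zeta] endo_zero[OF is_endo_pin])


section \<open>The exponential\<close>

text \<open>The share of the i-th odd variables in (Z-W)\<Lambda>. In case K it absorbs -\<theta>_i
  \<zeta>_i \<lambda>, so that the remainder is (z-w)\<lambda> in both cases.\<close>

definition u_term :: "nat \<Rightarrow> ('k::case_index, 'u::superspace) opseries" where
  "u_term i = (gen (Theta i) - gen (Zeta i)) * gen (Chi i)
     - (if index_case TYPE('k) = CaseK then gen (Theta i) * gen (Zeta i) * lam 1 1 else 0)"

definition u_sum :: "nat \<Rightarrow> ('k::case_index, 'u::superspace) opseries" where
  "u_sum N = (\<Sum>i=1..N. u_term i)"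

text \<open>The exponential of u_1 + ... + u_N, as a product; see
  \<open>exp_factor_eq\<close>.\<close>

fun exp_factor :: "nat \<Rightarrow> ('k::case_index, 'u::superspace) opseries" where
  "exp_factor 0 = 1"
| "exp_factor (Suc N) = (1 + u_term (Suc N)) * exp_factor N"

lemma represents_Z_minus_W_Lambda:
  "represents (Z_minus_W_Lambda (index_case TYPE('k)) N)
    (\<lambda>m n. (if m = 1 \<and> n = 0 then 1 else 0) * lam 1 1 - (if m = 0 \<and> n = 1 then 1 else 0) * lam 1 1
       + at_zero (u_sum N :: ('k::case_index, 'u::superspace) opseries) m n)"
proof -
  let ?\<kappa> = "index_case TYPE('k)"
  let ?l = "\<lambda>m n. (if m = 1 \<and> n = 0 then 1 else 0) * lam 1 1 - (if m = (0::int) \<and> n = (1::int) then 1 else 0)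
    * (lam 1 1 :: ('k, 'u) opseries)"
  have at_diff: "(\<lambda>m n. at_zero (gen (Theta i)) m n - at_zero (gen (Zeta i)) m n)
      = at_zero (gen (Theta i) - gen (Zeta i) :: ('k, 'u) opseries)" for i
    by (auto simp: fun_eq_iff at_zero_def)
  have diff: "represents (var_theta i - var_zeta i) (at_zero (gen (Theta i) - gen (Zeta i) :: ('k, 'u) opseries))" for i
    unfolding at_diff[symmetric] by (rule represents_diff[OF represents_theta represents_zeta])
  have chi: "represents (\<Sum>i=1..N. series_mult ?\<kappa> (var_theta i - var_zeta i) (var_chi i))
      (at_zero (\<Sum>i=1..N. (gen (Theta i) - gen (Zeta i)) * gen (Chi i) :: ('k, 'u) opseries))"
    by (intro represents_sum_at_zero represents_mult_at_zero2 diff represents_chi) simp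
  have tz: "represents (\<Sum>i=1..N. series_mult ?\<kappa> (var_theta i) (var_zeta i))
      (at_zero (\<Sum>i=1..N. gen (Theta i) * gen (Zeta i) :: ('k, 'u) opseries))"
    by (intro represents_sum_at_zero represents_mult_at_zero2 represents_theta represents_zeta) simp
  have zw: "represents (var_z - var_w) (\<lambda>m n. (if m = 1 \<and> n = 0 then 1 else 0) -
      (if m = 0 \<and> n = 1 then 1 else 0) :: ('k, 'u) opseries)"
    by (rule represents_diff[OF represents_z represents_w])
  let ?chi = "\<Sum>i=1..N. (gen (Theta i) - gen (Zeta i)) * gen (Chi i) :: ('k, 'u) opseries"
  let ?tz = "\<Sum>i=1..N. gen (Theta i) * gen (Zeta i) :: ('k, 'u) opseries"
  let ?zw = "\<lambda>m n. (if m = 1 \<and> n = 0 then 1 else 0) - (if m = (0::int) \<and> n = (1::int) then 1 else 0)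
    :: ('k, 'u) opseries"
  show ?thesis
  proof (cases ?\<kappa>)
    case CaseW
    have "(u_sum N :: ('k, 'u) opseries) = ?chi"
      by (simp add: u_sum_def u_term_def CaseW)
    then have eq: "(\<lambda>m n. ?zw m n * lam 1 1 + at_zero ?chi m n) = (\<lambda>m n. ?l m n + at_zero (u_sum N) m n)"
      by (simp only: left_diff_distrib)
    show ?thesis
      using represents_add[OF represents_mult_at_zero[OF zw represents_lambda] chi]
      unfolding eq unfolding CaseW Z_minus_W_Lambda.simps .
  next
    case CaseK
    have "(u_sum N :: ('k, 'u) opseries) = ?chi - ?tz * lam 1 1"
      by (simp add: u_sum_def u_term_def CaseK sum_subtractf sum_distrib_right)
    then have eq: "(\<lambda>m n. (?zw m n - at_zero ?tz m n) * lam 1 1 + at_zero ?chi m n)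
        = (\<lambda>m n. ?l m n + at_zero (u_sum N) m n)"
      by (auto simp only: fun_eq_iff at_zero_def left_diff_distrib split: if_split) simp_all
    show ?thesis
      using represents_add[OF represents_mult_at_zero[OF represents_diff[OF zw tz] represents_lambda] chi]
      unfolding eq unfolding CaseK Z_minus_W_Lambda.simps .
  qed
qed

lemma gen_nilpotent [simp]: "gen (Theta i) * gen (Theta i) = 0" "gen (Zeta i) * gen (Zeta i) = 0"
  by (simp_all add: gen_square_eq)

section \<open>The algebra of the terms u_i\<close>

lemma even_pair_commute:
  assumes "g \<noteq> a" "g \<noteq> b"
  shows "gen g * (gen a * gen b) = gen a * gen b * gen g"
proof -
  have "gen g * (gen a * gen b) = - (gen a * (gen g * gen b))"
    by (simp only: mult.assoc[symmetric] gen_anticommute[OF assms(1)]) simp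
  also have "\<dots> = gen a * gen b * gen g"
    by (simp only: gen_anticommute[OF assms(2)] mult.assoc) simp
  finally show ?thesis .
qed

lemma u_term_eq:
  "(u_term i :: ('k::case_index, 'u::superspace) opseries) = (gen (Theta i) - gen (Zeta i)) * gen (Chi i)
     - lam 1 (if index_case TYPE('k) = CaseK then 1 else 0) * (gen (Theta i) * gen (Zeta i))"
  by (simp add: u_term_def lam_commute)

lemma gen_u_term_commute:
  assumes "g \<notin> {Theta i, Zeta i, Chi i}"
  shows "gen g * u_term i = u_term i * gen g"
  using assms
  by (simp add: u_term_eq left_diff_distrib right_diff_distrib even_pair_commute lam_left_commute)
    (simp add: mult.assoc)

text \<open>For different indices these are even elements in disjoint sets of generators, and
  \<lambda> is central.\<close>

lemma u_term_commute:
  assumes "i \<noteq> j"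
  shows "(u_term i * u_term j :: ('k::case_index, 'u::superspace) opseries) = u_term j * u_term i"
proof -
  define w where "w = (u_term j :: ('k, 'u) opseries)"
  have w: "w * gen g = gen g * w" if "g \<in> {Theta i, Zeta i, Chi i}" for g
    unfolding w_def using assms that by (intro gen_u_term_commute[symmetric]) auto
  have w': "w * (gen g * x) = gen g * (w * x)" if "g \<in> {Theta i, Zeta i, Chi i}" for g x
    using w[OF that] by (simp add: mult.assoc[symmetric])
  have "u_term i * w = w * u_term i"
    by (simp add: u_term_eq left_diff_distrib right_diff_distrib mult.assoc lam_left_commute w w')
  then show ?thesis
    by (simp add: w_def)
qed

lemma gen_left_anticommute:
  assumes "g \<noteq> h"
  shows "gen g * (gen h * x) = - (gen h * (gen g * x))"
  by (simp only: mult.assoc[symmetric] gen_anticommute[OF assms] mult_minus_left)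

lemma gen_left_nilpotent: "gen (Theta i) * (gen (Theta i) * x) = 0" "gen (Zeta i) * (gen (Zeta i) * x) = 0"
  by (simp_all only: mult.assoc[symmetric] gen_nilpotent mult_zero_left)

lemmas theta_zeta_chi_simps = gen_left_nilpotent
  gen_anticommute[of "Zeta i" "Theta i", OF generator.distinct(4)]
  gen_anticommute[of "Chi i" "Theta i", OF generator.distinct(2)]
  gen_anticommute[of "Chi i" "Zeta i", OF generator.distinct(5)]
  gen_left_anticommute[of "Zeta i" "Theta i", OF generator.distinct(4)]
  gen_left_anticommute[of "Chi i" "Theta i", OF generator.distinct(2)]
  gen_left_anticommute[of "Chi i" "Zeta i", OF generator.distinct(5)] for i

text \<open>\<theta> - \<zeta> squares to zero and \<theta>\<zeta> annihilates it. This will make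
  \<theta> - \<zeta> act as a delta function next to the exponential.\<close>

lemma u_term_theta_zeta: "u_term i * (gen (Theta i) - gen (Zeta i)) = 0"
  by (simp add: u_term_eq left_diff_distrib right_diff_distrib mult.assoc theta_zeta_chi_simps)

text \<open>The square of \<chi> appears only next to (\<theta> - \<zeta>)^2 = 0, so the argument is
  the same in case K.\<close>

lemma u_term_square: "u_term i * u_term i = 0"
  by (simp add: u_term_eq left_diff_distrib right_diff_distrib mult.assoc theta_zeta_chi_simps
      lam_left_commute)

lemma u_sum_Suc: "u_sum (Suc N) = u_sum N + u_term (Suc N)"
  by (simp add: u_sum_def)

lemma u_sum_commute: "i > N \<Longrightarrow> u_term i * u_sum N = u_sum N * u_term i"
  by (auto simp: u_sum_def sum_distrib_left sum_distrib_right intro!: sum.cong u_term_commute)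

lemma power_add_nilpotent:
  fixes a b :: "('k::case_index, 'u::superspace) opseries"
  assumes "b * a = a * b" "b * b = 0"
  shows "(a + b) ^ Suc q = a ^ Suc q + lam 0 (of_nat (Suc q)) * (b * a ^ q)"
proof (induction q)
  case 0
  then show ?case
    by simp
next
  case (Suc q)
  have ab: "a * (b * x) = b * (a * x)" and bb: "b * (b * x) = 0" for x
    by (simp_all add: assms flip: mult.assoc)
  have "(a + b) ^ Suc (Suc q) = (a + b) * (a ^ Suc q + lam 0 (of_nat (Suc q)) * (b * a ^ q))"
    by (simp only: power_Suc[of _ "Suc q"] Suc.IH)
  also have "\<dots> = a ^ Suc (Suc q) + (lam 0 1 + lam 0 (of_nat (Suc q))) * (b * a ^ Suc q)"
    by (simp add: distrib_left distrib_right lam_left_commute[of a] lam_left_commute[of b] ab bb)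
  also have "lam 0 1 + lam 0 (of_nat (Suc q)) = (lam 0 (of_nat (Suc (Suc q))) :: ('k, 'u) opseries)"
    by (simp only: lam_add[symmetric]) (simp add: algebra_simps)
  finally show ?case .
qed

lemma Suc_over_fact: "of_nat (Suc q) / fact (Suc q) = (1 / fact q :: complex)"
  by (simp add: fact_Suc del: of_nat_Suc)

text \<open>Since the u_i commute and square to zero, u^q / q! is their q-th elementary symmetric
  polynomial. Hence the Pascal-type recursion \<open>divided_power_Suc\<close>, the vanishing for q
  > N, and the product formula for the exponential.\<close>

definition divided_power :: "nat \<Rightarrow> nat \<Rightarrow> ('k::case_index, 'u::superspace) opseries" where
  "divided_power N q = lam 0 (1 / fact q) * u_sum N ^ q"

lemma divided_power_0: "divided_power N 0 = 1"
  by (simp add: divided_power_def)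

lemma u_sum_divided_power: "u_sum N * divided_power N q = lam 0 (of_nat (Suc q)) * divided_power N (Suc q)"
  unfolding divided_power_def by (simp add: lam_left_commute[of "u_sum N"] lam_mult' Suc_over_fact
    del: of_nat_Suc fact_Suc)

lemma divided_power_Suc:
  "divided_power (Suc N) (Suc q) = divided_power N (Suc q) + u_term (Suc N) * divided_power N q"
  unfolding divided_power_def u_sum_Suc
  by (subst power_add_nilpotent)
    (simp_all add: u_sum_commute u_term_square distrib_left lam_left_commute[of "u_term _"] lam_mult' Suc_over_fact
      del: power_Suc of_nat_Suc fact_Suc)

lemma divided_power_eq_0: "q > N \<Longrightarrow> divided_power N q = 0"
proof (induction N arbitrary: q)
  case 0
  then show ?case
    by (cases q) (simp_all add: divided_power_def u_sum_def)
next
  case (Suc N)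
  then show ?case
    by (cases q) (simp_all add: divided_power_Suc)
qed

lemma exp_factor_eq: "exp_factor N = (\<Sum>q\<le>N. divided_power N q)"
proof (induction N)
  case (Suc N)
  have "(\<Sum>q\<le>Suc N. divided_power (Suc N) q)
      = (1 :: ('a, 'b) opseries) + (\<Sum>q\<le>N. divided_power N (Suc q)) + u_term (Suc N) * exp_factor N"
    by (simp only: sum.atMost_Suc_shift divided_power_Suc divided_power_0 sum.distrib Suc.IH
        sum_distrib_left add.assoc)
  also have "1 + (\<Sum>q\<le>N. divided_power N (Suc q)) = (\<Sum>q\<le>Suc N. divided_power N q :: ('a, 'b) opseries)"
    by (simp only: sum.atMost_Suc_shift divided_power_0)
  also have "\<dots> = exp_factor N"
    by (simp add: Suc.IH divided_power_eq_0)
  finally show ?case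
    by (simp add: distrib_right)
qed (simp add: divided_power_0)

text \<open>The coefficient of \<open>z^r w^s \<lambda>^(r+s)\<close> in e^{(z-w)\<lambda>}.\<close>

definition exp_coeff :: "nat \<Rightarrow> nat \<Rightarrow> complex" where
  "exp_coeff r s = sgn1 s / (fact r * fact s)"

lemma exp_coeff_Suc:
  "of_nat r * exp_coeff r s = (if r = 0 then 0 else exp_coeff (r - 1) s)"
  "of_nat s * exp_coeff r s = (if s = 0 then 0 else - exp_coeff r (s - 1))"
proof -
  show "of_nat r * exp_coeff r s = (if r = 0 then 0 else exp_coeff (r - 1) s)"
    by (cases r) (simp_all add: exp_coeff_def fact_Suc del: of_nat_Suc)
  show "of_nat s * exp_coeff r s = (if s = 0 then 0 else - exp_coeff r (s - 1))"
    by (cases s) (simp_all add: exp_coeff_def fact_Suc del: of_nat_Suc)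
qed

text \<open>The multinomial expansion of (z\<lambda> - w\<lambda> + u)^q: the coefficient of z^m w^n
  is q!/(m! n! j!) (-1)^n \<lambda>^(m+n) u^j with j = q - m - n, the 1/j! being part of the divided
  power.\<close>

definition power_component :: "nat \<Rightarrow> nat \<Rightarrow> int \<Rightarrow> int \<Rightarrow> ('k::case_index, 'u::superspace) opseries" where
  "power_component N q m n = (if m \<ge> 0 \<and> n \<ge> 0 \<and> nat m + nat n \<le> q
     then lam (nat m + nat n) (fact q * exp_coeff (nat m) (nat n)) * divided_power N (q - nat m - nat n)
     else 0)"

text \<open>The three summands are r, s and j times one common term, and r + s + j = q + 1 turns q!
  into (q+1)!.\<close>

lemma power_component_Suc:
  "power_component N (Suc q) m n = lam 1 1 * power_component N q (m - 1) n
     - lam 1 1 * power_component N q m (n - 1) + u_sum N * power_component N q m n"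
proof (cases "m \<ge> 0 \<and> n \<ge> 0 \<and> nat m + nat n \<le> Suc q")
  case False
  then show ?thesis
    by (auto simp: power_component_def)
next
  case True
  define r s j where "r = nat m" and "s = nat n" and "j = Suc q - r - s"
  have mn: "m = int r" "n = int s" "r + s + j = Suc q"
    using True by (auto simp: r_def s_def j_def)
  let ?K = "fact q * exp_coeff r s"
  have 1: "lam 1 1 * power_component N q (m - 1) n = lam (r + s) (of_nat r * ?K) * divided_power N j"
  proof (cases r)
    case (Suc r')
    have "m - 1 = int r'"
      using mn Suc by simp
    moreover have "exp_coeff r' s = of_nat r * exp_coeff r s"
      using exp_coeff_Suc(1)[of r s] Suc by (simp del: of_nat_Suc)
    moreover have "q - r' - s = j" "r' + s \<le> q"
      using mn Suc by auto
    ultimately show ?thesis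
      using mn Suc by (simp add: power_component_def lam_mult' mult_ac)
  qed (simp add: power_component_def mn)
  have 2: "lam 1 1 * power_component N q m (n - 1) = lam (r + s) (- of_nat s * ?K) * divided_power N j"
  proof (cases s)
    case (Suc s')
    have "n - 1 = int s'"
      using mn Suc by simp
    moreover have "exp_coeff r s' = - of_nat s * exp_coeff r s"
      using exp_coeff_Suc(2)[of s r] Suc by (simp del: of_nat_Suc)
    moreover have "q - r - s' = j" "r + s' \<le> q"
      using mn Suc by auto
    ultimately show ?thesis
      using mn Suc by (simp add: power_component_def lam_mult' mult_ac)
  qed (simp add: power_component_def mn)
  have 3: "u_sum N * power_component N q m n = lam (r + s) (of_nat j * ?K) * divided_power N j"
  proof (cases j)
    case (Suc j')
    have "q - r - s = j'" "r + s \<le> q"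
      using mn Suc by auto
    then show ?thesis
      using mn Suc by (simp add: power_component_def lam_left_commute[of "u_sum N"] u_sum_divided_power lam_mult' mult_ac)
  next
    case 0
    then have "\<not> r + s \<le> q"
      using mn by simp
    then show ?thesis
      using mn 0 by (simp add: power_component_def)
  qed
  have "power_component N (Suc q) m n = lam (r + s) (of_nat (Suc q) * ?K) * divided_power N j"
    using mn by (simp add: power_component_def j_def mult_ac)
  also have "of_nat (Suc q) * ?K = of_nat r * ?K - (- of_nat s * ?K) + of_nat j * ?K"
    unfolding mn(3)[symmetric] of_nat_add by (simp only: distrib_right) simp
  finally show ?thesis
    unfolding 1 2 3 by (simp only: lam_add lam_minus diff_conv_add_uminus distrib_right) (simp add: lam_minus)
qed

lemma represents_power:
  "represents (series_power (index_case TYPE('k)) (Z_minus_W_Lambda (index_case TYPE('k)) N) q)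
    (power_component N q :: int \<Rightarrow> int \<Rightarrow> ('k::case_index, 'u::superspace) opseries)"
proof (induction q)
  case 0
  have "(power_component N 0 :: int \<Rightarrow> int \<Rightarrow> ('k::case_index, 'u::superspace) opseries) = at_zero 1"
    by (auto simp: fun_eq_iff power_component_def at_zero_def divided_power_0 exp_coeff_def)
  then show ?case
    by (simp add: represents_one)
next
  case (Suc q)
  have "represents (series_power (index_case TYPE('k)) (Z_minus_W_Lambda (index_case TYPE('k)) N) (Suc q))
    (\<lambda>m n. \<Sum>(a, b)\<in>{(1, 0), (0, 1), (0, 0)}. ((if a = 1 \<and> b = 0 then 1 else 0) * lam 1 1
       - (if a = 0 \<and> b = 1 then 1 else 0) * lam 1 1 + at_zero (u_sum N) a b)
       * power_component N q (m - a) (n - b) :: ('k, 'u) opseries)"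
    unfolding series_power.simps
    by (rule represents_mult_finite[OF represents_Z_minus_W_Lambda Suc]) (auto simp: at_zero_def)
  moreover have "(\<lambda>m n. \<Sum>(a, b)\<in>{(1, 0), (0, 1), (0, 0)}. ((if a = 1 \<and> b = 0 then 1 else 0) * lam 1 1
       - (if a = 0 \<and> b = 1 then 1 else 0) * lam 1 1 + at_zero (u_sum N) a b)
       * power_component N q (m - a) (n - b) :: ('k, 'u) opseries) = power_component N (Suc q)"
    by (simp add: fun_eq_iff power_component_Suc at_zero_def algebra_simps)
  ultimately show ?case
    by simp
qed

definition weight :: "nat \<Rightarrow> nat \<Rightarrow> ('k::case_index, 'u::superspace) opseries" where
  "weight r s = lam (r + s) (exp_coeff r s)"

definition exp_component :: "nat \<Rightarrow> int \<Rightarrow> int \<Rightarrow> ('k::case_index, 'u::superspace) opseries" where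
  "exp_component N m n = (if m \<ge> 0 \<and> n \<ge> 0 then weight (nat m) (nat n) * exp_factor N else 0)"

lemma sum_fun_apply: "sum f A v = (\<Sum>i\<in>A. f i v)"
  by (induction A rule: infinite_finite_induct) auto

lemma represents_exp:
  "represents (series_exp (index_case TYPE('k)) (Z_minus_W_Lambda (index_case TYPE('k)) N))
    (exp_component N :: int \<Rightarrow> int \<Rightarrow> ('k::case_index, 'u::superspace) opseries)"
  unfolding represents_def
proof (intro allI)
  fix m n :: int and k S and v :: 'u
  let ?\<kappa> = "index_case TYPE('k)"
  let ?P = "\<lambda>q. power_component N q m n :: ('k, 'u) opseries"
  \<comment> \<open>At fixed exponents m, n the q-th power leaves u^(q-m-n), which vanishes for q >
    m + n + N; so the exponential series is finite here.\<close>
  let ?B = "{..nat m + nat n + N}"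
  let ?f = "\<lambda>q. scale_op (1 / fact q) (series_power ?\<kappa> (Z_minus_W_Lambda ?\<kappa> N) q (Mon m n k S)) :: 'u operator"
  have f: "?f q w = pin (card S) (coef (lam 0 (1 / fact q) * ?P q) (k, S) w)" for q w
    by (simp add: scale_op_def representsD[OF represents_power] coef_lam_times endo_scale[OF is_endo_pin])
  have zero: "?P q = 0" if "q \<notin> ?B" for q
    using that by (auto simp: power_component_def divided_power_eq_0)
  have "?f q = 0" if "q \<notin> ?B" for q
    using zero[OF that] f[of q] by (auto simp: fun_eq_iff endo_zero[OF is_endo_pin])
  then have "Sum_any ?f = sum ?f ?B"
    by (intro Sum_any.expand_superset) auto
  then have "series_exp ?\<kappa> (Z_minus_W_Lambda ?\<kappa> N) (Mon m n k S) v
      = pin (card S) (coef (\<Sum>q\<in>?B. lam 0 (1 / fact q) * ?P q) (k, S) v)"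
    unfolding series_exp_def by (simp only: sum_fun_apply f endo_sum[OF is_endo_pin] coef_sum)
  also have "(\<Sum>q\<in>?B. lam 0 (1 / fact q) * ?P q) = exp_component N m n"
  proof (cases "m \<ge> 0 \<and> n \<ge> 0")
    case True
    let ?d = "nat m + nat n"
    have "(\<Sum>q\<in>?B. lam 0 (1 / fact q) * ?P q) = (\<Sum>q\<in>{?d..?d + N}. lam 0 (1 / fact q) * ?P q)"
      by (rule sum.mono_neutral_right) (auto simp: power_component_def)
    also have "\<dots> = (\<Sum>j\<le>N. lam 0 (1 / fact (j + ?d)) * ?P (j + ?d))"
      using sum.shift_bounds_cl_nat_ivl[of "\<lambda>q. lam 0 (1 / fact q) * ?P q" 0 ?d N]
      by (simp add: add.commute atMost_atLeast0)
    also have "\<dots> = (\<Sum>j\<le>N. weight (nat m) (nat n) * divided_power N j)"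
      using True by (intro sum.cong refl) (simp add: power_component_def lam_mult' weight_def)
    also have "\<dots> = weight (nat m) (nat n) * exp_factor N"
      by (simp add: exp_factor_eq sum_distrib_left)
    finally show ?thesis
      using True by (simp add: exp_component_def)
  qed (auto simp: power_component_def exp_component_def)
  finally show "series_exp ?\<kappa> (Z_minus_W_Lambda ?\<kappa> N) (Mon m n k S) v
      = pin (card S) (coef (exp_component N m n :: ('k, 'u) opseries) (k, S) v)" .
qed

section \<open>The odd delta function\<close>

definition free :: "generator \<Rightarrow> ('k::case_index, 'u::superspace) opseries \<Rightarrow> bool" where
  "free g x \<longleftrightarrow> (\<forall>t v. coef x t v \<noteq> 0 \<longrightarrow> g \<notin> snd t)"

lemma free_mult:
  assumes "free g x" "free g y"
  shows "free g (x * y)"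
  unfolding free_def
proof (intro allI impI)
  fix u v assume "coef (x * y) u v \<noteq> 0"
  then obtain s t where st: "om_times s t = u" "coef x s (coef y t v) \<noteq> 0"
    by (rule coef_times_nonzero)
  then have "coef y t v \<noteq> 0"
    by auto
  with st(2) have "g \<notin> snd s" "g \<notin> snd t"
    using assms unfolding free_def by blast+
  then show "g \<notin> snd u"
    using st(1) by (auto simp: om_times_def symdiff_def)
qed

lemma free_zero: "free g 0"
  by (simp add: free_def)

lemma free_add: "free g x \<Longrightarrow> free g y \<Longrightarrow> free g (x + y)"
  unfolding free_def by (metis add.right_neutral coef_plus)

lemma free_uminus: "free g x \<Longrightarrow> free g (- x)"
  by (simp add: free_def)

lemma free_diff: "free g x \<Longrightarrow> free g y \<Longrightarrow> free g (x - y)"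
  using free_add[of g x "- y"] by (simp add: free_uminus)

lemma free_single: "is_endo A \<Longrightarrow> g \<notin> snd t \<Longrightarrow> finite (snd t) \<Longrightarrow> free g (single t A)"
  by (cases t) (auto simp: free_def coef_single split: if_splits)

lemma free_gen: "g \<noteq> h \<Longrightarrow> free g (gen h)"
  unfolding gen_def by (rule free_single) (simp_all add: is_endo_pinv)

lemma free_lam: "free g (lam k c)"
  unfolding lam_def by (rule free_single) (simp_all add: is_endo_scale)

lemma free_one: "free g 1"
  using free_lam[of g 0 1] by simp

lemma free_u_term: "g \<notin> {Theta i, Zeta i, Chi i} \<Longrightarrow> free g (u_term i)"
  unfolding u_term_eq by (intro free_diff free_mult free_gen free_lam) auto

lemma free_exp_factor:
  "(\<And>i. i \<in> {1..N} \<Longrightarrow> g \<notin> {Theta i, Zeta i, Chi i}) \<Longrightarrow> free g (exp_factor N)"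
  by (induction N) (auto intro!: free_mult free_add free_one free_u_term)

lemma part_free:
  assumes "free g x" "g \<in> T"
  shows "part T x = 0"
  using assms by (intro opseries_eqI) (fastforce simp: coef_part free_def)

lemma u_term_exp_factor_commute:
  "i > N \<Longrightarrow> u_term i * exp_factor N = (exp_factor N * u_term i :: ('k::case_index, 'u::superspace) opseries)"
proof (induction N)
  case (Suc N)
  have "(u_term i * exp_factor (Suc N) :: ('k, 'u) opseries)
      = (1 + u_term (Suc N)) * (u_term i * exp_factor N)"
    using Suc.prems u_term_commute[where 'k = 'k and 'u = 'u, of i "Suc N"]
    by (simp add: distrib_left distrib_right flip: mult.assoc)
  then show ?case
    using Suc by (simp add: mult.assoc)
qed simp

text \<open>The factors commute, so the only one that contains \<chi>_i can be moved to the right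
  end.\<close>

lemma exp_factor_split:
  assumes "i \<in> {1..N}"
  shows "\<exists>E. exp_factor N = E * (1 + u_term i) \<and> free (Chi i) (E :: ('k::case_index, 'u::superspace) opseries)"
  using assms
proof (induction N)
  case (Suc N)
  show ?case
  proof (cases "i = Suc N")
    case True
    have "exp_factor (Suc N) = exp_factor N * (1 + u_term i)"
      using u_term_exp_factor_commute[of N i] True by (simp add: distrib_left distrib_right)
    moreover have "free (Chi i) (exp_factor N)"
      using True by (intro free_exp_factor) auto
    ultimately show ?thesis by blast
  next
    case False
    with Suc obtain E where E: "exp_factor N = E * (1 + u_term i)" "free (Chi i) (E :: ('k, 'u) opseries)"
      by auto
    have "free (Chi i) ((1 + u_term (Suc N)) * E)"
      using E(2) False by (intro free_mult free_add free_one free_u_term) auto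
    moreover have "exp_factor (Suc N) = (1 + u_term (Suc N)) * E * (1 + u_term i)"
      by (simp add: E(1) mult.assoc)
    ultimately show ?thesis by blast
  qed
qed simp

text \<open>Modulo terms without \<open>\<chi>\<^sup>i\<close>, the exponential contains the factor \<open>\<theta>\<^sup>i - \<zeta>\<^sup>i\<close>, which is a
  delta function.\<close>

lemma part_exp_theta:
  assumes "i \<in> {1..N}" "Chi i \<in> T" "free (Chi i) x"
  shows "part T (exp_factor N * (gen (Theta i) * x)) = part T (exp_factor N * (gen (Zeta i) * x))"
proof -
  let ?d = "gen (Theta i) - gen (Zeta i) :: ('a, 'b) opseries"
  obtain E where E: "exp_factor N = E * (1 + u_term i)" "free (Chi i) (E :: ('a, 'b) opseries)"
    using exp_factor_split[OF assms(1)] by blast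
  have "exp_factor N * ?d = E * ((1 + u_term i) * ?d)"
    by (simp only: E(1) mult.assoc)
  also have "\<dots> = E * ?d"
    by (simp only: distrib_right[of 1] u_term_theta_zeta) simp
  finally have "exp_factor N * (?d * x) = E * ?d * x"
    by (simp only: mult.assoc[symmetric])
  moreover have "free (Chi i) (E * ?d * x)"
    using assms(3) E(2) by (intro free_mult free_diff free_gen) auto
  ultimately have "part T (exp_factor N * (?d * x)) = 0"
    using part_free[OF _ assms(2)] by metis
  then show ?thesis
    by (simp add: left_diff_distrib right_diff_distrib part_diff)
qed

text \<open>The ordered product of the odd variables with indices in \<open>I\<close>;
  \<open>pin\<close> is the coordinate of the coefficient 1.\<close>

definition om :: "(nat \<Rightarrow> generator) \<Rightarrow> nat set \<Rightarrow> ('k::case_index, 'u::superspace) opseries" where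
  "om V I = single (0, V ` I) (pin (card I))"

lemma swap_sign_insert_less:
  assumes "V = Theta \<or> V = Zeta" "\<And>j. j \<in> I \<Longrightarrow> i < j"
  shows "swap_sign {V i} (V ` I) = 1"
proof -
  have "{(g, h) \<in> {V i} \<times> V ` I. precedes h g} = {}"
    using assms by fastforce
  then show ?thesis
    unfolding swap_sign_def by (simp only: card.empty power_0)
qed

lemma om_insert:
  assumes "V = Theta \<or> V = Zeta" "finite I" "\<And>j. j \<in> I \<Longrightarrow> i < j"
  shows "om V (insert i I) = gen (V i) * (om V I :: ('k::case_index, 'u::superspace) opseries)"
proof -
  have inj: "inj V"
    using assms(1) inj_Theta inj_Zeta by auto
  have i: "i \<notin> I"
    using assms(3) by auto
  then have disj: "V i \<notin> V ` I"
    using inj by (auto dest: injD)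
  have "om_times (0, {V i}) (0, V ` I) = (0, V ` insert i I)"
    using disj by (auto simp: om_times_def symdiff_def)
  moreover have "cocycle (index_case TYPE('k)) {V i} (V ` I) = 1"
    using disj swap_sign_insert_less[OF assms(1,3)] by (simp add: cocycle_def square_factor_def)
  moreover have "scaleC 1 \<circ> \<Pi> \<circ> pin (card I) = (pin (card (insert i I)) :: 'u operator)"
    using i assms(2) by (auto simp: fun_eq_iff scaleC_one pin_def)
  ultimately show ?thesis
    using assms(2) unfolding om_def gen_def
    by (subst single_times_single) (simp_all add: is_endo_pinv is_endo_pin)
qed

lemma has_parity_om:
  assumes "inj V"
  shows "finite I \<Longrightarrow> has_parity (card I) (om V I)"
  using assms card_image[of V I]
  by (auto simp: has_parity_def om_def coef_single is_endo_pin pinv_pin endo_zero[OF is_endo_pinv]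
      inj_on_subset scaleC_one)

lemma free_om: "g \<notin> V ` I \<Longrightarrow> finite I \<Longrightarrow> free g (om V I)"
  unfolding om_def by (rule free_single) (simp_all add: is_endo_pin)

text \<open>The \<theta>'s are replaced one by one, smallest index first. Only the variable next to
  the exponential can be replaced; the new \<zeta> is then moved behind the remaining \<theta>'s, so
  that the induction hypothesis applies to them.\<close>

lemma part_exp_om:
  assumes "I \<subseteq> {1..N}" "Chi ` {1..N} \<subseteq> T" "\<And>i. free (Chi i) x"
  shows "part T (exp_factor N * (om Theta I * x)) = part T (exp_factor N * (om Zeta I * x))"
proof -
  have "finite I"
    using assms(1) finite_subset by blast
  then show ?thesis
    using assms(1,3)
  proof (induction I arbitrary: x rule: finite_linorder_min_induct)
    case empty
    then show ?case
      by (simp add: om_def)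
  next
    case (insert i I)
    have I: "finite I" "\<And>j. j \<in> I \<Longrightarrow> i < j"
      using insert by auto
    have free: "free (Chi j) (om Theta I * x)" for j
      using insert.prems(2) I by (intro free_mult free_om) auto
    \<comment> \<open>Used twice, to move \<zeta>_i behind the remaining \<theta>'s and back in
      front of the \<zeta>'s that replaced them. The sign is the same both times and
      cancels.\<close>
    have comm: "gen (Zeta i) * om V I = lam 0 (sgn1 (card I)) * (om V I * gen (Zeta i))"
      if "inj V" for V
      by (rule gen_supercommute[OF has_parity_om[OF that I(1)]]) simp
    have "part T (exp_factor N * (om Theta (insert i I) * x))
        = part T (exp_factor N * (gen (Theta i) * (om Theta I * x)))"
      by (simp add: om_insert I mult.assoc)
    also have "\<dots> = part T (exp_factor N * (gen (Zeta i) * (om Theta I * x)))"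
      using insert.prems(1) assms(2) free by (intro part_exp_theta) auto
    also have "\<dots> = part T (exp_factor N * (gen (Zeta i) * om Theta I * x))"
      by (simp only: mult.assoc)
    also have "\<dots> = lam 0 (sgn1 (card I)) * part T (exp_factor N * (om Theta I * (gen (Zeta i) * x)))"
      by (simp only: comm[OF inj_Theta] mult.assoc lam_left_commute[of "exp_factor N"] part_lam_times)
    also have "\<dots> = lam 0 (sgn1 (card I)) * part T (exp_factor N * (om Zeta I * (gen (Zeta i) * x)))"
    proof -
      have "free (Chi j) (gen (Zeta i) * x)" for j
        using insert.prems(2) by (intro free_mult free_gen) auto
      moreover have "I \<subseteq> {1..N}"
        using insert.prems(1) by auto
      ultimately show ?thesis
        by (simp only: insert.IH)
    qed
    also have "\<dots> = part T (exp_factor N * (gen (Zeta i) * om Zeta I * x))"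
      by (simp only: comm[OF inj_Zeta] mult.assoc lam_left_commute[of "exp_factor N"] part_lam_times)
    also have "\<dots> = part T (exp_factor N * (om Zeta (insert i I) * x))"
      by (simp add: om_insert I mult.assoc)
    finally show ?case .
  qed
qed

text \<open>Separates odd variables from operators; the latter contain no \<chi> and can serve as
  \<open>x\<close> in \<open>part_exp_om\<close>.\<close>

lemma mode_eq_sum:
  assumes "is_field N f" "V = Theta \<or> V = Zeta"
  shows "(mode V f m :: ('k::case_index, 'u::superspace) opseries)
    = (\<Sum>I\<in>Pow {1..N}. om V I * single (0, {}) (f m I))"
proof (rule opseries_eqI)
  fix k S and v :: 'u
  have inj: "inj V"
    using assms(2) inj_Theta inj_Zeta by auto
  note endo = is_fieldD(1)[OF assms(1)]
  have om_term: "coef (om V I * single (0, {}) (f m I) :: ('k, 'u) opseries) (k, S) v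
      = (if (k, S) = (0, V ` I) then pin (card I) (f m I v) else 0)" if "I \<in> Pow {1..N}" for I
  proof -
    have fin: "finite (V ` I)"
      using that finite_subset by auto
    have "(om V I * single (0, {}) (f m I) :: ('k, 'u) opseries) = single (0, V ` I) (scaleC 1 \<circ> pin (card I) \<circ> f m I)"
      using fin unfolding om_def by (subst single_times_single) (simp_all add: is_endo_pin endo)
    then show ?thesis
      using fin by (simp add: coef_single is_endo_comp is_endo_scale is_endo_pin endo scaleC_one)
  qed
  let ?I = "{i. V i \<in> S}"
  have "coef (\<Sum>I\<in>Pow {1..N}. om V I * single (0, {}) (f m I) :: ('k, 'u) opseries) (k, S) v
      = (\<Sum>I\<in>Pow {1..N}. if (k, S) = (0, V ` I) then pin (card I) (f m I v) else 0)"
    by (simp only: coef_sum om_term cong: sum.cong)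
  also have "\<dots> = (\<Sum>I\<in>Pow {1..N}. if I = ?I then
      (if k = 0 \<and> S \<subseteq> range V then pin (card S) (f m ?I v) else 0) else 0)"
  proof (rule sum.cong[OF refl])
    fix I assume "I \<in> Pow {1..N}"
    have 1: "I = ?I" "card I = card S" "S \<subseteq> range V" if S: "S = V ` I"
      using inj card_image[OF inj_on_subset[OF inj], of I] unfolding S
      by (simp_all add: inj_image_mem_iff image_mono)
    have 2: "S = V ` I" if "I = ?I" "S \<subseteq> range V"
      unfolding that(1) using that(2) by blast
    show "(if (k, S) = (0, V ` I) then pin (card I) (f m I v) else 0) = (if I = ?I then
      (if k = 0 \<and> S \<subseteq> range V then pin (card S) (f m ?I v) else 0) else 0)"
    proof (cases "S = V ` I")
      case True
      show ?thesis
        using 1[OF True] True by (cases "k = 0") simp_all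
    next
      case False
      then have "\<not> (I = ?I \<and> S \<subseteq> range V)"
        using 2 by blast
      then show ?thesis
        using False by (cases "I = ?I") simp_all
    qed
  qed
  also have "\<dots> = (if k = 0 \<and> S \<subseteq> range V then pin (card S) (f m ?I v) else 0)"
  proof (cases "?I \<subseteq> {1..N}")
    case False
    then have "f m ?I = 0"
      by (rule is_fieldD(2)[OF assms(1)])
    then show ?thesis
      using False by (simp add: endo_zero[OF is_endo_pin])
  qed (simp add: sum.delta)
  also have "\<dots> = coef (mode V f m :: ('k, 'u) opseries) (k, S) v"
    by (simp add: coef_mode[OF assms(1) inj])
  finally show "coef (mode V f m :: ('k, 'u) opseries) (k, S) v
      = coef (\<Sum>I\<in>Pow {1..N}. om V I * single (0, {}) (f m I) :: ('k, 'u) opseries) (k, S) v" ..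
qed

lemma part_sum: "part T (sum f A) = (\<Sum>i\<in>A. part T (f i))"
  by (induction A rule: infinite_finite_induct) (simp_all add: part_add)

text \<open>The delta function property for a whole field: once all \<chi>'s are extracted,
  a(\<theta>) next to the exponential may be replaced by a(\<zeta>).\<close>

lemma part_exp_mode:
  fixes f :: "'u::superspace field"
  assumes "is_field N f" "Chi ` {1..N} \<subseteq> T"
  shows "part T (exp_factor N * mode Theta f m :: ('k::case_index, 'u) opseries)
    = part T (exp_factor N * mode Zeta f m)"
proof -
  have "free (Chi i) (single (0, {}) (f m I) :: ('k, 'u) opseries)" for i I
    using is_fieldD(1)[OF assms(1)] by (intro free_single) auto
  then have "part T (exp_factor N * (om Theta I * single (0, {}) (f m I)) :: ('k, 'u) opseries)
      = part T (exp_factor N * (om Zeta I * single (0, {}) (f m I)))" if "I \<in> Pow {1..N}" for I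
    using that assms(2) by (intro part_exp_om) auto
  then show ?thesis
    unfolding mode_eq_sum[OF assms(1) disjI1[OF refl]] mode_eq_sum[OF assms(1) disjI2[OF refl]]
      sum_distrib_left part_sum
    by (rule sum.cong[OF refl])
qed

section \<open>The top coefficient of the odd exponential\<close>

definition top_gens :: "nat \<Rightarrow> generator set" where
  "top_gens N = Theta ` {1..N} \<union> Chi ` {1..N}"

lemma front_top: "front (top_gens N)"
  by (auto simp: front_def top_gens_def)

lemma card_top: "card (top_gens N) = 2 * N"
  unfolding top_gens_def by (subst card_Un_disjoint) (auto simp: card_image inj_on_def)

lemma swap_sign_top: "swap_sign (top_gens N) {Theta (Suc N), Chi (Suc N)} = sgn1 N"
proof -
  have "{(g, h) \<in> top_gens N \<times> {Theta (Suc N), Chi (Suc N)}. precedes h g}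
      = (\<lambda>j. (Chi j, Theta (Suc N))) ` {1..N}"
    by (auto simp: top_gens_def)
  moreover have "card ((\<lambda>j. (Chi j, Theta (Suc N))) ` {1..N}) = N"
    by (subst card_image) (auto simp: inj_on_def)
  ultimately show ?thesis
    by (simp add: swap_sign_def)
qed

lemma theta_chi_eq_single:
  "gen (Theta i) * gen (Chi i) = (single (0, {Theta i, Chi i}) id :: ('k::case_index, 'u::superspace) opseries)"
proof -
  have "{(g, h) \<in> {Theta i} \<times> {Chi i}. precedes h g} = {}"
    by auto
  then have "swap_sign {Theta i} {Chi i} = 1"
    unfolding swap_sign_def by (simp only: card.empty power_0)
  then have "cocycle (index_case TYPE('k)) {Theta i} {Chi i} = 1"
    by (simp add: cocycle_def square_factor_def)
  moreover have "om_times (0, {Theta i}) (0, {Chi i}) = (0, {Theta i, Chi i})"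
    by (auto simp: om_times_def symdiff_def)
  moreover have "scaleC 1 \<circ> \<Pi> \<circ> \<Pi> = (id :: 'u operator)"
    by (auto simp: fun_eq_iff scaleC_one)
  ultimately show ?thesis
    unfolding gen_def by (subst single_times_single) (simp_all add: is_endo_pinv)
qed

lemma coef_free: "free g x \<Longrightarrow> g \<in> snd t \<Longrightarrow> coef x t v = 0"
  unfolding free_def by blast

text \<open>Only the product of all \<theta>_i \<chi>_i reaches the top monomial. Appending
  \<theta>_{N+1} \<chi>_{N+1} costs N transpositions, since \<theta>_{N+1} passes the N earlier
  \<chi>'s; in all this makes 0 + 1 + ... + (N-1) = N(N-1)/2.\<close>

lemma coef_exp_factor_top:
  assumes "S \<subseteq> range Zeta"
  shows "coef (exp_factor N :: ('k::case_index, 'u::superspace) opseries) (k, top_gens N \<union> S) v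
    = (if k = 0 \<and> S = {} then sgn1 (N * (N - 1) div 2) *\<^sub>C v else 0)"
  using assms
proof (induction N arbitrary: k v)
  case 0
  then show ?case
    by (simp add: coef_1 top_gens_def scaleC_one)
next
  case (Suc N)
  let ?E = "exp_factor N :: ('k, 'u) opseries"
  let ?i = "Suc N"
  let ?p = "{Theta ?i, Chi ?i}"
  let ?u = "(k, top_gens ?i \<union> S)"
  let ?\<epsilon> = "lam 1 (if index_case TYPE('k) = CaseK then 1 else 0) :: ('k, 'u) opseries"
  have top: "top_gens ?i = top_gens N \<union> ?p"
    by (auto simp: top_gens_def atLeastAtMostSuc_conv)
  have free: "free (V ?i) ?E" if "V = Theta \<or> V = Zeta \<or> V = Chi" for V
    using that by (intro free_exp_factor) auto
  \<comment> \<open>Of the four terms only the one with \<theta>\<chi> contains both new generators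
    of the top monomial.\<close>
  have "exp_factor ?i = ?E + ?E * (gen (Theta ?i) * gen (Chi ?i)) - ?E * (gen (Zeta ?i) * gen (Chi ?i))
      - ?E * (?\<epsilon> * (gen (Theta ?i) * gen (Zeta ?i)))"
    using u_term_exp_factor_commute[where 'k = 'k and 'u = 'u, of N ?i]
    by (simp add: distrib_right distrib_left) (simp add: u_term_eq left_diff_distrib right_diff_distrib)
  moreover have "coef ?E ?u v = 0"
    by (rule coef_free[OF free[of Chi]]) (auto simp: top)
  moreover have "coef (?E * (gen (Zeta ?i) * gen (Chi ?i))) ?u v = 0"
    by (rule coef_free[of "Theta ?i"]) (auto simp: top intro!: free_mult free_gen free)
  moreover have "coef (?E * (?\<epsilon> * (gen (Theta ?i) * gen (Zeta ?i)))) ?u v = 0"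
    by (rule coef_free[of "Chi ?i"]) (auto simp: top intro!: free_mult free_gen free free_lam free_zero)
  moreover have "coef (?E * (gen (Theta ?i) * gen (Chi ?i))) ?u v
      = (if k = 0 \<and> S = {} then sgn1 (?i * (?i - 1) div 2) *\<^sub>C v else 0)"
  proof -
    let ?t = "(k, top_gens N \<union> S)"
    have disj: "(top_gens N \<union> S) \<inter> ?p = {}"
      using Suc.prems by (auto simp: top_gens_def)
    have "coef (?E * (gen (Theta ?i) * gen (Chi ?i))) ?u v
        = Sum_any (\<lambda>t. if om_times t (0, ?p) = ?u
          then cocycle (index_case TYPE('k)) (snd t) ?p *\<^sub>C coef ?E t v else 0)"
      by (simp add: theta_chi_eq_single coef_times_single is_endo_id cong: if_cong)
    also have "\<dots> = (if om_times ?t (0, ?p) = ?u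
          then cocycle (index_case TYPE('k)) (snd ?t) ?p *\<^sub>C coef ?E ?t v else 0)"
    proof (rule Sum_any_single)
      fix t :: odd_monomial assume "t \<noteq> ?t"
      have "t = ?t" if *: "om_times t (0, ?p) = ?u" "coef ?E t v \<noteq> 0"
      proof -
        have "Theta ?i \<notin> snd t" "Chi ?i \<notin> snd t"
          using coef_free[OF free[of Theta]] coef_free[OF free[of Chi]] *(2) by blast+
        then have "snd t \<inter> ?p = {}"
          by auto
        from om_times_disjoint_eq(1,5)[of "(0, ?p)" t k "top_gens ?i \<union> S"] this *(1)
        have "fst t = k" "snd t = top_gens ?i \<union> S - ?p"
          by (auto simp: om_times_def symdiff_def Int_commute)
        moreover have "top_gens ?i \<union> S - ?p = top_gens N \<union> S"
          using disj by (auto simp: top)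
        ultimately show ?thesis
          by (simp add: prod_eq_iff)
      qed
      then show "(if om_times t (0, ?p) = ?u
          then cocycle (index_case TYPE('k)) (snd t) ?p *\<^sub>C coef ?E t v else 0) = 0"
        using \<open>t \<noteq> ?t\<close> by auto
    qed
    also have "om_times ?t (0, ?p) = ?u"
      using disj by (auto simp: om_times_def symdiff_def top)
    also have "cocycle (index_case TYPE('k)) (snd ?t) ?p = swap_sign (top_gens N \<union> S) ?p"
      using disj by (simp add: cocycle_def square_factor_def)
    also have "(if ?u = ?u then swap_sign (top_gens N \<union> S) ?p *\<^sub>C coef ?E ?t v else 0)
        = (if k = 0 \<and> S = {} then sgn1 (?i * (?i - 1) div 2) *\<^sub>C v else 0)"
    proof -
      have "?i * (?i - 1) div 2 = N + N * (N - 1) div 2"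
        by (cases N) (simp_all add: algebra_simps)
      then have "sgn1 (?i * (?i - 1) div 2) = sgn1 N * sgn1 (N * (N - 1) div 2)"
        by (simp only: power_add)
      then show ?thesis
        using Suc.IH[OF Suc.prems] by (simp add: swap_sign_top scaleC_scaleC)
    qed
    finally show ?thesis by simp
  qed
  ultimately show ?case
    by (simp only: coef_plus coef_minus) simp
qed

lemma part_exp_factor_top:
  "part (top_gens N) (exp_factor N) = (lam 0 (sgn1 (N * (N - 1) div 2)) :: ('k::case_index, 'u::superspace) opseries)"
proof (rule opseries_eqI)
  fix k S and v :: 'u
  have "S \<inter> top_gens N = {}" if "S \<subseteq> range Zeta"
    using that by (auto simp: top_gens_def)
  then show "coef (part (top_gens N) (exp_factor N) :: ('k, 'u) opseries) (k, S) v
      = coef (lam 0 (sgn1 (N * (N - 1) div 2)) :: ('k, 'u) opseries) (k, S) v"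
    using coef_exp_factor_top[where 'k = 'k, of S N k v]
    by (auto simp: coef_part coef_lam card_top pin_def)
qed

lemma gen_pair_commute:
  fixes y :: "('k::case_index, 'u::superspace) opseries"
  assumes "has_parity p y" "supported (range Zeta) y"
  shows "gen g * gen h * y = y * (gen g * gen h)"
proof -
  have sq: "gen_square (index_case TYPE('k)) a = 0" if "coef y t v \<noteq> 0" "a \<in> snd t" for a t v
    using supportedD(2)[OF assms(2) that(1)] that(2) by auto
  have "gen g * gen h * y = gen g * (gen h * y)"
    by (rule mult.assoc)
  also have "gen h * y = lam 0 (sgn1 p) * (y * gen h)"
    using sq by (intro gen_supercommute[OF assms(1)]) auto
  also have "gen g * (lam 0 (sgn1 p) * (y * gen h)) = lam 0 (sgn1 p) * (gen g * y * gen h)"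
    by (simp only: lam_left_commute[of "gen g"] mult.assoc)
  also have "gen g * y = lam 0 (sgn1 p) * (y * gen g)"
    using sq by (intro gen_supercommute[OF assms(1)]) auto
  finally show ?thesis
    by (simp add: mult.assoc)
qed

lemma exp_factor_commute:
  fixes y :: "('k::case_index, 'u::superspace) opseries"
  assumes "has_parity p y" "supported (range Zeta) y"
  shows "exp_factor N * y = y * exp_factor N"
proof (induction N)
  case (Suc N)
  have "u_term i * y = y * u_term i" for i
    by (simp add: u_term_eq left_diff_distrib right_diff_distrib gen_pair_commute[OF assms]
        mult.assoc[of "lam _ _"] lam_left_commute[of y])
  then have "(1 + u_term (Suc N)) * (y * exp_factor N) = y * ((1 + u_term (Suc N)) * exp_factor N)"
    by (simp add: distrib_left distrib_right flip: mult.assoc)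
  then show ?case
    by (simp add: Suc mult.assoc)
qed simp

lemma has_parity_u_term: "has_parity 0 (u_term i)"
proof -
  have pair: "has_parity 0 (gen g * gen h)" for g h
    using has_parity_cong[OF has_parity_mult[OF has_parity_gen has_parity_gen], of 0] by simp
  then show ?thesis
    unfolding u_term_eq left_diff_distrib by (intro has_parity_diff has_parity_lam_mult)
qed

lemma has_parity_exp_factor: "has_parity 0 (exp_factor N)"
proof (induction N)
  case 0
  then show ?case
    using has_parity_lam[of 0 1] by simp
next
  case (Suc N)
  have "has_parity 0 (1 + u_term (Suc N))"
    using has_parity_lam[of 0 1] has_parity_u_term by (intro has_parity_add) simp_all
  from has_parity_mult[OF this Suc] show ?case
    by simp
qed

section \<open>The Wick formula for modes\<close>

text \<open>The index \<open>p\<close> stands for the product of the two parities, not for a parity.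
  Products with a common first factor add, which gives the super Leibniz rule
  \<open>supercomm_times\<close> its simple form.\<close>

definition supercomm :: "nat \<Rightarrow> ('k::case_index, 'u::superspace) opseries \<Rightarrow> ('k, 'u) opseries \<Rightarrow> ('k, 'u) opseries" where
  "supercomm p x y = x * y - lam 0 (sgn1 p) * (y * x)"

lemma supercomm_zero [simp]: "supercomm p x 0 = 0" "supercomm p 0 x = 0"
  by (simp_all add: supercomm_def)

lemma supercomm_times:
  "supercomm (p + q) x (y * z) = supercomm p x y * z + lam 0 (sgn1 p) * (y * supercomm q x z)"
  by (simp add: supercomm_def left_diff_distrib right_diff_distrib mult.assoc lam_left_commute[of y]
      lam_mult' power_add)

lemma supercomm_add: "supercomm p x (y + z) = supercomm p x y + supercomm p x z"
  by (simp add: supercomm_def distrib_left distrib_right)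

lemma supercomm_lam: "supercomm p x (lam k c * y) = lam k c * supercomm p x y"
  by (simp add: supercomm_def right_diff_distrib lam_left_commute[of x] lam_mult' mult.assoc add.commute mult.commute)

lemma lsummable_supercomm: "lsummable f \<Longrightarrow> lsummable (\<lambda>i. supercomm p x (f i))"
  unfolding supercomm_def by (intro lsummable_diff lsummable_times_left lsummable_times_right)

lemma supercomm_lsum: "lsummable f \<Longrightarrow> supercomm p x (lsum f) = lsum (\<lambda>i. supercomm p x (f i))"
  by (simp add: supercomm_def times_lsum lsum_times lsum_diff lsummable_times_left lsummable_times_right)

lemma bounded_below_supercomm: "bounded_below y \<Longrightarrow> bounded_below (\<lambda>n. supercomm p x (y n))"
  unfolding supercomm_def by (intro bounded_below_diff bounded_below_left bounded_below_right)

text \<open>The odd half of the bracket: for \<open>T\<close> made of \<theta>_1, ..., \<theta>_N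
  and the \<chi>'s of J this is the odd residue together with the coefficient of \<chi>^J.\<close>

definition res_comm :: "generator set \<Rightarrow> nat \<Rightarrow> nat \<Rightarrow> ('k::case_index, 'u::superspace) opseries
    \<Rightarrow> ('k, 'u) opseries \<Rightarrow> ('k, 'u) opseries" where
  "res_comm T N p x y = part T (exp_factor N * supercomm p x y)"

lemma res_comm_zero [simp]: "res_comm T N p x 0 = 0" "res_comm T N p 0 x = 0"
  by (simp_all add: res_comm_def)

text \<open>The Leibniz rule persists because the odd exponential is even and commutes with
  \<open>y\<close>. Splitting off \<open>T\<close> to the left of \<open>y\<close> adds the sign
  (-1)^(|T| p(y)), the origin of both the shift by N and the sign rule of :b[a,c]: in the
  formula.\<close>

lemma res_comm_times:
  assumes "front T" "supported (range Zeta) y" "supported (range Zeta) z" "has_parity py y"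
  shows "res_comm T N (p + q) x (y * z)
    = res_comm T N p x y * z + lam 0 (sgn1 (p + card T * py)) * (y * res_comm T N q x z)"
proof -
  have "exp_factor N * (y * supercomm q x z) = y * (exp_factor N * supercomm q x z)"
    by (simp only: mult.assoc[symmetric] exp_factor_commute[OF assms(4,2)])
  then have "part T (exp_factor N * (y * supercomm q x z))
      = lam 0 (sgn1 (py * card T)) * (y * res_comm T N q x z)"
    by (simp only: times_part[OF assms(2,1,4)] res_comm_def)
  moreover have "part T (exp_factor N * (supercomm p x y * z)) = res_comm T N p x y * z"
    by (simp only: mult.assoc[symmetric] part_times[OF assms(3,1)] res_comm_def)
  ultimately show ?thesis
    unfolding res_comm_def supercomm_times
    by (simp add: distrib_left part_add lam_left_commute[of "exp_factor N"] part_lam_times lam_mult'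
        power_add mult.commute)
qed

lemma res_comm_add: "res_comm T N p x (y + z) = res_comm T N p x y + res_comm T N p x z"
  by (simp add: res_comm_def supercomm_add distrib_left part_add)

lemma res_comm_lam: "res_comm T N p x (lam k c * y) = lam k c * res_comm T N p x y"
  by (simp add: res_comm_def supercomm_lam lam_left_commute[of "exp_factor N"] part_lam_times)

lemma res_comm_lsum:
  assumes "lsummable f"
  shows "res_comm T N p x (lsum f) = lsum (\<lambda>i. res_comm T N p x (f i))"
  by (simp add: res_comm_def supercomm_lsum assms times_lsum lsummable_supercomm part_lsum
      lsummable_times_left)

lemma bounded_below_res_comm: "bounded_below y \<Longrightarrow> bounded_below (\<lambda>n. res_comm T N p x (y n))"
  unfolding res_comm_def by (intro bounded_below_part bounded_below_left bounded_below_supercomm)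

lemma lambda_order_zero: "lambda_order d 0"
  by (simp add: lambda_order_def)

lemma lambda_order_mono: "lambda_order d x \<Longrightarrow> d' \<le> d \<Longrightarrow> lambda_order d' x"
  by (auto simp: lambda_order_def)

definition wt :: "nat \<times> nat \<Rightarrow> ('k::case_index, 'u::superspace) opseries" where
  "wt p = weight (fst p) (snd p)"

lemma lambda_order_wt: "lambda_order (fst p + snd p) (wt p * x)"
  by (simp add: wt_def weight_def lambda_order_lam)

lemma wt_left_commute: "x * (wt p * y) = wt p * (x * y)"
  by (simp add: wt_def weight_def lam_left_commute)

lemma lsummable_wt: "lsummable (\<lambda>p. wt p * f p)"
  by (rule lsummable_lambda_order[OF lambda_order_wt finite_pair_sum_le])

text \<open>The weight carries \<lambda>^(r+s), so the sum over pairs converges by order and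
  exchanges with any summable inner sum.\<close>

lemma lsum_wt_swap:
  assumes "\<And>p. lsummable (f p)"
  shows "lsum (\<lambda>p. wt p * lsum (f p)) = lsum (\<lambda>m. lsum (\<lambda>p. wt p * f p m))"
proof -
  have "lsummable (\<lambda>(p, m). wt p * f p m)"
    by (rule lsummable_pair_lambda_order[OF lambda_order_wt finite_pair_sum_le])
      (rule lsummable_times_left[OF assms])
  then show ?thesis
    by (simp add: times_lsum[OF assms] lsum_swap)
qed

lemma lsum_shift: "lsum (\<lambda>m :: int. f (m - s)) = lsum f"
  by (subst (2) lsum_reindex_inv[of "\<lambda>m. m + s" "\<lambda>m. m - s"]) simp_all

text \<open>Restores the even exponential. In \<open>X r m\<close> the index r stands for the mode
  -1-r of a, which z^r moves to the residue; w^s shifts the exponent of w by s.\<close>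

definition res_bracket :: "(nat \<Rightarrow> int \<Rightarrow> ('k::case_index, 'u::superspace) opseries) \<Rightarrow> int \<Rightarrow> ('k, 'u) opseries" where
  "res_bracket X n = lsum (\<lambda>p. wt p * X (fst p) (n - int (snd p)))"

text \<open>The factor w^s moves the modes -s \<le> m < 0 into the nonnegative range. They belong to
  the plus part of the bracket but not to the bracket of the plus part, and the finite sum is this
  defect.\<close>

lemma lsum_plus_res_bracket:
  assumes "bounded_below \<gamma>"
  shows "lsum (\<lambda>p. wt p * lsum (\<lambda>m. (if m \<ge> 0 then X (fst p) m else 0) * \<gamma> (n - int (snd p) - m)))
    = lsum (\<lambda>m. (if m \<ge> 0 then res_bracket X m else 0) * \<gamma> (n - m))
      - lsum (\<lambda>p. wt p * (\<Sum>m\<in>{- int (snd p)..<0}. X (fst p) m * \<gamma> (n - int (snd p) - m)))"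
proof -
  have 1: "lsum (\<lambda>m. (if m \<ge> 0 then X (fst p) m else 0) * \<gamma> (n - int (snd p) - m))
      = lsum (\<lambda>m. (if m \<ge> 0 then X (fst p) (m - int (snd p)) else 0) * \<gamma> (n - m))
      - (\<Sum>m\<in>{- int (snd p)..<0}. X (fst p) m * \<gamma> (n - int (snd p) - m))" (is "?L = ?R - ?S") for p :: "nat \<times> nat"
  proof -
    let ?f = "\<lambda>m. (if m \<ge> 0 then X (fst p) m else 0) * \<gamma> (n - int (snd p) - m)"
    let ?g = "\<lambda>m. if m \<in> {- int (snd p)..<0} then X (fst p) m * \<gamma> (n - int (snd p) - m) else 0"
    have f: "lsummable ?f"
      by (rule lsummable2_times[OF lsummable2_plus[OF assms]])
    have g: "lsummable ?g"
      by (rule lsummable_finite_support[of "{- int (snd p)..<0}"]) auto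
    have "?R = lsum (\<lambda>m. (if m - int (snd p) + int (snd p) \<ge> 0 then X (fst p) (m - int (snd p)) else 0)
        * \<gamma> (n - int (snd p) - (m - int (snd p))))"
      by simp
    also have "\<dots> = lsum (\<lambda>m. (if m + int (snd p) \<ge> 0 then X (fst p) m else 0) * \<gamma> (n - int (snd p) - m))"
      by (rule lsum_shift)
    also have "\<dots> = lsum (\<lambda>m. ?f m + ?g m)"
      by (rule arg_cong[of _ _ lsum]) (auto simp: fun_eq_iff)
    also have "\<dots> = lsum ?f + lsum ?g"
      by (rule lsum_add[OF f g])
    also have "lsum ?g = ?S"
      by (subst lsum_finite_support[of "{- int (snd p)..<0}"]) auto
    finally show ?thesis by simp
  qed
  have s: "lsummable (\<lambda>m. (if m \<ge> 0 then X (fst p) (m - int (snd p)) else 0) * \<gamma> (n - m))" for p :: "nat \<times> nat"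
    by (rule lsummable2_times[OF lsummable2_plus[OF assms]])
  have "lsum (\<lambda>p. wt p * lsum (\<lambda>m. (if m \<ge> 0 then X (fst p) (m - int (snd p)) else 0) * \<gamma> (n - m)))
      = lsum (\<lambda>m. lsum (\<lambda>p. wt p * ((if m \<ge> 0 then X (fst p) (m - int (snd p)) else 0) * \<gamma> (n - m))))"
    by (rule lsum_wt_swap[OF s])
  also have "\<dots> = lsum (\<lambda>m. (if m \<ge> 0 then res_bracket X m else 0) * \<gamma> (n - m))"
  proof (rule arg_cong[of _ _ lsum], rule ext)
    fix m
    show "lsum (\<lambda>p. wt p * ((if m \<ge> 0 then X (fst p) (m - int (snd p)) else 0) * \<gamma> (n - m)))
        = (if m \<ge> 0 then res_bracket X m else 0) * \<gamma> (n - m)"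
      by (cases "m \<ge> 0") (simp_all add: res_bracket_def lsum_times[OF lsummable_wt] mult.assoc)
  qed
  finally show ?thesis
    unfolding 1 right_diff_distrib by (simp only: lsum_diff[OF lsummable_wt lsummable_wt])
qed

text \<open>The same defect for the minus part: the modes -s \<le> m < 0 are negative before the
  shift but not after it.\<close>

lemma lsum_minus_res_bracket:
  assumes "\<And>r. bounded_below (X r)"
  shows "lsum (\<lambda>p. wt p * lsum (\<lambda>m. \<gamma> (n - int (snd p) - m) * (if m < 0 then X (fst p) m else 0)))
    = lsum (\<lambda>m. \<gamma> (n - m) * (if m < 0 then res_bracket X m else 0))
      + lsum (\<lambda>p. wt p * (\<Sum>m\<in>{- int (snd p)..<0}. \<gamma> (n - int (snd p) - m) * X (fst p) m))"
proof -
  have 1: "lsum (\<lambda>m. \<gamma> (n - int (snd p) - m) * (if m < 0 then X (fst p) m else 0))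
      = lsum (\<lambda>m. \<gamma> (n - m) * (if m < 0 then X (fst p) (m - int (snd p)) else 0))
      + (\<Sum>m\<in>{- int (snd p)..<0}. \<gamma> (n - int (snd p) - m) * X (fst p) m)" (is "?L = ?R + ?S") for p :: "nat \<times> nat"
  proof -
    let ?f = "\<lambda>m. \<gamma> (n - int (snd p) - m) * (if m < - int (snd p) then X (fst p) m else 0)"
    let ?g = "\<lambda>m. if m \<in> {- int (snd p)..<0} then \<gamma> (n - int (snd p) - m) * X (fst p) m else 0"
    have f: "lsummable ?f"
      by (rule lsummable2_times[OF lsummable2_minus[OF assms]])
    have g: "lsummable ?g"
      by (rule lsummable_finite_support[of "{- int (snd p)..<0}"]) auto
    have "?R = lsum (\<lambda>m. \<gamma> (n - int (snd p) - (m - int (snd p)))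
        * (if m - int (snd p) < - int (snd p) then X (fst p) (m - int (snd p)) else 0))"
      by simp
    also have "\<dots> = lsum ?f"
      by (rule lsum_shift)
    finally have R: "?R = lsum ?f" .
    have "?L = lsum (\<lambda>m. ?f m + ?g m)"
      by (rule arg_cong[of _ _ lsum]) (auto simp: fun_eq_iff)
    also have "\<dots> = lsum ?f + lsum ?g"
      by (rule lsum_add[OF f g])
    also have "lsum ?g = ?S"
      by (subst lsum_finite_support[of "{- int (snd p)..<0}"]) auto
    finally show ?thesis
      by (simp only: R)
  qed
  have s: "lsummable (\<lambda>m. \<gamma> (n - m) * (if m < 0 then X (fst p) (m - int (snd p)) else 0))" for p :: "nat \<times> nat"
    by (rule lsummable2_times[OF lsummable2_minus[OF bounded_below_shift[OF assms]]])
  have "lsum (\<lambda>p. wt p * lsum (\<lambda>m. \<gamma> (n - m) * (if m < 0 then X (fst p) (m - int (snd p)) else 0)))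
      = lsum (\<lambda>m. lsum (\<lambda>p. wt p * (\<gamma> (n - m) * (if m < 0 then X (fst p) (m - int (snd p)) else 0))))"
    by (rule lsum_wt_swap[OF s])
  also have "\<dots> = lsum (\<lambda>m. \<gamma> (n - m) * (if m < 0 then res_bracket X m else 0))"
  proof (rule arg_cong[of _ _ lsum], rule ext)
    fix m
    show "lsum (\<lambda>p. wt p * (\<gamma> (n - m) * (if m < 0 then X (fst p) (m - int (snd p)) else 0)))
        = \<gamma> (n - m) * (if m < 0 then res_bracket X m else 0)"
      by (cases "m < 0") (simp_all add: res_bracket_def times_lsum[OF lsummable_wt] wt_left_commute)
  qed
  finally show ?thesis
    unfolding 1 distrib_left by (simp only: lsum_add[OF lsummable_wt lsummable_wt])
qed

section \<open>The binomial identities behind the integral over the even parameter\<close>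

lemma sum_alternating_choose_Suc:
  "(\<Sum>i\<le>Suc p. sgn1 i * of_nat (Suc p choose i) * f i)
    = (\<Sum>i\<le>p. sgn1 i * of_nat (p choose i) * f i) - (\<Sum>i\<le>p. sgn1 i * of_nat (p choose i) * f (Suc i))"
proof -
  have "(\<Sum>i\<le>Suc p. sgn1 i * of_nat (Suc p choose i) * f i)
      = f 0 + (\<Sum>i\<le>p. sgn1 (Suc i) * of_nat (p choose Suc i) * f (Suc i)
        - sgn1 i * of_nat (p choose i) * f (Suc i))"
    unfolding sum.atMost_Suc_shift by (simp add: algebra_simps) (rule sum.cong; simp)
  also have "\<dots> = f 0 + (\<Sum>i\<le>p. sgn1 (Suc i) * of_nat (p choose Suc i) * f (Suc i))
        - (\<Sum>i\<le>p. sgn1 i * of_nat (p choose i) * f (Suc i))"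
    by (simp only: sum_subtractf add_diff_eq)
  also have "f 0 + (\<Sum>i\<le>p. sgn1 (Suc i) * of_nat (p choose Suc i) * f (Suc i))
      = (\<Sum>i\<le>Suc p. sgn1 i * of_nat (p choose i) * f i)"
    by (simp add: sum.atMost_Suc_shift del: sum.atMost_Suc)
  also have "\<dots> = (\<Sum>i\<le>p. sgn1 i * of_nat (p choose i) * f i)"
    by simp
  finally show ?thesis .
qed

text \<open>The Beta integral \<open>\<integral>\<^sub>0\<^sup>1 x\<^sup>q (1 - x)\<^sup>p dx\<close>.\<close>

lemma sum_alternating_choose_over:
  "(\<Sum>i\<le>p. sgn1 i * of_nat (p choose i) * (1 / of_nat (i + q + 1))) = (fact p * fact q / fact (p + q + 1) :: complex)"
proof (induction p arbitrary: q)
  case 0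
  then show ?case
    by (simp add: fact_Suc del: of_nat_Suc)
next
  case (Suc p)
  have "(\<Sum>i\<le>Suc p. sgn1 i * of_nat (Suc p choose i) * (1 / of_nat (i + q + 1)))
      = fact p * fact q / fact (p + q + 1) - fact p * fact (Suc q) / fact (p + Suc q + 1)"
    unfolding sum_alternating_choose_Suc using Suc.IH[of q] Suc.IH[of "Suc q"] by simp
  also have "\<dots> = fact p * fact q * (of_nat (p + q + 2) - of_nat (q + 1)) / fact (p + q + 2)"
  proof -
    have 1: "fact (p + q + 2) = of_nat (p + q + 2) * (fact (p + q + 1) :: complex)"
    proof -
      have "p + q + 2 = Suc (p + q + 1)"
        by simp
      then show ?thesis
        by (simp only: fact_Suc)
    qed
    have 2: "of_nat (p + q + 2) \<noteq> (0 :: complex)"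
      unfolding of_nat_eq_0_iff by simp
    have 3: "fact (p + q + 1) \<noteq> (0 :: complex)"
      by (rule fact_nonzero)
    have "fact p * fact q / fact (p + q + 1) = fact p * fact q * of_nat (p + q + 2) / (fact (p + q + 2) :: complex)"
      unfolding 1 using 2 3 by simp
    moreover have "p + Suc q + 1 = p + q + 2" "fact (Suc q) = of_nat (q + 1) * (fact q :: complex)"
      by simp_all
    ultimately show ?thesis
      by (simp only: right_diff_distrib diff_divide_distrib mult.assoc mult.commute[of "of_nat (q + 1)"])
  qed
  also have "of_nat (p + q + 2) - of_nat (q + 1) = (of_nat (Suc p) :: complex)"
    by simp
  also have "fact p * fact q * of_nat (Suc p) = (fact (Suc p) * fact q :: complex)"
    by (simp add: algebra_simps)
  finally show ?case
    by simp
qed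

text \<open>The coefficient of \<open>x^r w^s \<lambda>^(r+s+1)\<close> in (e^{(x-w)\<lambda>} -
  1)/(x-w), the denominator coming from the integration of \<gamma>^(r+s).\<close>

definition int_coeff :: "nat \<Rightarrow> nat \<Rightarrow> complex" where
  "int_coeff r s = exp_coeff r s / of_nat (r + s + 1)"

text \<open>The coefficient of z^r w^q x^p in the identity of generating functions
  ((e^{(x-w)\<lambda>} - 1)/(x-w)) e^{(z-x)\<lambda>} = (e^{(z-w)\<lambda>} -
  e^{(z-x)\<lambda>})/(x-w). On the right (w^k - x^k)/(x-w) is minus the sum of x^p w^q over p + q =
  k - 1, whence the index q + p + 1. Reversing the sum and clearing factorials leaves the Beta
  integral.\<close>

lemma sum_int_coeff:
  "(\<Sum>s\<le>p. int_coeff (p - s) q * exp_coeff r s) = - exp_coeff r (q + p + 1)"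
proof -
  have "(\<Sum>s\<le>p. int_coeff (p - s) q * exp_coeff r s) = (\<Sum>i\<le>p. int_coeff i q * exp_coeff r (p - i))"
    by (rule sum.reindex_bij_witness[of _ "\<lambda>i. p - i" "\<lambda>i. p - i"]) auto
  also have "\<dots> = (\<Sum>i\<le>p. sgn1 (q + p) / (fact p * fact q * fact r)
      * (sgn1 i * of_nat (p choose i) * (1 / of_nat (i + q + 1))))"
  proof (rule sum.cong[OF refl])
    fix i assume "i \<in> {..p}"
    then have i: "i \<le> p" by simp
    have s: "sgn1 (p - i) = sgn1 p * sgn1 i"
      using i by (simp add: minus_one_power_iff)
    have "of_nat (p choose i) = (fact p / (fact i * fact (p - i)) :: complex)"
      by (rule binomial_fact[OF i])
    then show "int_coeff i q * exp_coeff r (p - i) = sgn1 (q + p) / (fact p * fact q * fact r)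
      * (sgn1 i * of_nat (p choose i) * (1 / of_nat (i + q + 1)))"
      by (simp add: int_coeff_def exp_coeff_def s power_add)
  qed
  also have "\<dots> = sgn1 (q + p) / (fact p * fact q * fact r) * (fact p * fact q / fact (p + q + 1))"
    by (simp only: sum_distrib_left[symmetric] sum_alternating_choose_over)
  also have "\<dots> = - exp_coeff r (q + p + 1)"
    by (simp add: exp_coeff_def add.commute)
  finally show ?thesis .
qed

definition int_weight :: "nat \<times> nat \<Rightarrow> ('k::case_index, 'u::superspace) opseries" where
  "int_weight p = lam (fst p + snd p + 1) (int_coeff (fst p) (snd p))"

lemma lambda_order_int_weight: "lambda_order (fst p + snd p) (int_weight p * x)"
  using lambda_order_lam[of "fst p + snd p + 1" _ x] by (auto simp: int_weight_def lambda_order_def)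

lemma lsummable_int_weight: "lsummable (\<lambda>p. int_weight p * f p)"
  by (rule lsummable_lambda_order[OF lambda_order_int_weight finite_pair_sum_le])

text \<open>The comparison of \<open>((e^{(x-w)\<lambda>} - 1) / (x - w)) e^{(z-x)\<lambda>}\<close> with
  \<open>(e^{(z-w)\<lambda>} - e^{(z-x)\<lambda>}) / (x - w)\<close>, coefficient by coefficient.\<close>

lemma lsum_int_weight:
  fixes Z :: "nat \<Rightarrow> int \<Rightarrow> int \<Rightarrow> ('k::case_index, 'u::superspace) opseries"
  shows "lsum (\<lambda>p'. int_weight p' * lsum (\<lambda>p. wt p * Z (fst p) (- 1 - int (fst p') - int (snd p)) (n - int (snd p'))))
    = - lsum (\<lambda>p. wt p * (\<Sum>m\<in>{- int (snd p)..<0}. Z (fst p) m (n - int (snd p) - m)))"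
proof -
  \<comment> \<open>The common triple sum: r, q, p are the exponents of z, w, x. On the right-hand
    side of the claim the exponent of w is s = q + p + 1.\<close>
  let ?K = "\<lambda>(r, q, p). lam (r + q + p + 1) (exp_coeff r (q + p + 1)) * Z r (- 1 - int p) (n - int q)"
  let ?d = "\<lambda>(r, q, p). r + q + p :: nat"
  have fin3: "finite {i. ?d i \<le> k}" for k
    by (rule finite_subset[of _ "{..k} \<times> {..k} \<times> {..k}"]) auto
  \<comment> \<open>The range -s \<le> m < 0 is traversed as -1-m with natural m < s.\<close>
  let ?F = "\<lambda>p m. if m < snd p then wt p * Z (fst p) (- 1 - int m) (n - int (snd p) + 1 + int m) else 0"
  have F: "lsummable (\<lambda>(p, m). ?F p m)"
  proof (rule lsummable_pair_lambda_order[of "\<lambda>p. fst p + snd p"])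
    show "lambda_order (fst p + snd p) (?F p m)" for p m
      using lambda_order_wt[of p] by (auto simp: lambda_order_def)
    show "lsummable (?F p)" for p
      by (rule lsummable_finite_support[of "{..<snd p}"]) auto
  qed (rule finite_pair_sum_le)
  have "lsum (\<lambda>p. wt p * (\<Sum>m\<in>{- int (snd p)..<0}. Z (fst p) m (n - int (snd p) - m)))
      = lsum (\<lambda>p. lsum (?F p))"
  proof (rule arg_cong[of _ _ lsum], rule ext)
    fix p :: "nat \<times> nat"
    have "(\<Sum>m\<in>{- int (snd p)..<0}. Z (fst p) m (n - int (snd p) - m))
        = (\<Sum>m<snd p. Z (fst p) (- 1 - int m) (n - int (snd p) + 1 + int m))"
      by (rule sum.reindex_bij_witness[of _ "\<lambda>m. - 1 - int m" "\<lambda>m. nat (- 1 - m)"]) (auto simp: algebra_simps)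
    moreover have "lsum (?F p) = (\<Sum>m<snd p. ?F p m)"
      by (rule lsum_finite_support) auto
    ultimately show "wt p * (\<Sum>m\<in>{- int (snd p)..<0}. Z (fst p) m (n - int (snd p) - m)) = lsum (?F p)"
      by (simp add: sum_distrib_left)
  qed
  also have "\<dots> = lsum (\<lambda>(p, m). ?F p m)"
    by (rule lsum_pair[OF F])
  also have "\<dots> = lsum ?K"
  proof (subst lsum_reindex_inv[of "\<lambda>((r, s), p). (r, s - p - 1, p)" "\<lambda>(r, q, p). ((r, q + p + 1), p)"])
    show "lsum (\<lambda>j. case case j of (r, q, p) \<Rightarrow> ((r, q + p + 1), p) of (p, m) \<Rightarrow> ?F p m) = lsum ?K"
      by (rule arg_cong[of _ _ lsum]) (auto simp: fun_eq_iff wt_def weight_def algebra_simps)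
  qed (auto split: if_splits)
  finally have Q: "lsum (\<lambda>p. wt p * (\<Sum>m\<in>{- int (snd p)..<0}. Z (fst p) m (n - int (snd p) - m))) = lsum ?K" .
  \<comment> \<open>Terms are grouped by the total exponent p of x, of which s comes from
    \<open>wt\<close> and p - s from \<open>int_weight\<close>.\<close>
  let ?G = "\<lambda>(r, q, p) s. if s \<le> p then lam (r + q + p + 1) (int_coeff (p - s) q * exp_coeff r s)
      * Z r (- 1 - int p) (n - int q) else 0"
  let ?H = "\<lambda>p' p. int_weight p' * (wt p * Z (fst p) (- 1 - int (fst p') - int (snd p)) (n - int (snd p')))"
  have G: "lsummable (\<lambda>(i, s). ?G i s)"
  proof (rule lsummable_pair_lambda_order[of ?d, OF _ fin3])
    fix i :: "nat \<times> nat \<times> nat" and s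
    obtain r q p where i: "i = (r, q, p)"
      by (cases i)
    show "lambda_order (?d i) (?G i s)"
      by (auto simp: i lambda_order_zero intro!: lambda_order_mono[OF lambda_order_lam])
    show "lsummable (?G i)"
      by (rule lsummable_finite_support[of "{..p}"]) (auto simp: i)
  qed
  have H: "lsummable (\<lambda>(p', p). ?H p' p)"
    by (rule lsummable_pair_lambda_order[OF lambda_order_int_weight finite_pair_sum_le])
      (rule lsummable_times_left[OF lsummable_wt])
  have "lsum (\<lambda>p'. int_weight p' * lsum (\<lambda>p. wt p * Z (fst p) (- 1 - int (fst p') - int (snd p)) (n - int (snd p'))))
      = lsum (\<lambda>p'. lsum (?H p'))"
    by (simp only: times_lsum[OF lsummable_wt])
  also have "\<dots> = lsum (\<lambda>(p', p). ?H p' p)"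
    by (rule lsum_pair[OF H])
  also have "\<dots> = lsum (\<lambda>(i, s). ?G i s)"
  proof -
    let ?h = "\<lambda>((r', q), (r, s)). ((r, q, r' + s), s) :: (nat \<times> nat \<times> nat) \<times> nat"
    have "lsum (\<lambda>(i, s). ?G i s) = lsum (\<lambda>j. case ?h j of (i, s) \<Rightarrow> ?G i s)"
      by (rule lsum_reindex_inv[of "\<lambda>((r, q, p), s). ((p - s, q), (r, s))"]) (auto split: if_splits)
    moreover have "lsum (\<lambda>(p', p). ?H p' p) = lsum (\<lambda>j. case ?h j of (i, s) \<Rightarrow> ?G i s)"
      by (rule arg_cong[of _ _ lsum])
        (auto simp: fun_eq_iff wt_def weight_def int_weight_def lam_mult' algebra_simps)
    ultimately show ?thesis
      by (simp only:)
  qed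
  also have "\<dots> = lsum (\<lambda>i. lsum (?G i))"
    by (rule lsum_pair[OF G, symmetric])
  also have "\<dots> = lsum (\<lambda>i. - ?K i)"
  proof (rule arg_cong[of _ _ lsum], rule ext)
    fix i :: "nat \<times> nat \<times> nat"
    obtain r q p where i: "i = (r, q, p)"
      by (cases i)
    have "lsum (?G i) = (\<Sum>s\<le>p. ?G i s)"
      by (rule lsum_finite_support) (auto simp: i)
    also have "\<dots> = lam (r + q + p + 1) (\<Sum>s\<le>p. int_coeff (p - s) q * exp_coeff r s) * Z r (- 1 - int p) (n - int q)"
      by (simp add: i lam_sum sum_distrib_right)
    also have "\<dots> = - ?K i"
      by (simp only: sum_int_coeff i) (simp add: lam_minus)
    finally show "lsum (?G i) = - ?K i" .
  qed
  also have "\<dots> = - lsum ?K"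
  proof (rule lsum_uminus, rule lsummable_lambda_order[of ?d, OF _ fin3])
    fix i :: "nat \<times> nat \<times> nat"
    obtain r q p where i: "i = (r, q, p)"
      by (cases i)
    show "lambda_order (?d i) (?K i)"
      by (auto simp: i intro!: lambda_order_mono[OF lambda_order_lam])
  qed
  finally show ?thesis
    by (simp only: Q)
qed

text \<open>\<open>P\<close> holds the modes of :bc: and \<sigma> is the product of the parities of
  the bracket of a, b and of c, the removal of \<open>T\<close> shifting the former by |T|. The
  defects of the plus and minus parts combine to a supercommutator, because \<sigma> is also the
  sign between the two halves of :[a,b]c:.\<close>

lemma wick_modes:
  fixes \<alpha> :: "nat \<Rightarrow> ('k::case_index, 'u::superspace) opseries" and \<beta> \<gamma> :: "int \<Rightarrow> ('k, 'u) opseries"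
    and pa pb pc N :: nat and n :: int
  assumes T: "front T"
    and \<beta>: "\<And>m. supported (range Zeta) (\<beta> m)" "\<And>m. has_parity pb (\<beta> m)" "bounded_below \<beta>"
    and \<gamma>: "\<And>m. supported (range Zeta) (\<gamma> m)" "\<And>m. has_parity pc (\<gamma> m)" "bounded_below \<gamma>"
  defines "X \<equiv> \<lambda>r m. res_comm T N (pa * pb) (\<alpha> r) (\<beta> m)"
    and "Y \<equiv> \<lambda>r m. res_comm T N (pa * pc) (\<alpha> r) (\<gamma> m)"
    and "P \<equiv> \<lambda>q. lsum (\<lambda>m. (if m \<ge> 0 then \<beta> m else 0) * \<gamma> (q - m))
       + lam 0 (sgn1 (pb * pc)) * lsum (\<lambda>m. \<gamma> (q - m) * (if m < 0 then \<beta> m else 0))"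
    and "\<sigma> \<equiv> (pa + pb + card T) * pc"
  shows "lsum (\<lambda>p. wt p * res_comm T N (pa * (pb + pc)) (\<alpha> (fst p)) (P (n - int (snd p))))
    = (lsum (\<lambda>m. (if m \<ge> 0 then res_bracket X m else 0) * \<gamma> (n - m))
        + lam 0 (sgn1 \<sigma>) * lsum (\<lambda>m. \<gamma> (n - m) * (if m < 0 then res_bracket X m else 0)))
      + lam 0 (sgn1 ((pa + card T) * pb)) *
        (lsum (\<lambda>m. (if m \<ge> 0 then \<beta> m else 0) * res_bracket Y (n - m))
        + lam 0 (sgn1 (pb * (pa + pc + card T))) * lsum (\<lambda>m. res_bracket Y (n - m) * (if m < 0 then \<beta> m else 0)))
      + lsum (\<lambda>p. int_weight p * supercomm \<sigma> (res_bracket X (- 1 - int (fst p))) (\<gamma> (n - int (snd p))))"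
proof -
  have X_bb: "bounded_below (X r)" and Y_bb: "bounded_below (Y r)" for r
    unfolding X_def Y_def by (rule bounded_below_res_comm[OF \<beta>(3)], rule bounded_below_res_comm[OF \<gamma>(3)])
  have XP: "res_comm T N (pa * pb) (\<alpha> r) (if m \<ge> 0 then \<beta> m else 0) = (if m \<ge> 0 then X r m else 0)"
    and XM: "res_comm T N (pa * pb) (\<alpha> r) (if m < 0 then \<beta> m else 0) = (if m < 0 then X r m else 0)" for r m
    by (simp_all add: X_def)
  have if_supp: "supported (range Zeta) (if Q then \<beta> m else 0)" "has_parity pb (if Q then \<beta> m else 0)" for Q m
    using \<beta>(1,2) by (simp_all add: supported_def has_parity_zero)
  \<comment> \<open>The signs of moving a and \<open>T\<close> past b, of moving them past c, and of
    exchanging b and c in the normally ordered product.\<close>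
  let ?s1 = "lam 0 (sgn1 (pa * pb + card T * pb)) :: ('k, 'u) opseries"
  let ?s2 = "lam 0 (sgn1 (pa * pc + card T * pc)) :: ('k, 'u) opseries"
  let ?s3 = "lam 0 (sgn1 (pb * pc)) :: ('k, 'u) opseries"
  note sum1 = lsummable2_times[OF lsummable2_plus[OF \<gamma>(3)]]
  note sum2 = lsummable2_times[OF lsummable2_minus[OF \<beta>(3)]]
  note sum3 = lsummable2_times[OF lsummable2_plus[OF Y_bb]]
  note sum4 = lsummable2_times[OF lsummable2_minus[OF X_bb]]
  define A1 A2 A3 A4 where "A1 = (\<lambda>r q. lsum (\<lambda>m. (if m \<ge> 0 then X r m else 0) * \<gamma> (q - m)))"
    and "A2 = (\<lambda>r q. lsum (\<lambda>m. (if m \<ge> 0 then \<beta> m else 0) * Y r (q - m)))"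
    and "A3 = (\<lambda>r q. lsum (\<lambda>m. Y r (q - m) * (if m < 0 then \<beta> m else 0)))"
    and "A4 = (\<lambda>r q. lsum (\<lambda>m. \<gamma> (q - m) * (if m < 0 then X r m else 0)))"
  have step: "res_comm T N (pa * (pb + pc)) (\<alpha> r) (P q) = A1 r q + ?s1 * A2 r q + ?s3 * A3 r q + ?s3 * (?s2 * A4 r q)"
    for r q
  proof -
    have "res_comm T N (pa * (pb + pc)) (\<alpha> r) (lsum (\<lambda>m. (if m \<ge> 0 then \<beta> m else 0) * \<gamma> (q - m)))
        = lsum (\<lambda>m. (if m \<ge> 0 then X r m else 0) * \<gamma> (q - m) + ?s1 * ((if m \<ge> 0 then \<beta> m else 0) * Y r (q - m)))"
      unfolding res_comm_lsum[OF sum1] distrib_left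
        res_comm_times[OF T if_supp(1) \<gamma>(1) if_supp(2)] XP Y_def ..
    also have "\<dots> = A1 r q + ?s1 * A2 r q"
      unfolding A1_def A2_def by (simp only: lsum_add[OF sum1 lsummable_times_left[OF sum3]] times_lsum[OF sum3])
    finally have 1: "res_comm T N (pa * (pb + pc)) (\<alpha> r) (lsum (\<lambda>m. (if m \<ge> 0 then \<beta> m else 0) * \<gamma> (q - m)))
        = A1 r q + ?s1 * A2 r q" .
    have "res_comm T N (pa * (pc + pb)) (\<alpha> r) (lsum (\<lambda>m. \<gamma> (q - m) * (if m < 0 then \<beta> m else 0)))
        = lsum (\<lambda>m. Y r (q - m) * (if m < 0 then \<beta> m else 0) + ?s2 * (\<gamma> (q - m) * (if m < 0 then X r m else 0)))"
      unfolding res_comm_lsum[OF sum2] distrib_left[of pa]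
        res_comm_times[OF T \<gamma>(1) if_supp(1) \<gamma>(2)] XM Y_def ..
    also have "\<dots> = A3 r q + ?s2 * A4 r q"
      unfolding A3_def A4_def by (simp only: lsum_add[OF sum2 lsummable_times_left[OF sum4]] times_lsum[OF sum4])
    finally have 2: "res_comm T N (pa * (pb + pc)) (\<alpha> r) (lsum (\<lambda>m. \<gamma> (q - m) * (if m < 0 then \<beta> m else 0)))
        = A3 r q + ?s2 * A4 r q"
      by (simp only: add.commute)
    show ?thesis
      unfolding P_def res_comm_add res_comm_lam 1 2 by (simp add: distrib_left add.assoc)
  qed
  \<comment> \<open>The cut-off concerns the modes of b, whereas the shift by the exponential is
    absorbed by \<open>Y\<close>; so these terms leave no defect.\<close>
  have A2: "lsum (\<lambda>p. wt p * A2 (fst p) (n - int (snd p))) = lsum (\<lambda>m. (if m \<ge> 0 then \<beta> m else 0) * res_bracket Y (n - m))"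
    unfolding A2_def lsum_wt_swap[OF sum3]
    by (simp only: wt_left_commute[symmetric] times_lsum[OF lsummable_wt, symmetric] res_bracket_def)
      (simp only: diff_right_commute)
  have A3: "lsum (\<lambda>p. wt p * A3 (fst p) (n - int (snd p))) = lsum (\<lambda>m. res_bracket Y (n - m) * (if m < 0 then \<beta> m else 0))"
    unfolding A3_def lsum_wt_swap[where f = "\<lambda>p m. Y (fst p) (n - int (snd p) - m) * (if m < 0 then \<beta> m else 0)", OF sum2]
    by (simp only: mult.assoc[symmetric] lsum_times[OF lsummable_wt, symmetric] res_bracket_def)
      (simp only: diff_right_commute)
  define QX QG where "QX = lsum (\<lambda>p. wt p * (\<Sum>m\<in>{- int (snd p)..<0}. X (fst p) m * \<gamma> (n - int (snd p) - m)))"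
    and "QG = lsum (\<lambda>p. wt p * (\<Sum>m\<in>{- int (snd p)..<0}. \<gamma> (n - int (snd p) - m) * X (fst p) m))"
  have A1: "lsum (\<lambda>p. wt p * A1 (fst p) (n - int (snd p)))
      = lsum (\<lambda>m. (if m \<ge> 0 then res_bracket X m else 0) * \<gamma> (n - m)) - QX"
    unfolding A1_def QX_def by (rule lsum_plus_res_bracket[OF \<gamma>(3)])
  have A4: "lsum (\<lambda>p. wt p * A4 (fst p) (n - int (snd p)))
      = lsum (\<lambda>m. \<gamma> (n - m) * (if m < 0 then res_bracket X m else 0)) + QG"
    unfolding A4_def QG_def by (rule lsum_minus_res_bracket[OF X_bb])
  define Z where "Z = (\<lambda>r m q. supercomm \<sigma> (X r m) (\<gamma> q))"
  have "supercomm \<sigma> (res_bracket X m) (\<gamma> q) = lsum (\<lambda>p. wt p * Z (fst p) (m - int (snd p)) q)" for m q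
    unfolding Z_def supercomm_def res_bracket_def
    by (simp add: lsum_times times_lsum lsummable_wt lsummable_times_left lsummable_times_right
        right_diff_distrib wt_left_commute mult.assoc lsum_diff)
  then have "lsum (\<lambda>p. int_weight p * supercomm \<sigma> (res_bracket X (- 1 - int (fst p))) (\<gamma> (n - int (snd p))))
      = - lsum (\<lambda>p. wt p * (\<Sum>m\<in>{- int (snd p)..<0}. Z (fst p) m (n - int (snd p) - m)))"
    by (simp only: lsum_int_weight)
  also have "lsum (\<lambda>p. wt p * (\<Sum>m\<in>{- int (snd p)..<0}. Z (fst p) m (n - int (snd p) - m)))
      = QX - lam 0 (sgn1 \<sigma>) * QG"
    unfolding Z_def supercomm_def QX_def QG_def
    by (simp add: sum_subtractf sum_distrib_left[symmetric] right_diff_distrib lsum_diff lsummable_wt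
        wt_left_commute times_lsum)
  finally have J: "lsum (\<lambda>p. int_weight p * supercomm \<sigma> (res_bracket X (- 1 - int (fst p))) (\<gamma> (n - int (snd p))))
      = - QX + lam 0 (sgn1 \<sigma>) * QG"
    by simp
  have "lsum (\<lambda>p. wt p * res_comm T N (pa * (pb + pc)) (\<alpha> (fst p)) (P (n - int (snd p))))
      = lsum (\<lambda>p. wt p * A1 (fst p) (n - int (snd p))) + ?s1 * lsum (\<lambda>p. wt p * A2 (fst p) (n - int (snd p)))
        + ?s3 * lsum (\<lambda>p. wt p * A3 (fst p) (n - int (snd p)))
        + ?s3 * (?s2 * lsum (\<lambda>p. wt p * A4 (fst p) (n - int (snd p))))"
    unfolding step
    by (simp only: distrib_left[of "wt _"] lam_left_commute[of "wt _"] lsum_add lsummable_add lsummable_wt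
        lsummable_times_left times_lsum)
  moreover have "?s3 * (?s2 * x) = lam 0 (sgn1 \<sigma>) * x" for x
    by (simp add: lam_mult' \<sigma>_def flip: power_add) (simp add: algebra_simps)
  moreover have "?s1 * x = lam 0 (sgn1 ((pa + card T) * pb)) * x" for x
    by (simp add: algebra_simps)
  \<comment> \<open>Modulo 2 the exponents add up to pb pc.\<close>
  moreover have "lam 0 (sgn1 ((pa + card T) * pb)) * (lam 0 (sgn1 (pb * (pa + pc + card T))) * x) = ?s3 * x" for x
    by (simp add: lam_mult' flip: power_add) (simp add: minus_one_power_iff algebra_simps)
  ultimately show ?thesis
    unfolding A1 A2 A3 A4 J by (simp add: distrib_left algebra_simps)
qed

section \<open>Normally ordered products and brackets in terms of modes\<close>

lemma lsummable2_reindex: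
  assumes "lsummable2 (\<lambda>j. f (h j)) (\<lambda>j. g (h j))" "\<And>i. i \<notin> range h \<Longrightarrow> f i = 0"
  shows "lsummable2 f g"
  unfolding lsummable2_def
proof (intro allI)
  fix k v
  have "{(i, s, t). fst s \<le> k \<and> fst t \<le> k \<and> coef (f i) s (coef (g i) t v) \<noteq> 0}
    \<subseteq> (\<lambda>(j, s, t). (h j, s, t)) ` {(j, s, t). fst s \<le> k \<and> fst t \<le> k \<and> coef (f (h j)) s (coef (g (h j)) t v) \<noteq> 0}"
  proof (rule subsetI, clarify)
    fix i s1 s2 t1 t2
    let ?s = "(s1, s2) :: odd_monomial" and ?t = "(t1, t2) :: odd_monomial"
    assume *: "fst ?s \<le> k" "fst ?t \<le> k" "coef (f i) ?s (coef (g i) ?t v) \<noteq> 0"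
    have "i \<in> range h"
    proof (rule ccontr)
      assume "i \<notin> range h"
      from assms(2)[OF this] *(3) show False by simp
    qed
    then obtain j where "i = h j" by blast
    with * show "(i, ?s, ?t) \<in> (\<lambda>(j, s, t). (h j, s, t)) `
        {(j, s, t). fst s \<le> k \<and> fst t \<le> k \<and> coef (f (h j)) s (coef (g (h j)) t v) \<noteq> 0}"
      by (intro image_eqI[of _ _ "(j, ?s, ?t)"]) auto
  qed
  moreover have "finite {(j, s, t). fst s \<le> k \<and> fst t \<le> k \<and> coef (f (h j)) s (coef (g (h j)) t v) \<noteq> 0}"
    using assms(1) by (simp add: lsummable2_def)
  ultimately show "finite {(i, s, t). fst s \<le> k \<and> fst t \<le> k \<and> coef (f i) s (coef (g i) t v) \<noteq> 0}"
    by (rule finite_surj[rotated])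
qed

lemma lsummable2_lambda_order:
  assumes "\<And>i. lambda_order (d i) (f i)" "\<And>k. finite {i. d i \<le> k}"
  shows "lsummable2 f g"
proof (rule lsummable2I)
  fix k v
  have "i \<in> {i. d i \<le> k}" if "fst s \<le> k" "coef (f i) s (coef (g i) t v) \<noteq> 0" for i s t
  proof -
    have "\<not> fst s < d i"
      using assms(1)[of i] that(2) unfolding lambda_order_def by blast
    then show ?thesis
      using that(1) by simp
  qed
  then show "\<exists>A. finite A \<and> (\<forall>i s t. fst s \<le> k \<longrightarrow> fst t \<le> k \<longrightarrow>
      coef (f i) s (coef (g i) t v) \<noteq> 0 \<longrightarrow> i \<in> A)"
    using assms(2)[of k] by blast
qed

lemma represents_mult_Z:
  fixes x y :: "int \<Rightarrow> ('k::case_index, 'u::superspace) opseries"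
  assumes "represents F (\<lambda>m n. if n = 0 then x m else 0)" "represents G (\<lambda>m n. if n = 0 then y m else 0)"
    and "\<And>m. lsummable2 x (\<lambda>p. y (m - p))"
  shows "represents (series_mult (index_case TYPE('k)) F G)
    (\<lambda>m n. if n = 0 then lsum (\<lambda>p. x p * y (m - p)) else 0)"
proof -
  let ?x = "\<lambda>(p :: int, q :: int). if q = 0 then x p else 0"
  let ?y = "\<lambda>m n (p :: int, q :: int). if n - q = (0 :: int) then y (m - p) else 0"
  have range: "i \<in> range (\<lambda>p :: int. (p, 0 :: int))" if "?x i \<noteq> 0" for i
    using that by (cases i) (auto split: if_splits)
  have "lsummable2 ?x (?y m n)" for m n
  proof (rule lsummable2_reindex[of _ "\<lambda>p. (p, 0)"])
    show "lsummable2 (\<lambda>p. ?x (p, 0)) (\<lambda>p. ?y m n (p, 0))"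
    proof (cases "n = 0")
      case True
      then show ?thesis using assms(3)[of m] by simp
    next
      case False
      then show ?thesis by (intro lsummable2_finite_support[of "{}"]) auto
    qed
  qed (use range in blast)
  then have "represents (series_mult (index_case TYPE('k)) F G)
      (\<lambda>m n. lsum (\<lambda>(p, q). (if q = 0 then x p else 0) * (if n - q = 0 then y (m - p) else 0)))"
    by (intro represents_mult[OF assms(1,2)]) (simp add: split_def)
  moreover have "lsum (\<lambda>(p, q). (if q = 0 then x p else 0) * (if n - q = 0 then y (m - p) else 0))
      = (if n = 0 then lsum (\<lambda>p. x p * y (m - p)) else 0)" for m n :: int
    by (subst lsum_reindex_inv[of fst "\<lambda>p. (p, 0)"]) (auto split: if_splits)
  ultimately show ?thesis
    by simp
qed

lemma is_field_restrict:
  assumes "is_field N f"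
  shows "is_field N (\<lambda>n I. if P n then f n I else 0)"
  unfolding is_field_def
proof (intro conjI allI impI)
  fix v
  obtain M where "\<forall>n<M. \<forall>I. f n I v = 0"
    using is_fieldD(3)[OF assms] by blast
  then show "\<exists>M. \<forall>n<M. \<forall>I. (if P n then f n I else 0) v = 0"
    by (intro exI[of _ M]) simp
qed (use is_fieldD(1,2)[OF assms] in \<open>simp_all add: is_endo_zero\<close>)

lemma field_minus_eq: "field_minus f = (\<lambda>n I. if n < 0 then f n I else 0)"
  by (auto simp: field_minus_def field_plus_def fun_eq_iff)

lemma is_field_field_plus: "is_field N f \<Longrightarrow> is_field N (field_plus f)"
  unfolding field_plus_def by (rule is_field_restrict)

lemma is_field_field_minus: "is_field N f \<Longrightarrow> is_field N (field_minus f)"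
  unfolding field_minus_eq by (rule is_field_restrict)

lemma mode_restrict:
  assumes "is_field N f" "inj V"
  shows "mode V (\<lambda>n I. if P n then f n I else 0) m = (if P m then mode V f m else 0)"
proof (rule opseries_eqI)
  fix k S v
  show "coef (mode V (\<lambda>n I. if P n then f n I else 0) m) (k, S) v = coef (if P m then mode V f m else 0) (k, S) v"
    unfolding coef_mode[OF is_field_restrict[OF assms(1)] assms(2)]
    by (auto simp: coef_mode[OF assms] endo_zero[OF is_endo_pin])
qed

lemma mode_field_plus:
  assumes "is_field N f" "inj V"
  shows "mode V (field_plus f) m = (if m \<ge> 0 then mode V f m else 0)"
    and "mode V (field_minus f) m = (if m < 0 then mode V f m else 0)"
  unfolding field_plus_def field_minus_eq by (rule mode_restrict[OF assms])+

definition normal_mode :: "(nat \<Rightarrow> generator) \<Rightarrow> 'u field \<Rightarrow> 'u field \<Rightarrow> int \<Rightarrow> ('k::case_index, 'u::superspace) opseries" where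
  "normal_mode V f g n = lsum (\<lambda>m. (if m \<ge> 0 then mode V f m else 0) * mode V g (n - m))
     + lam 0 (sgn1 (parity f * parity g)) * lsum (\<lambda>m. mode V g (n - m) * (if m < 0 then mode V f m else 0))"

lemma
  assumes "is_field N f" "is_field N g" "inj V"
  shows lsummable2_normal_plus: "lsummable2 (\<lambda>m. if m \<ge> 0 then mode V f m else 0) (\<lambda>m. mode V g (n - m))"
    and lsummable2_normal_minus: "lsummable2 (\<lambda>m. mode V g (n - m)) (\<lambda>m. if m < 0 then mode V f m else 0)"
  by (rule lsummable2_plus[OF bounded_below_mode[OF assms(2,3)]],
      rule lsummable2_minus[OF bounded_below_mode[OF assms(1,3)]])

lemma normal_product_eq_theta:
  fixes f g :: "'u::superspace field"
  assumes "is_field N f" "is_field N g"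
  shows "normal_product (index_case TYPE('k)) f g n I v
    = pin (card I) (coef (normal_mode Theta f g n :: ('k::case_index, 'u) opseries) (0, Theta ` I) v)"
proof -
  let ?\<kappa> = "index_case TYPE('k)"
  note rp = represents_in_Z[OF is_field_field_plus[OF assms(1)], unfolded mode_field_plus(1)[OF assms(1) inj_Theta]]
  note rm = represents_in_Z[OF is_field_field_minus[OF assms(1)], unfolded mode_field_plus(2)[OF assms(1) inj_Theta]]
  note rg = represents_in_Z[OF assms(2)]
  \<comment> \<open>\<open>series_mult\<close> sums over the exponent of its first factor, here g,
    while \<open>normal_mode\<close> sums over that of f; p and m - p are exchanged.\<close>
  have minus: "lsummable2 (mode Theta g) (\<lambda>p. if m - p < 0 then mode Theta f (m - p) else 0 :: ('k, 'u) opseries)" for m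
  proof (rule lsummable2_reindex[of _ "\<lambda>p. m - p"])
    show "lsummable2 (\<lambda>p. mode Theta g (m - p))
        (\<lambda>p. if m - (m - p) < 0 then mode Theta f (m - (m - p)) else 0 :: ('k, 'u) opseries)"
      using lsummable2_normal_minus[OF assms inj_Theta, of m] by (simp cong: if_cong)
    show "mode Theta g i = 0" if "i \<notin> range (\<lambda>p. m - p)" for i
      using that by (metis diff_diff_eq2 add_diff_cancel_left' rangeI)
  qed
  have rep: "represents (series_mult ?\<kappa> (in_Z (field_plus f)) (in_Z g)
      + minus_one_power (parity f * parity g) (series_mult ?\<kappa> (in_Z g) (in_Z (field_minus f))))
    (\<lambda>m n. (if n = 0 then lsum (\<lambda>p. (if p \<ge> 0 then mode Theta f p else 0) * mode Theta g (m - p)) else 0)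
      + lam 0 (sgn1 (parity f * parity g)) *
       (if n = 0 then lsum (\<lambda>p. mode Theta g p * (if m - p < 0 then mode Theta f (m - p) else 0)) else 0 :: ('k, 'u) opseries))"
    by (intro represents_add represents_minus_one_power represents_mult_Z rp rm rg
        lsummable2_normal_plus[OF assms inj_Theta] minus)
  have swap: "lsum (\<lambda>p. mode Theta g p * (if m - p < 0 then mode Theta f (m - p) else 0))
      = lsum (\<lambda>p. mode Theta g (m - p) * (if p < 0 then mode Theta f p else 0) :: ('k, 'u) opseries)" for m
    by (subst lsum_reindex_inv[of "\<lambda>p. m - p" "\<lambda>p. m - p"]) simp_all
  have card: "card (Theta ` I) = card I"
    by (rule card_image[OF inj_on_subset[OF inj_Theta]]) simp
  show ?thesis
    unfolding normal_product_def normal_mode_def representsD[OF rep] swap card by (simp only: if_True simp_thms)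
qed

lemma supported_mult:
  assumes "supported Q x" "supported Q y"
    and "square_free Q"
  shows "supported Q (x * y)"
  unfolding supported_def
proof (intro allI impI)
  fix u v assume ne: "coef (x * y) u v \<noteq> 0"
  obtain l S where u: "u = (l, S)" by (cases u)
  have "finite S"
    using coef_finite[OF ne] by (simp add: u)
  from ne obtain T where T: "T \<in> Pow S" "swap_sign (S - T) T *\<^sub>C coef x (l, S - T) (coef y (0, T) v) \<noteq> 0"
    unfolding u coef_times_supported[OF assms(2,3) \<open>finite S\<close>] by (metis (mono_tags, lifting) sum.neutral)
  then have "coef x (l, S - T) (coef y (0, T) v) \<noteq> 0" "coef y (0, T) v \<noteq> 0"
    by auto
  then have "l = 0" "S - T \<subseteq> Q" "T \<subseteq> Q"
    using supportedD[OF assms(1), of "(l, S - T)"] supportedD[OF assms(2), of "(0, T)"] by auto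
  then show "fst u = 0 \<and> snd u \<subseteq> Q"
    by (auto simp: u)
qed

lemma supported_lsum:
  assumes "lsummable f" "\<And>i. supported Q (f i)"
  shows "supported Q (lsum f)"
  unfolding supported_def
proof (intro allI impI)
  fix t v assume "coef (lsum f) t v \<noteq> 0"
  then obtain i where "coef (f i) t v \<noteq> 0"
    unfolding coef_lsum[OF assms(1)] by (metis Sum_any.not_neutral_obtains_not_neutral)
  then show "fst t = 0 \<and> snd t \<subseteq> Q"
    using supportedD[OF assms(2)] by blast
qed

lemma supported_zero: "supported Q 0"
  by (simp add: supported_def)

lemma supported_add: "supported Q x \<Longrightarrow> supported Q y \<Longrightarrow> supported Q (x + y)"
  unfolding supported_def by (metis add.right_neutral coef_plus)

lemma supported_lam: "supported Q x \<Longrightarrow> supported Q (lam 0 c * x)"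
  unfolding supported_def by (auto simp: coef_lam_times)

lemma swap_sign_image:
  assumes "V = Theta \<or> V = Zeta"
  shows "swap_sign (V ` I) (V ` J) = sgn1 (card {(i, j) \<in> I \<times> J. j < i})"
proof -
  have inj: "inj V"
    using assms inj_Theta inj_Zeta by auto
  have prec: "precedes (V j) (V i) \<longleftrightarrow> j < i" for i j
    using assms by auto
  have "{(g, h) \<in> V ` I \<times> V ` J. precedes h g} = (\<lambda>(i, j). (V i, V j)) ` {(i, j) \<in> I \<times> J. j < i}"
    by (auto simp: prec)
  moreover have "inj_on (\<lambda>(i, j). (V i, V j)) {(i, j) \<in> I \<times> J. j < i}"
    using inj by (auto simp: inj_on_def)
  ultimately show ?thesis
    by (simp add: swap_sign_def card_image)
qed

text \<open>The right-hand side does not depend on \<open>V\<close>, which is what permits the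
  renaming of \<theta> into \<zeta>.\<close>

lemma coef_mode_times_mode:
  fixes f g :: "'u::superspace field"
  assumes "is_field N f" "is_field N g" "V = Theta \<or> V = Zeta" "finite I"
  shows "coef (mode V f m * mode V g n :: ('k::case_index, 'u) opseries) (0, V ` I) v
    = (\<Sum>J\<in>Pow I. sgn1 (card {(i, j) \<in> (I - J) \<times> J. j < i}) *\<^sub>C
        pin (card (I - J)) (f m (I - J) (pin (card J) (g n J v))))"
proof -
  have inj: "inj V"
    using assms(3) inj_Theta inj_Zeta by auto
  have sq: "square_free (range V)"
    using assms(3) square_free_Theta square_free_Zeta by auto
  let ?f = "mode V f m :: ('k, 'u) opseries" and ?g = "mode V g n :: ('k, 'u) opseries"
  have "coef (?f * ?g) (0, V ` I) v = (\<Sum>T\<in>Pow (V ` I). swap_sign (V ` I - T) T *\<^sub>C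
      coef ?f (0, V ` I - T) (coef ?g (0, T) v))"
    by (rule coef_times_supported[OF supported_mode[OF assms(2) inj] sq]) (simp add: assms(4))
  also have "\<dots> = (\<Sum>J\<in>Pow I. swap_sign (V ` I - V ` J) (V ` J) *\<^sub>C
      coef ?f (0, V ` I - V ` J) (coef ?g (0, V ` J) v))"
    unfolding image_Pow_surj[OF refl, of V I, symmetric]
    by (subst sum.reindex) (auto simp: inj_on_def inj_image_eq_iff[OF inj])
  also have "\<dots> = (\<Sum>J\<in>Pow I. sgn1 (card {(i, j) \<in> (I - J) \<times> J. j < i}) *\<^sub>C
        pin (card (I - J)) (f m (I - J) (pin (card J) (g n J v))))"
  proof (rule sum.cong[OF refl])
    fix J
    have diff: "V ` I - V ` J = V ` (I - J)"
      by (rule image_set_diff[OF inj, symmetric])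
    have pre: "{i. V i \<in> V ` K} = K" for K
      using inj by (simp add: inj_image_mem_iff)
    have "card (V ` K) = card K" for K
      by (rule card_image[OF inj_on_subset[OF inj]]) simp
    then show "swap_sign (V ` I - V ` J) (V ` J) *\<^sub>C
        coef ?f (0, V ` I - V ` J) (coef ?g (0, V ` J) v)
      = sgn1 (card {(i, j) \<in> (I - J) \<times> J. j < i}) *\<^sub>C
        pin (card (I - J)) (f m (I - J) (pin (card J) (g n J v)))"
      by (simp add: diff swap_sign_image[OF assms(3)] coef_mode[OF assms(1) inj]
          coef_mode[OF assms(2) inj] pre image_mono)
  qed
  finally show ?thesis .
qed

text \<open>\<open>normal_product\<close> is computed in the variables Z, but inside a bracket it is
  needed in W.\<close>

lemma coef_normal_mode_rename:
  fixes f g :: "'u::superspace field"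
  assumes "is_field N f" "is_field N g"
  shows "coef (normal_mode Theta f g n :: ('k::case_index, 'u) opseries) (0, Theta ` I) v
    = coef (normal_mode Zeta f g n :: ('k, 'u) opseries) (0, Zeta ` I) v"
proof (cases "finite I")
  case True
  note sums = lsummable2_times[OF lsummable2_normal_plus[OF assms]] lsummable2_times[OF lsummable2_normal_minus[OF assms]]
  have 1: "coef ((if m \<ge> 0 then mode Theta f m else 0) * mode Theta g q :: ('k, 'u) opseries) (0, Theta ` I) v
      = coef ((if m \<ge> 0 then mode Zeta f m else 0) * mode Zeta g q :: ('k, 'u) opseries) (0, Zeta ` I) v" for m q
    by (cases "m \<ge> 0") (simp_all only: if_True if_False mult_zero_left coef_0
        coef_mode_times_mode[OF assms disjI1[OF refl] True] coef_mode_times_mode[OF assms disjI2[OF refl] True])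
  have 2: "coef (mode Theta g q * (if m < 0 then mode Theta f m else 0) :: ('k, 'u) opseries) (0, Theta ` I) v
      = coef (mode Zeta g q * (if m < 0 then mode Zeta f m else 0) :: ('k, 'u) opseries) (0, Zeta ` I) v" for m q
    by (cases "m < 0") (simp_all only: if_True if_False mult_zero_right coef_0
        coef_mode_times_mode[OF assms(2,1) disjI1[OF refl] True] coef_mode_times_mode[OF assms(2,1) disjI2[OF refl] True])
  show ?thesis
    unfolding normal_mode_def coef_plus coef_lam_times
      coef_lsum[OF sums(1)[OF inj_Theta]] coef_lsum[OF sums(1)[OF inj_Zeta]]
      coef_lsum[OF sums(2)[OF inj_Theta]] coef_lsum[OF sums(2)[OF inj_Zeta]] diff_zero 1 2 ..
next
  case False
  then have "infinite (Theta ` I)" "infinite (Zeta ` I)"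
    by (simp_all add: finite_image_iff inj_on_def)
  then show ?thesis
    by (simp add: coef_infinite)
qed

lemma normal_product_eq:
  fixes f g :: "'u::superspace field"
  assumes "is_field N f" "is_field N g"
  shows "normal_product (index_case TYPE('k)) f g n I v
    = pin (card I) (coef (normal_mode Zeta f g n :: ('k::case_index, 'u) opseries) (0, Zeta ` I) v)"
  by (simp only: normal_product_eq_theta[OF assms] coef_normal_mode_rename[OF assms])

lemma supported_mode_field:
  assumes "is_field N f" "inj V"
  shows "supported (V ` {1..N}) (mode V f m)"
  unfolding supported_def
proof (intro allI impI)
  fix t v assume ne: "coef (mode V f m) t v \<noteq> 0"
  obtain k S where t: "t = (k, S)" by (cases t)
  have "k = 0" "S \<subseteq> range V" "f m {i. V i \<in> S} \<noteq> 0"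
    using ne by (auto simp: t coef_mode[OF assms] split: if_splits)
  moreover from this(3) have "{i. V i \<in> S} \<subseteq> {1..N}"
    using is_fieldD(2)[OF assms(1)] by metis
  ultimately show "fst t = 0 \<and> snd t \<subseteq> V ` {1..N}"
    by (auto simp: t)
qed

lemma square_free_subset: "square_free Q \<Longrightarrow> R \<subseteq> Q \<Longrightarrow> square_free R"
  by (auto simp: square_free_def)

lemma supported_if: "supported Q x \<Longrightarrow> supported Q (if P then x else 0)"
  by (simp add: supported_zero)

lemma supported_normal_mode:
  assumes "is_field N f" "is_field N g"
  shows "supported (Zeta ` {1..N}) (normal_mode Zeta f g n)"
  unfolding normal_mode_def
  using square_free_subset[OF square_free_Zeta, of "Zeta ` {1..N}"]
  by (intro supported_add supported_lam supported_lsum supported_mult supported_if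
      lsummable2_times[OF lsummable2_normal_plus[OF assms inj_Zeta]]
      lsummable2_times[OF lsummable2_normal_minus[OF assms inj_Zeta]]
      supported_mode_field[OF assms(1) inj_Zeta] supported_mode_field[OF assms(2) inj_Zeta]) auto

lemma bounded_below_add:
  assumes "bounded_below x" "bounded_below y"
  shows "bounded_below (\<lambda>n. x n + y n)"
proof -
  have "bounded_below (\<lambda>n. 0 * y n - y n)"
    by (rule bounded_below_diff[OF bounded_below_left[OF assms(2)] assms(2)])
  from bounded_below_diff[OF assms(1) this] show ?thesis
    by simp
qed

lemma bounded_below_lsum_plus:
  fixes x y :: "int \<Rightarrow> ('k::case_index, 'u::superspace) opseries"
  assumes "bounded_below y"
  shows "bounded_below (\<lambda>n. lsum (\<lambda>m. (if m \<ge> 0 then x m else 0) * y (n - m)))"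
  unfolding bounded_below_def
proof (intro allI)
  fix k and v :: 'u
  obtain M where M: "\<forall>n<M. \<forall>t. fst t \<le> k \<longrightarrow> coef (y n) t v = 0"
    using bounded_belowD[OF assms, of k v] by blast
  have "coef (lsum (\<lambda>m. (if m \<ge> 0 then x m else 0) * y (n - m))) u v = 0" if n: "n < M" "fst u \<le> k" for n u
  proof -
    have "coef ((if m \<ge> 0 then x m else 0) * y (n - m)) u v = 0" for m
    proof (rule ccontr)
      assume "coef ((if m \<ge> 0 then x m else 0) * y (n - m)) u v \<noteq> 0"
      then obtain s t where st: "om_times s t = u"
        "coef (if m \<ge> 0 then x m else 0) s (coef (y (n - m)) t v) \<noteq> 0"
        by (rule coef_times_nonzero)
      then have "m \<ge> 0"
        by (auto split: if_splits)
      then have "n - m < M" "fst t \<le> k"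
        using n st(1) om_times_le(2)[of t s] by auto
      then have "coef (y (n - m)) t v = 0"
        using M by blast
      with st(2) show False by simp
    qed
    then show ?thesis
      by (simp add: coef_lsum[OF lsummable2_times[OF lsummable2_plus[OF assms]]])
  qed
  then show "\<exists>M. \<forall>n<M. \<forall>t. fst t \<le> k \<longrightarrow> coef (lsum (\<lambda>m. (if m \<ge> 0 then x m else 0) * y (n - m))) t v = 0"
    by blast
qed

text \<open>The factor acting first confines m to M \<le> m < 0 and yields finitely many vectors.
  For these \<open>x\<close> has a common bound L, and n < L + M with m \<ge> M gives n - m <
  L.\<close>

lemma bounded_below_lsum_minus:
  fixes x y :: "int \<Rightarrow> ('k::case_index, 'u::superspace) opseries"
  assumes "bounded_below x" "bounded_below y"
  shows "bounded_below (\<lambda>n. lsum (\<lambda>m. x (n - m) * (if m < 0 then y m else 0)))"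
  unfolding bounded_below_def
proof (intro allI)
  fix k and v :: 'u
  obtain M where M: "\<forall>n<M. \<forall>t. fst t \<le> k \<longrightarrow> coef (y n) t v = 0"
    using bounded_belowD[OF assms(2), of k v] by blast
  define B where "B = (\<Union>m\<in>{M..0}. (\<lambda>t. coef (y m) t v) ` {t. fst t \<le> k \<and> coef (y m) t v \<noteq> 0})"
  have "finite B"
    unfolding B_def by (intro finite_UN_I finite_imageI finite_coef finite_atLeastAtMost_int)
  from bounded_below_finite_set[OF assms(1) this, of k]
  obtain L where L: "\<forall>w\<in>B. \<forall>n<L. \<forall>t. fst t \<le> k \<longrightarrow> coef (x n) t w = 0"
    by blast
  have "coef (lsum (\<lambda>m. x (n - m) * (if m < 0 then y m else 0))) u v = 0"
    if n: "n < L + M" "fst u \<le> k" for n u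
  proof -
    have "coef (x (n - m) * (if m < 0 then y m else 0)) u v = 0" for m
    proof (rule ccontr)
      assume "coef (x (n - m) * (if m < 0 then y m else 0)) u v \<noteq> 0"
      then obtain s t where st: "om_times s t = u"
        "coef (x (n - m)) s (coef (if m < 0 then y m else 0) t v) \<noteq> 0"
        by (rule coef_times_nonzero)
      have le: "fst s \<le> k" "fst t \<le> k"
        using st(1) n om_times_le(1)[of s t] om_times_le(2)[of t s] by auto
      have m: "m < 0" "coef (y m) t v \<noteq> 0"
        using st(2) by (auto split: if_splits)
      have "\<not> m < M"
        using M m(2) le(2) by blast
      then have "coef (y m) t v \<in> B"
        unfolding B_def using m le(2) by (intro UN_I[of m] image_eqI[of _ _ t]) auto
      moreover have "n - m < L"
        using n \<open>\<not> m < M\<close> by simp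
      ultimately have "coef (x (n - m)) s (coef (y m) t v) = 0"
        using L le(1) by blast
      with st(2) m(1) show False by simp
    qed
    then show ?thesis
      by (simp add: coef_lsum[OF lsummable2_times[OF lsummable2_minus[OF assms(2)]]])
  qed
  then show "\<exists>M. \<forall>n<M. \<forall>t. fst t \<le> k \<longrightarrow> coef (lsum (\<lambda>m. x (n - m) * (if m < 0 then y m else 0))) t v = 0"
    by blast
qed

lemma bounded_below_normal_mode:
  assumes "is_field N f" "is_field N g"
  shows "bounded_below (normal_mode Zeta f g)"
  unfolding normal_mode_def[abs_def]
  by (intro bounded_below_add bounded_below_left bounded_below_lsum_plus bounded_below_lsum_minus
      bounded_below_mode[OF assms(1) inj_Zeta] bounded_below_mode[OF assms(2) inj_Zeta])

text \<open>Normally ordered products and bracket coefficients are recognised as fields by this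
  criterion, and their modes are identified at the same time.\<close>

lemma is_field_of_modes:
  fixes x :: "int \<Rightarrow> ('k::case_index, 'u::superspace) opseries"
  assumes "\<And>n I v. f n I v = pin (card I) (coef (x n) (0, Zeta ` I) v)"
    and "\<And>n. supported (Zeta ` {1..N}) (x n)" "bounded_below x"
  shows "is_field N f" "mode Zeta f n = x n"
proof -
  have f: "f n I = pin (card I) \<circ> coef (x n) (0, Zeta ` I)" for n I
    using assms(1) by (simp add: fun_eq_iff)
  have "is_endo (f n I)" for n I
    unfolding f by (intro is_endo_comp is_endo_pin is_endo_coef)
  moreover have "f n I = 0" if "\<not> I \<subseteq> {1..N}" for n I
  proof -
    have "\<not> Zeta ` I \<subseteq> Zeta ` {1..N}"
      using that inj_Zeta by (simp add: inj_image_subset_iff)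
    then have "coef (x n) (0, Zeta ` I) v = 0" for v
      using supportedD(2)[OF assms(2), of n "(0, Zeta ` I)" v] by auto
    then show ?thesis
      by (simp add: f fun_eq_iff endo_zero[OF is_endo_pin])
  qed
  moreover have "\<exists>M. \<forall>n<M. \<forall>I. f n I v = 0" for v
  proof -
    obtain M where "\<forall>n<M. \<forall>t. fst t \<le> 0 \<longrightarrow> coef (x n) t v = 0"
      using bounded_belowD[OF assms(3), of 0 v] by blast
    then show ?thesis
      by (intro exI[of _ M]) (simp add: assms(1) endo_zero[OF is_endo_pin])
  qed
  ultimately show field: "is_field N f"
    unfolding is_field_def by blast
  show "mode Zeta f n = x n"
  proof (rule opseries_eqI)
    fix k S and v :: 'u
    show "coef (mode Zeta f n :: ('k, 'u) opseries) (k, S) v = coef (x n) (k, S) v"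
    proof (cases "k = 0 \<and> S \<subseteq> range Zeta")
      case True
      have S: "Zeta ` {i. Zeta i \<in> S} = S"
        using True by auto
      have "card (Zeta ` {i. Zeta i \<in> S}) = card {i. Zeta i \<in> S}"
        by (rule card_image[OF inj_on_subset[OF inj_Zeta]]) simp
      then have "card {i. Zeta i \<in> S} = card S"
        by (simp only: S)
      then show ?thesis
        using True by (simp add: coef_mode[OF field inj_Zeta] assms(1) S)
    next
      case False
      have "coef (x n) (k, S) v = 0"
        using supportedD[OF assms(2), of n "(k, S)" v] False by auto
      then show ?thesis
        using False by (auto simp: coef_mode[OF field inj_Zeta])
    qed
  qed
qed

lemma
  fixes f g :: "'u::superspace field"
  assumes "is_field N f" "is_field N g"
  shows is_field_normal_product: "is_field N (normal_product (index_case TYPE('k::case_index)) f g)"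
    and mode_normal_product: "mode Zeta (normal_product (index_case TYPE('k)) f g) n
      = (normal_mode Zeta f g n :: ('k, 'u) opseries)"
  by (rule is_field_of_modes[where x = "normal_mode Zeta f g :: int \<Rightarrow> ('k, 'u) opseries",
        OF normal_product_eq[OF assms] supported_normal_mode[OF assms] bounded_below_normal_mode[OF assms]])+

section \<open>The bracket in terms of modes\<close>

lemma represents_supercommutator:
  fixes f g :: "'u::superspace field"
  assumes "is_field N f" "is_field N g"
  shows "represents (supercommutator (index_case TYPE('k)) f g)
    (\<lambda>m n. supercomm (parity f * parity g) (mode Theta f m) (mode Zeta g n) :: ('k::case_index, 'u) opseries)"
proof -
  note rf = represents_in_Z[OF assms(1)] and rg = represents_in_W[OF assms(2)]
  have "lsummable2 (\<lambda>(p, q). if q = 0 then mode Theta f p else 0)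
      (\<lambda>(p, q). if m - p = 0 then mode Zeta g (n - q) else 0 :: ('k, 'u) opseries)" for m n :: int
    by (rule lsummable2_finite_support[of "{(m, 0)}"]) (auto split: if_splits)
  note r1 = represents_mult[OF rf rg this]
  have "lsummable2 (\<lambda>(p, q). if p = 0 then mode Zeta g q else 0)
      (\<lambda>(p, q). if n - q = 0 then mode Theta f (m - p) else 0 :: ('k, 'u) opseries)" for m n :: int
    by (rule lsummable2_finite_support[of "{(0, n)}"]) (auto split: if_splits)
  note r2 = represents_mult[OF rg rf this]
  have e1: "lsum (\<lambda>(p, q). (if q = 0 then mode Theta f p else 0) * (if m - p = 0 then mode Zeta g (n - q) else 0))
      = (mode Theta f m * mode Zeta g n :: ('k, 'u) opseries)" for m n :: int
    by (subst lsum_single[of "(m, 0)"]) (auto split: if_splits)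
  have e2: "lsum (\<lambda>(p, q). (if p = 0 then mode Zeta g q else 0) * (if n - q = 0 then mode Theta f (m - p) else 0))
      = (mode Zeta g n * mode Theta f m :: ('k, 'u) opseries)" for m n :: int
    by (subst lsum_single[of "(0, n)"]) (auto split: if_splits)
  show ?thesis
    unfolding supercommutator_def supercomm_def
    by (rule represents_diff[OF r1[unfolded e1] represents_minus_one_power[OF r2[unfolded e2]]])
qed

text \<open>The generators to be split off: all \<theta>'s for the residue, and the \<chi>'s of the
  coefficient in question.\<close>

definition front_gens :: "nat \<Rightarrow> nat set \<Rightarrow> generator set" where
  "front_gens N J = Theta ` {1..N} \<union> Chi ` J"

lemma front_front_gens: "front (front_gens N J)"
  by (auto simp: front_def front_gens_def)

lemma card_front_gens: "finite J \<Longrightarrow> card (front_gens N J) = N + card J"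
  unfolding front_gens_def by (subst card_Un_disjoint) (auto simp: card_image inj_on_def)

lemma infinite_front_gens: "infinite J \<Longrightarrow> infinite (front_gens N J)"
  unfolding front_gens_def by (simp add: finite_image_iff inj_on_def)

lemma front_gens_top: "front_gens N {1..N} = top_gens N"
  by (simp add: front_gens_def top_gens_def)

definition bracket_mode :: "generator set \<Rightarrow> nat \<Rightarrow> 'u field \<Rightarrow> 'u field \<Rightarrow> int \<Rightarrow> ('k::case_index, 'u::superspace) opseries" where
  "bracket_mode T N f g = res_bracket (\<lambda>r m. res_comm T N (parity f * parity g) (mode Theta f (- 1 - int r)) (mode Zeta g m))"

text \<open>The exponential has only nonnegative exponents, so the sum over pairs of integers
  becomes one over pairs of naturals; the residue exponent -1 selects the modes -1-r of f.\<close>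

lemma lambda_bracket_eq:
  fixes f g :: "'u::superspace field"
  assumes "is_field N f" "is_field N g"
  shows "lambda_bracket (index_case TYPE('k)) N f g j J n I v
    = pin (card I) (coef (bracket_mode (front_gens N J) N f g n :: ('k::case_index, 'u) opseries) (j, Zeta ` I) v)"
proof -
  let ?C = "\<lambda>m n. supercomm (parity f * parity g) (mode Theta f m) (mode Zeta g n) :: ('k, 'u) opseries"
  let ?T = "front_gens N J"
  let ?S = "?T \<union> Zeta ` I"
  let ?h = "\<lambda>(r, s). (int r, int s)"
  let ?x = "\<lambda>(p, q). exp_component N p q :: ('k, 'u) opseries"
  have x_zero: "?x i = 0" if "i \<notin> range ?h" for i
  proof (rule ccontr)
    assume "?x i \<noteq> 0"
    then have "fst i \<ge> 0" "snd i \<ge> 0"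
      by (auto simp: exp_component_def split: if_splits prod.splits)
    then have "i = ?h (nat (fst i), nat (snd i))"
      by simp
    with that show False by blast
  qed
  have xh: "?x (?h p) = wt p * exp_factor N" for p
    by (cases p) (simp add: exp_component_def wt_def)
  have "lsummable2 ?x (\<lambda>(p, q). ?C (m - p) (n - q))" for m n
  proof (rule lsummable2_reindex[of _ ?h])
    show "lsummable2 (\<lambda>j. ?x (?h j)) (\<lambda>j. case ?h j of (p, q) \<Rightarrow> ?C (m - p) (n - q))"
      unfolding xh by (rule lsummable2_lambda_order[OF lambda_order_wt finite_pair_sum_le])
  qed (rule x_zero)
  note rep = represents_mult[OF represents_exp represents_supercommutator[OF assms] this]
  have lsum: "lsum (\<lambda>(p, q). exp_component N p q * ?C (- 1 - p) (n - q))
      = lsum (\<lambda>p. wt p * (exp_factor N * ?C (- 1 - int (fst p)) (n - int (snd p))))"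
  proof -
    have "lsum (\<lambda>(p, q). exp_component N p q * ?C (- 1 - p) (n - q))
        = lsum (\<lambda>j. case ?h j of (p, q) \<Rightarrow> exp_component N p q * ?C (- 1 - p) (n - q))"
    proof (rule lsum_reindex_inv[of "\<lambda>(p, q). (nat p, nat q)"])
      fix i assume "(case i of (p, q) \<Rightarrow> exp_component N p q * ?C (- 1 - p) (n - q)) \<noteq> 0"
      then have "?x i \<noteq> 0"
        by (auto split: prod.splits)
      then have "i \<in> range ?h"
        using x_zero by blast
      then show "?h (case i of (p, q) \<Rightarrow> (nat p, nat q)) = i"
        by auto
    qed auto
    also have "\<dots> = lsum (\<lambda>p. wt p * (exp_factor N * ?C (- 1 - int (fst p)) (n - int (snd p))))"
      by (rule arg_cong[of _ _ lsum])
        (auto simp: fun_eq_iff exp_component_def wt_def mult.assoc)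
    finally show ?thesis .
  qed
  have "part ?T (lsum (\<lambda>p. wt p * (exp_factor N * ?C (- 1 - int (fst p)) (n - int (snd p)))))
      = bracket_mode ?T N f g n"
    unfolding part_lsum[OF lsummable_wt] bracket_mode_def res_bracket_def res_comm_def
    by (simp only: wt_def weight_def part_lam_times)
  moreover have "lambda_bracket (index_case TYPE('k)) N f g j J n I v
      = pin (card ?S) (coef (lsum (\<lambda>p. wt p * (exp_factor N * ?C (- 1 - int (fst p)) (n - int (snd p))))) (j, ?S) v)"
    unfolding lambda_bracket_def front_gens_def[symmetric] representsD[OF rep] lsum ..
  moreover have "pin (card ?S) (coef x (j, ?S) v) = pin (card I) (coef (part ?T x) (j, Zeta ` I) v)" for x :: "('k, 'u) opseries"
  proof (cases "finite ?S")
    case True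
    have I: "card (Zeta ` I) = card I"
      by (rule card_image[OF inj_on_subset[OF inj_Zeta]]) simp
    have disj: "Zeta ` I \<inter> ?T = {}"
      by (auto simp: front_gens_def)
    then have "card ?S = card I + card ?T"
      using True I by (subst card_Un_disjoint) auto
    then show ?thesis
      using disj by (simp add: coef_part image_mono pin_pin)
  next
    case False
    then show ?thesis
      by (auto simp: coef_part coef_infinite endo_zero[OF is_endo_pin])
  qed
  ultimately show ?thesis
    by (simp only:)
qed

section \<open>Parities of normally ordered products and brackets\<close>

lemma homogeneous_vectors_cong: "even p = even q \<Longrightarrow> homogeneous_vectors p = homogeneous_vectors q"
  by (simp add: homogeneous_vectors_def)

lemma field_homogeneous_cong:
  fixes f :: "'u::superspace field"
  assumes "field_homogeneous p f" "even p = even q"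
  shows "field_homogeneous q f"
proof -
  have "homogeneous_vectors (p + card I + r) = (homogeneous_vectors (q + card I + r) :: 'u set)"
    for I :: "nat set" and r
    using assms(2) by (intro homogeneous_vectors_cong) simp
  then show ?thesis
    using assms(1) by (simp add: field_homogeneous_def operator_homogeneous_def)
qed

lemma field_homogeneous_parity:
  assumes "homogeneous f"
  shows "field_homogeneous (parity f) f"
proof -
  obtain p where p: "field_homogeneous p f"
    using assms by (auto simp: homogeneous_def)
  then show ?thesis
    using field_homogeneous_cong[OF p, of 0] field_homogeneous_cong[OF p, of 1]
    by (auto simp: parity_def)
qed

lemma has_parity_unique:
  assumes "has_parity p x" "has_parity q x" "even p \<noteq> even q"
  shows "x = 0"
proof (rule opseries_eqI)
  fix k S v
  let ?w = "coef x (k, S) v"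
  have "sgn1 (p + card S) *\<^sub>C ?w = sgn1 (q + card S) *\<^sub>C ?w"
    using assms(1,2) unfolding has_parity_def by (metis snd_conv)
  then have "?w = - ?w"
    using assms(3) by (auto simp: minus_one_power_iff scaleC_one split: if_splits)
  then have "(2 :: complex) *\<^sub>C ?w = 0"
    using scaleC_add_left[of 1 1 ?w] by (simp add: scaleC_one) (metis add.left_inverse)
  then show "?w = coef 0 (k, S) v"
    by (simp add: scaleC.scale_eq_0_iff)
qed

text \<open>The zero field has parity 0 by convention, whatever the parity computed from its factors.\<close>

lemma parity_sign:
  fixes f :: "'u::superspace field"
  assumes "is_field N f" "inj V" "field_homogeneous p f"
  shows "lam 0 (sgn1 (q * parity f)) * mode V f m
    = (lam 0 (sgn1 (q * p)) * mode V f m :: ('k::case_index, 'u) opseries)"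
proof (cases "even p = even (parity f)")
  case True
  then show ?thesis by (simp add: minus_one_power_iff)
next
  case False
  have "field_homogeneous (parity f) f"
    using assms(3) by (intro field_homogeneous_parity) (auto simp: homogeneous_def)
  then have "mode V f m = (0 :: ('k, 'u) opseries)"
    using has_parity_unique[OF has_parity_mode[OF assms(1,2,3)] has_parity_mode[OF assms(1,2)]] False by blast
  then show ?thesis by simp
qed

text \<open>With \<open>parity_sign\<close> this exchanges the conventional parity of a possibly
  zero field for the computed one inside a commutator.\<close>

lemma supercomm_cong_right:
  assumes "lam 0 (sgn1 p) * y = lam 0 (sgn1 q) * y"
  shows "supercomm p x y = supercomm q x y"
  using assms by (simp add: supercomm_def flip: mult.assoc)

lemma supercomm_cong_left:
  assumes "lam 0 (sgn1 p) * x = lam 0 (sgn1 q) * x"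
  shows "supercomm p x y = supercomm q x y"
  using assms by (simp add: supercomm_def flip: lam_left_commute[of y])

lemma has_parity_if: "has_parity p x \<Longrightarrow> has_parity p (if P then x else 0)"
  by (simp add: has_parity_zero)

lemma has_parity_normal_mode:
  assumes "is_field N f" "is_field N g" "field_homogeneous p f" "field_homogeneous q g"
  shows "has_parity (p + q) (normal_mode Zeta f g n)"
proof -
  note f = has_parity_if[OF has_parity_mode[OF assms(1) inj_Zeta assms(3)]]
  note g = has_parity_mode[OF assms(2) inj_Zeta assms(4)]
  show ?thesis
    unfolding normal_mode_def
    by (intro has_parity_add has_parity_lam_mult has_parity_lsum
        lsummable2_times[OF lsummable2_normal_plus[OF assms(1,2) inj_Zeta]]
        lsummable2_times[OF lsummable2_normal_minus[OF assms(1,2) inj_Zeta]]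
        has_parity_mult[OF f g] has_parity_cong[OF has_parity_mult[OF g f]]) auto
qed

lemma has_parity_supercomm:
  assumes "has_parity p x" "has_parity q y"
  shows "has_parity (p + q) (supercomm r x y)"
proof -
  have "has_parity (p + q) (y * x)"
    by (rule has_parity_cong[OF has_parity_mult[OF assms(2,1)]]) (simp add: add.commute)
  from has_parity_diff[OF has_parity_mult[OF assms] has_parity_lam_mult[OF this]] show ?thesis
    unfolding supercomm_def .
qed

lemma has_parity_bracket_mode:
  fixes f g :: "'u::superspace field"
  assumes "is_field N f" "is_field N g" "field_homogeneous p f" "field_homogeneous q g"
  shows "has_parity (p + q + card T) (bracket_mode T N f g n :: ('k::case_index, 'u) opseries)"
proof -
  have "has_parity (0 + (p + q)) (exp_factor N * supercomm r (mode Theta f k) (mode Zeta g m) :: ('k, 'u) opseries)"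
    for r k m
    by (intro has_parity_mult has_parity_exp_factor has_parity_supercomm
        has_parity_mode[OF assms(1) inj_Theta assms(3)] has_parity_mode[OF assms(2) inj_Zeta assms(4)])
  then have "has_parity (p + q + card T) (res_comm T N r (mode Theta f k) (mode Zeta g m) :: ('k, 'u) opseries)"
    for r k m
    unfolding res_comm_def add_0 by (intro has_parity_part)
  then show ?thesis
    unfolding bracket_mode_def res_bracket_def wt_def weight_def
    by (intro has_parity_lsum lsummable_wt[unfolded wt_def weight_def] has_parity_lam_mult)
qed

lemma free_lsum:
  assumes "lsummable f" "\<And>i. free g (f i)"
  shows "free g (lsum f)"
  unfolding free_def
proof (intro allI impI)
  fix t v assume "coef (lsum f) t v \<noteq> 0"
  then obtain i where "coef (f i) t v \<noteq> 0"
    unfolding coef_lsum[OF assms(1)] by (rule Sum_any.not_neutral_obtains_not_neutral)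
  then show "g \<notin> snd t"
    using assms(2)[of i] unfolding free_def by blast
qed

lemma free_part: "free g x \<Longrightarrow> free g (part T x)"
  unfolding free_def by (auto simp: coef_part split: if_splits)

lemma free_supported: "supported Q x \<Longrightarrow> g \<notin> Q \<Longrightarrow> free g x"
  unfolding supported_def free_def by blast

text \<open>Ensures that a bracket coefficient is a field in N odd variables, since neither the
  exponential nor the modes bring in a \<zeta>_j with j outside 1..N.\<close>

lemma free_bracket_mode:
  fixes f g :: "'u::superspace field"
  assumes "is_field N f" "is_field N g" "j \<notin> {1..N}"
  shows "free (Zeta j) (bracket_mode T N f g n :: ('k::case_index, 'u) opseries)"
proof -
  have E: "free (Zeta j) (exp_factor N :: ('k, 'u) opseries)"
    using assms(3) by (intro free_exp_factor) auto
  have f: "free (Zeta j) (mode Theta f m :: ('k, 'u) opseries)" for m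
    by (rule free_supported[OF supported_mode[OF assms(1) inj_Theta]]) auto
  have g: "free (Zeta j) (mode Zeta g m :: ('k, 'u) opseries)" for m
    by (rule free_supported[OF supported_mode_field[OF assms(2) inj_Zeta]]) (use assms(3) in auto)
  show ?thesis
    unfolding bracket_mode_def res_bracket_def res_comm_def supercomm_def
    by (intro free_lsum lsummable_wt free_mult free_part free_diff E f g)
      (simp_all add: wt_def weight_def free_lam)
qed

lemma coef_bracket_mode_eq_0:
  assumes "\<not> S \<subseteq> range Zeta"
  shows "coef (bracket_mode T N f g n :: ('k::case_index, 'u::superspace) opseries) (k, S) v = 0"
proof -
  have "coef (wt p * res_comm T N q x y :: ('k, 'u) opseries) (k, S) v = 0" for p q x y
    using assms by (cases p) (simp add: wt_def weight_def coef_lam_times res_comm_def coef_part)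
  then show ?thesis
    by (simp only: bracket_mode_def res_bracket_def coef_lsum[OF lsummable_wt] Sum_any.neutral)
qed

lemma bounded_below_bracket_mode:
  fixes f g :: "'u::superspace field"
  assumes "is_field N g"
  shows "bounded_below (bracket_mode T N f g :: int \<Rightarrow> ('k::case_index, 'u) opseries)"
  unfolding bracket_mode_def res_bracket_def[abs_def]
  by (rule bounded_below_lsum[OF lambda_order_wt finite_pair_sum_le])
    (intro bounded_below_left bounded_below_shift bounded_below_res_comm bounded_below_mode[OF assms inj_Zeta])

lemma
  fixes f g :: "'u::superspace field"
  assumes "is_field N f" "is_field N g"
  shows is_field_lambda_bracket: "is_field N (lambda_bracket (index_case TYPE('k::case_index)) N f g k J)"
    and mode_lambda_bracket: "mode Zeta (lambda_bracket (index_case TYPE('k)) N f g k J) n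
      = lambda_coeff k (bracket_mode (front_gens N J) N f g n :: ('k, 'u) opseries)"
proof -
  let ?x = "\<lambda>n. lambda_coeff k (bracket_mode (front_gens N J) N f g n :: ('k, 'u) opseries)"
  have 1: "lambda_bracket (index_case TYPE('k)) N f g k J n I v = pin (card I) (coef (?x n) (0, Zeta ` I) v)" for n I v
    by (simp add: lambda_bracket_eq[OF assms] coef_lambda_coeff)
  have 2: "supported (Zeta ` {1..N}) (?x n)" for n
    unfolding supported_def
  proof (intro allI impI)
    fix t v assume ne: "coef (?x n) t v \<noteq> 0"
    obtain l S where t: "t = (l, S)" by (cases t)
    have l: "l = 0" and S: "coef (bracket_mode (front_gens N J) N f g n :: ('k, 'u) opseries) (k, S) v \<noteq> 0"
      using ne by (auto simp: t coef_lambda_coeff split: if_splits)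
    have "S \<subseteq> range Zeta"
      using S coef_bracket_mode_eq_0 by blast
    have "S \<subseteq> Zeta ` {1..N}"
    proof
      fix h assume "h \<in> S"
      then obtain j where j: "h = Zeta j"
        using \<open>S \<subseteq> range Zeta\<close> by blast
      have "j \<in> {1..N}"
      proof (rule ccontr)
        assume "j \<notin> {1..N}"
        have "coef (bracket_mode (front_gens N J) N f g n :: ('k, 'u) opseries) (k, S) v = 0"
          using coef_free[OF free_bracket_mode[where 'k = 'k, OF assms \<open>j \<notin> {1..N}\<close>], of "(k, S)"] \<open>h \<in> S\<close>
          by (simp add: j)
        with S show False
          by contradiction
      qed
      then show "h \<in> Zeta ` {1..N}"
        by (simp add: j)
    qed
    then show "fst t = 0 \<and> snd t \<subseteq> Zeta ` {1..N}"
      by (simp add: t l)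
  qed
  have 3: "bounded_below ?x"
    unfolding bounded_below_def
  proof (intro allI)
    fix k' v
    \<comment> \<open>The bound is needed at the extracted power \<open>k\<close>, whatever
      \<open>k'\<close> is.\<close>
    obtain M where "\<forall>n<M. \<forall>t. fst t \<le> k \<longrightarrow> coef (bracket_mode (front_gens N J) N f g n :: ('k, 'u) opseries) t v = 0"
      using bounded_belowD[OF bounded_below_bracket_mode[where T = "front_gens N J" and f = f and 'k = 'k, OF assms(2)],
          where k = k and v = v] by blast
    then show "\<exists>M. \<forall>n<M. \<forall>t. fst t \<le> k' \<longrightarrow> coef (?x n) t v = 0"
      by (intro exI[of _ M]) (auto simp: coef_lambda_coeff)
  qed
  show "is_field N (lambda_bracket (index_case TYPE('k)) N f g k J)"
    and "mode Zeta (lambda_bracket (index_case TYPE('k)) N f g k J) n = ?x n"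
    by (rule is_field_of_modes[where x = ?x, OF 1 2 3])+
qed

lemma field_homogeneous_lambda_bracket:
  fixes f g :: "'u::superspace field"
  assumes "is_field N f" "is_field N g" "field_homogeneous p f" "field_homogeneous q g"
  shows "field_homogeneous (p + q + card (front_gens N J)) (lambda_bracket (index_case TYPE('k::case_index)) N f g k J)"
  by (rule field_homogeneous_if_has_parity[where 'k = 'k, OF is_field_lambda_bracket[OF assms(1,2)]])
    (simp only: mode_lambda_bracket[OF assms(1,2)] has_parity_lambda_coeff has_parity_bracket_mode[OF assms])


section \<open>The integral\<close>

lemma minus_one_power_apply: "minus_one_power p f x = minus_one_power p (f x)"
  by (simp add: minus_one_power_def)

lemma minus_one_power_eq: "minus_one_power p v = sgn1 p *\<^sub>C v"
  by (simp add: minus_one_power_def minus_one_power_iff scaleC_one)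

text \<open>With all \<chi>'s extracted, the exponential is a delta function and leaves only the
  sign of its top coefficient. Moving \<open>y\<close> past the 2N top generators costs
  nothing.\<close>

lemma res_comm_top:
  fixes y :: "('k::case_index, 'u::superspace) opseries"
  assumes "is_field N f" "supported (range Zeta) y" "has_parity q y"
  shows "res_comm (top_gens N) N p (mode Theta f m) y
    = lam 0 (sgn1 (N * (N - 1) div 2)) * supercomm p (mode Zeta f m) y"
proof -
  let ?T = "top_gens N"
  let ?s = "lam 0 (sgn1 (N * (N - 1) div 2)) :: ('k, 'u) opseries"
  let ?\<theta> = "mode Theta f m :: ('k, 'u) opseries" and ?\<zeta> = "mode Zeta f m :: ('k, 'u) opseries"
  have "part ?T (exp_factor N * ?\<theta>) = part ?T (exp_factor N * ?\<zeta>)"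
    by (rule part_exp_mode[OF assms(1)]) (simp add: top_gens_def)
  then have Ef: "part ?T (exp_factor N * ?\<theta>) = ?s * ?\<zeta>"
    by (simp only: part_times[OF supported_mode[OF assms(1) inj_Zeta] front_top] part_exp_factor_top)
  have 1: "part ?T (exp_factor N * (?\<theta> * y)) = ?s * (?\<zeta> * y)"
    by (simp only: mult.assoc[symmetric] part_times[OF assms(2) front_top] Ef)
  have 2: "part ?T (exp_factor N * (y * ?\<theta>)) = ?s * (y * ?\<zeta>)"
  proof -
    have "part ?T (exp_factor N * (y * ?\<theta>)) = part ?T (y * (exp_factor N * ?\<theta>))"
      by (simp only: mult.assoc[symmetric] exp_factor_commute[OF assms(3,2)])
    also have "\<dots> = lam 0 (sgn1 (q * card ?T)) * (y * (?s * ?\<zeta>))"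
      by (simp only: times_part[OF assms(2) front_top assms(3)] Ef)
    also have "sgn1 (q * card ?T) = 1"
      by (simp add: card_top minus_one_power_iff)
    finally show ?thesis
      by (simp add: lam_left_commute[of y])
  qed
  show ?thesis
    unfolding res_comm_def supercomm_def right_diff_distrib lam_left_commute[of "exp_factor N"] part_diff
      part_lam_times 1 2 by (simp add: lam_mult' mult.commute[of "sgn1 p"])
qed

lemma bracket_mode_top:
  assumes "is_field N f" "is_field N g" "homogeneous g"
  shows "bracket_mode (top_gens N) N f g n = lam 0 (sgn1 (N * (N - 1) div 2)) *
    lsum (\<lambda>p. wt p * supercomm (parity f * parity g) (mode Zeta f (- 1 - int (fst p))) (mode Zeta g (n - int (snd p))))"
  unfolding bracket_mode_def res_bracket_def times_lsum[OF lsummable_wt]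
    res_comm_top[OF assms(1) supported_mode[OF assms(2) inj_Zeta]
      has_parity_mode[OF assms(2) inj_Zeta field_homogeneous_parity[OF assms(3)]]]
  by (simp only: lam_left_commute[of "wt _"])

text \<open>Here the \<lambda> of the ring stands for \<gamma>, whose exponent is j; the original
  \<lambda>, with exponent k, has been removed by \<open>lambda_coeff\<close>.\<close>

lemma coef_lsum_wt_lambda_coeff:
  "coef (lsum (\<lambda>p. wt p * lambda_coeff k (V p))) (j, S) v
    = (\<Sum>p\<in>{p. fst p + snd p = j}. exp_coeff (fst p) (snd p) *\<^sub>C coef (V p) (k, S) v)"
proof -
  have fin: "finite {p :: nat \<times> nat. fst p + snd p = j}"
    by (rule finite_subset[OF _ finite_pair_sum_le[of j]]) auto
  have "coef (wt p * lambda_coeff k (V p)) (j, S) v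
      = (if fst p + snd p = j then exp_coeff (fst p) (snd p) *\<^sub>C coef (V p) (k, S) v else 0)" for p
    by (auto simp: wt_def weight_def coef_lam_times coef_lambda_coeff)
  then show ?thesis
    unfolding coef_lsum[OF lsummable_wt]
    by (subst Sum_any.expand_superset[OF fin]) (auto intro!: sum.cong)
qed

lemma coef_lsum_int_weight:
  "coef (lsum (\<lambda>p. int_weight p * V p)) (l, S) v
    = (\<Sum>p\<in>{p. fst p + snd p + 1 \<le> l}. int_coeff (fst p) (snd p) *\<^sub>C coef (V p) (l - (fst p + snd p + 1), S) v)"
proof -
  have fin: "finite {p :: nat \<times> nat. fst p + snd p + 1 \<le> l}"
    by (rule finite_subset[OF _ finite_pair_sum_le[of l]]) auto
  have "coef (int_weight p * V p) (l, S) v = (if fst p + snd p + 1 \<le> l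
      then int_coeff (fst p) (snd p) *\<^sub>C coef (V p) (l - (fst p + snd p + 1), S) v else 0)" for p
    by (simp add: int_weight_def coef_lam_times)
  then show ?thesis
    unfolding coef_lsum[OF lsummable_int_weight]
    by (subst Sum_any.expand_superset[OF fin]) (auto intro!: sum.cong)
qed

text \<open>All signs cancel in pairs: (-1)^(|J| N) of the double bracket with that of the odd
  derivative, and (-1)^(N(N-1)/2) of the latter with the top coefficient of the exponential.
  Division by j + 1 turns \<open>exp_coeff\<close> into \<open>int_coeff\<close>.\<close>

lemma lambda_integral_eq:
  fixes a b c :: "'u::superspace field" and J :: "nat set"
  assumes "is_field N a" "is_field N b" "is_field N c" "homogeneous a" "homogeneous b" "homogeneous c"
  defines "T \<equiv> front_gens N J"
  shows "lambda_integral N (gamma_bracket (index_case TYPE('k)) N (lambda_bracket (index_case TYPE('k)) N a b) c) l J n I v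
    = pin (card I) (coef (lsum (\<lambda>p. int_weight p * supercomm ((parity a + parity b + card T) * parity c)
        (bracket_mode T N a b (- 1 - int (fst p))) (mode Zeta c (n - int (snd p))))
        :: ('k::case_index, 'u) opseries) (l, Zeta ` I) v)"
proof -
  let ?\<kappa> = "index_case TYPE('k)"
  let ?s = "sgn1 (N * (N - 1) div 2)"
  let ?S = "Zeta ` I"
  define F where "F = (\<lambda>k. lambda_bracket ?\<kappa> N a b k J)"
  define V where "V = (\<lambda>p. supercomm ((parity a + parity b + card T) * parity c)
        (bracket_mode T N a b (- 1 - int (fst p))) (mode Zeta c (n - int (snd p))) :: ('k, 'u) opseries)"
  have F_eq: "F k = lambda_bracket ?\<kappa> N a b k J" for k
    by (simp only: F_def)
  note Fld = is_field_lambda_bracket[where 'k = 'k, OF assms(1,2), of _ J, folded F_eq]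
  note Fhom = field_homogeneous_lambda_bracket[where 'k = 'k, OF assms(1,2) field_homogeneous_parity[OF assms(4)]
      field_homogeneous_parity[OF assms(5)], of J, folded F_eq, folded T_def]
  note Fmode = mode_lambda_bracket[where 'k = 'k, OF assms(1,2), of _ J, folded F_eq, folded T_def]
  \<comment> \<open>The conventional parity of the bracket coefficient is replaced by the computed
    one, and the coefficient of \<lambda>^k is taken outside because the modes of c contain no
    \<lambda>.\<close>
  have V: "supercomm (parity (F k) * parity c) (mode Zeta (F k) m) (mode Zeta c q)
      = lambda_coeff k (supercomm ((parity a + parity b + card T) * parity c) (bracket_mode T N a b m) (mode Zeta c q) :: ('k, 'u) opseries)"
    for k m q
  proof -
    have "supercomm (parity (F k) * parity c) (mode Zeta (F k) m) (mode Zeta c q :: ('k, 'u) opseries)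
        = supercomm ((parity a + parity b + card T) * parity c) (mode Zeta (F k) m) (mode Zeta c q)"
      using parity_sign[OF Fld inj_Zeta Fhom, of "parity c"]
      by (intro supercomm_cong_left) (simp only: mult.commute)
    also have "\<dots> = lambda_coeff k (supercomm ((parity a + parity b + card T) * parity c) (bracket_mode T N a b m) (mode Zeta c q))"
    proof -
      have "lambda_coeff k (lam 0 c * x) = lam 0 c * lambda_coeff k x" for c and x :: "('k, 'u) opseries"
        by (rule opseries_eqI) (simp add: coef_lambda_coeff coef_lam_times)
      then show ?thesis
        unfolding supercomm_def diff_conv_add_uminus lambda_coeff_add lambda_coeff_uminus Fmode
        by (simp only: lambda_coeff_times[OF supported_mode[OF assms(3) inj_Zeta] square_free_Zeta]
            times_lambda_coeff[OF supported_mode[OF assms(3) inj_Zeta] square_free_Zeta])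
    qed
    finally show ?thesis .
  qed
  have bracket: "lambda_bracket ?\<kappa> N (F k) c j {1..N} n I v
      = pin (card I) (?s *\<^sub>C (\<Sum>p\<in>{p. fst p + snd p = j}. exp_coeff (fst p) (snd p) *\<^sub>C coef (V p) (k, ?S) v))" for k j
    unfolding lambda_bracket_eq[where 'k = 'k, OF Fld assms(3)] front_gens_top bracket_mode_top[OF Fld assms(3,6)] V
      coef_lam_times coef_lsum_wt_lambda_coeff by (simp add: V_def)
  have ss: "?s *\<^sub>C (?s *\<^sub>C x) = x" for x :: 'u
    by (simp add: scaleC_scaleC scaleC_one)
  have tt: "sgn1 (card J * N) *\<^sub>C (sgn1 (card J * N) *\<^sub>C x) = x" for x :: 'u
    by (simp add: scaleC_scaleC scaleC_one)
  let ?A = "{(k, j). k + (j + 1) = l} :: (nat \<times> nat) set"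
  let ?D = "\<lambda>j. {p :: nat \<times> nat. fst p + snd p = j}"
  have finA: "finite ?A"
    by (rule finite_subset[of _ "{..l} \<times> {..l}"]) auto
  have finD: "finite (?D j)" for j
    by (rule finite_subset[OF _ finite_pair_sum_le[of j]]) auto
  have "lambda_integral N (gamma_bracket ?\<kappa> N (lambda_bracket ?\<kappa> N a b) c) l J n I v
      = (\<Sum>(k, j)\<in>?A. (1 / of_nat (j + 1)) *\<^sub>C (sgn1 (card J * N + N * (N - 1) div 2) *\<^sub>C
          (sgn1 (card J * N) *\<^sub>C lambda_bracket ?\<kappa> N (F k) c j {1..N} n I v)))"
    unfolding lambda_integral_def sum_fun_apply split_def scale_op_def odd_derivative_def gamma_bracket_def
      minus_one_power_apply minus_one_power_eq F_def ..
  also have "\<dots> = (\<Sum>(k, j)\<in>?A. pin (card I) (\<Sum>p\<in>?D j. int_coeff (fst p) (snd p) *\<^sub>C coef (V p) (k, ?S) v))"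
  proof (rule sum.cong[OF refl], clarify)
    fix k j :: nat
    have "(1 / of_nat (j + 1)) *\<^sub>C (sgn1 (card J * N + N * (N - 1) div 2) *\<^sub>C
          (sgn1 (card J * N) *\<^sub>C lambda_bracket ?\<kappa> N (F k) c j {1..N} n I v))
      = pin (card I) ((1 / of_nat (j + 1)) *\<^sub>C (?s *\<^sub>C (?s *\<^sub>C
          (sgn1 (card J * N) *\<^sub>C (sgn1 (card J * N) *\<^sub>C
          (\<Sum>p\<in>?D j. exp_coeff (fst p) (snd p) *\<^sub>C coef (V p) (k, ?S) v))))))"
      unfolding bracket by (simp add: endo_scale[OF is_endo_pin] scaleC_scaleC power_add mult_ac)
    also have "\<dots> = pin (card I) (\<Sum>p\<in>?D j. int_coeff (fst p) (snd p) *\<^sub>C coef (V p) (k, ?S) v)"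
      unfolding ss tt endo_sum[OF is_endo_scale]
      by (intro arg_cong[of _ _ "pin (card I)"] sum.cong refl) (auto simp: scaleC_scaleC int_coeff_def)
    finally show "(1 / of_nat (j + 1)) *\<^sub>C (sgn1 (card J * N + N * (N - 1) div 2) *\<^sub>C
          (sgn1 (card J * N) *\<^sub>C lambda_bracket ?\<kappa> N (F k) c j {1..N} n I v))
      = pin (card I) (\<Sum>p\<in>?D j. int_coeff (fst p) (snd p) *\<^sub>C coef (V p) (k, ?S) v)" .
  qed
  also have "\<dots> = pin (card I) (\<Sum>i\<in>?A. \<Sum>p\<in>?D (snd i). int_coeff (fst p) (snd p) *\<^sub>C coef (V p) (fst i, ?S) v)"
    by (simp only: endo_sum[OF is_endo_pin] split_def)
  also have "(\<Sum>i\<in>?A. \<Sum>p\<in>?D (snd i). int_coeff (fst p) (snd p) *\<^sub>C coef (V p) (fst i, ?S) v)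
      = (\<Sum>(i, p)\<in>(SIGMA i:?A. ?D (snd i)). int_coeff (fst p) (snd p) *\<^sub>C coef (V p) (fst i, ?S) v)"
    using finA finD by (intro sum.Sigma) auto
  \<comment> \<open>The pair p determines j = fst p + snd p, and then k = l - (j + 1).\<close>
  also have "\<dots> = (\<Sum>p\<in>{p. fst p + snd p + 1 \<le> l}. int_coeff (fst p) (snd p) *\<^sub>C coef (V p) (l - (fst p + snd p + 1), ?S) v)"
    by (rule sum.reindex_bij_witness[of _ "\<lambda>p. ((l - (fst p + snd p + 1), fst p + snd p), p)" snd]) auto
  also have "\<dots> = coef (lsum (\<lambda>p. int_weight p * V p)) (l, ?S) v"
    by (rule coef_lsum_int_weight[symmetric])
  finally show ?thesis
    by (simp only: V_def)
qed


section \<open>The Wick formula\<close>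

lemma wick_formula:
  fixes a b c :: "'u::superspace field" and k :: "'k::case_index itself"
  assumes a: "is_field N a" "homogeneous a" and b: "is_field N b" "homogeneous b"
    and c: "is_field N c" "homogeneous c"
  defines "\<kappa> \<equiv> index_case TYPE('k)"
  shows "lambda_bracket \<kappa> N a (normal_product \<kappa> b c) =
      normal_product_left \<kappa> (lambda_bracket \<kappa> N a b) c
      + minus_one_power ((parity a + N) * parity b)
          (normal_product_right \<kappa> b (lambda_bracket \<kappa> N a c))
      + lambda_integral N (gamma_bracket \<kappa> N (lambda_bracket \<kappa> N a b) c)"
proof (intro ext)
  fix l J n I v
  define T where "T = front_gens N J"
  let ?S = "Zeta ` I"
  let ?pa = "parity a" and ?pb = "parity b" and ?pc = "parity c"
  let ?\<sigma> = "(?pa + ?pb + card T) * ?pc" and ?\<tau> = "?pb * (?pa + ?pc + card T)"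
  define \<alpha> where "\<alpha> = (\<lambda>r. mode Theta a (- 1 - int r) :: ('k, 'u) opseries)"
  define \<beta> where "\<beta> = (mode Zeta b :: int \<Rightarrow> ('k, 'u) opseries)"
  define \<gamma> where "\<gamma> = (mode Zeta c :: int \<Rightarrow> ('k, 'u) opseries)"
  define B where "B = (bracket_mode T N a b :: int \<Rightarrow> ('k, 'u) opseries)"
  define C where "C = (bracket_mode T N a c :: int \<Rightarrow> ('k, 'u) opseries)"
  define bc where "bc = normal_product \<kappa> b c"
  note hom = field_homogeneous_parity[OF a(2)] field_homogeneous_parity[OF b(2)] field_homogeneous_parity[OF c(2)]
  have \<beta>s: "supported (range Zeta) (\<beta> m)" and \<gamma>s: "supported (range Zeta) (\<gamma> m)" for m
    unfolding \<beta>_def \<gamma>_def by (rule supported_mode[OF b(1) inj_Zeta], rule supported_mode[OF c(1) inj_Zeta])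
  have \<beta>b: "bounded_below \<beta>" and \<gamma>b: "bounded_below \<gamma>"
    unfolding \<beta>_def \<gamma>_def by (rule bounded_below_mode[OF b(1) inj_Zeta], rule bounded_below_mode[OF c(1) inj_Zeta])
  have \<beta>p: "has_parity ?pb (\<beta> m)" and \<gamma>p: "has_parity ?pc (\<gamma> m)" for m
    unfolding \<beta>_def \<gamma>_def by (rule has_parity_mode[OF b(1) inj_Zeta hom(2)], rule has_parity_mode[OF c(1) inj_Zeta hom(3)])
  have B: "res_bracket (\<lambda>r m. res_comm T N (?pa * ?pb) (\<alpha> r) (\<beta> m)) = B"
    by (simp only: B_def bracket_mode_def \<alpha>_def \<beta>_def)
  have C: "res_bracket (\<lambda>r m. res_comm T N (?pa * ?pc) (\<alpha> r) (\<gamma> m)) = C"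
    by (simp only: C_def bracket_mode_def \<alpha>_def \<gamma>_def)
  have lam_coeff: "lambda_coeff l (lam 0 z * x) = lam 0 z * lambda_coeff l x" for z and x :: "('k, 'u) opseries"
    by (rule opseries_eqI) (simp add: coef_lambda_coeff coef_lam_times)

  have bc_field: "is_field N bc"
    unfolding bc_def \<kappa>_def by (rule is_field_normal_product[OF b(1) c(1)])
  have bc_mode: "mode Zeta bc q = (normal_mode Zeta b c q :: ('k, 'u) opseries)" for q
    unfolding bc_def \<kappa>_def by (rule mode_normal_product[OF b(1) c(1)])
  have bc_hom: "field_homogeneous (?pb + ?pc) bc"
    by (rule field_homogeneous_if_has_parity[where 'k = 'k, OF bc_field])
      (simp only: bc_mode has_parity_normal_mode[OF b(1) c(1) hom(2,3)])
  \<comment> \<open>If :bc: is zero its conventional parity is 0; the two signs agree once they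
    multiply its modes.\<close>
  have sc: "supercomm (?pa * parity bc) x (normal_mode Zeta b c q)
      = (supercomm (?pa * (?pb + ?pc)) x (normal_mode Zeta b c q) :: ('k, 'u) opseries)" for x q
    unfolding bc_mode[symmetric] by (rule supercomm_cong_right[OF parity_sign[OF bc_field inj_Zeta bc_hom]])
  have "bracket_mode T N a bc n = lsum (\<lambda>p. wt p * res_comm T N (?pa * (?pb + ?pc)) (\<alpha> (fst p))
      (normal_mode Zeta b c (n - int (snd p))) :: ('k, 'u) opseries)"
    unfolding bracket_mode_def res_bracket_def res_comm_def \<alpha>_def bc_mode sc ..
  also have "\<dots> = (lsum (\<lambda>m. (if m \<ge> 0 then B m else 0) * \<gamma> (n - m))
        + lam 0 (sgn1 ?\<sigma>) * lsum (\<lambda>m. \<gamma> (n - m) * (if m < 0 then B m else 0)))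
      + lam 0 (sgn1 ((?pa + card T) * ?pb)) *
        (lsum (\<lambda>m. (if m \<ge> 0 then \<beta> m else 0) * C (n - m))
        + lam 0 (sgn1 ?\<tau>) * lsum (\<lambda>m. C (n - m) * (if m < 0 then \<beta> m else 0)))
      + lsum (\<lambda>p. int_weight p * supercomm ?\<sigma> (B (- 1 - int (fst p))) (\<gamma> (n - int (snd p))))"
    unfolding normal_mode_def \<beta>_def[symmetric] \<gamma>_def[symmetric] B[symmetric] C[symmetric]
    by (rule wick_modes[OF front_front_gens[of N J, folded T_def] \<beta>s \<beta>p \<beta>b \<gamma>s \<gamma>p \<gamma>b])
  finally have main: "bracket_mode T N a bc n = (lsum (\<lambda>m. (if m \<ge> 0 then B m else 0) * \<gamma> (n - m))
        + lam 0 (sgn1 ?\<sigma>) * lsum (\<lambda>m. \<gamma> (n - m) * (if m < 0 then B m else 0)))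
      + lam 0 (sgn1 ((?pa + card T) * ?pb)) *
        (lsum (\<lambda>m. (if m \<ge> 0 then \<beta> m else 0) * C (n - m))
        + lam 0 (sgn1 ?\<tau>) * lsum (\<lambda>m. C (n - m) * (if m < 0 then \<beta> m else 0)))
      + lsum (\<lambda>p. int_weight p * supercomm ?\<sigma> (B (- 1 - int (fst p))) (\<gamma> (n - int (snd p))))"
    (is "_ = ?L + _ * ?R + ?M") .

  have left: "normal_product_left \<kappa> (lambda_bracket \<kappa> N a b) c l J n I v = pin (card I) (coef ?L (l, ?S) v)"
  proof -
    define F where "F = lambda_bracket \<kappa> N a b l J"
    have F: "is_field N F" "field_homogeneous (?pa + ?pb + card T) F"
      unfolding F_def \<kappa>_def T_def
      by (rule is_field_lambda_bracket[OF a(1) b(1)], rule field_homogeneous_lambda_bracket[OF a(1) b(1) hom(1,2)])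
    have Fm: "mode Zeta F m = lambda_coeff l (B m)" for m
      unfolding F_def \<kappa>_def B_def T_def by (rule mode_lambda_bracket[OF a(1) b(1)])
    have Bb: "bounded_below B"
      unfolding B_def by (rule bounded_below_bracket_mode[OF b(1)])
    have sign: "lam 0 (sgn1 (parity F * ?pc)) * (\<gamma> q * (if m < 0 then mode Zeta F m else 0))
        = lam 0 (sgn1 ?\<sigma>) * (\<gamma> q * (if m < 0 then mode Zeta F m else 0))" for m q
      using parity_sign[OF F(1) inj_Zeta F(2), where 'k = 'k, of ?pc m]
      by (simp only: lam_left_commute[of "\<gamma> q", symmetric] mult.commute[of ?pc]) simp
    have "normal_mode Zeta F c n = lsum (\<lambda>m. (if m \<ge> 0 then mode Zeta F m else 0) * \<gamma> (n - m))
        + lsum (\<lambda>m. lam 0 (sgn1 (parity F * ?pc)) * (\<gamma> (n - m) * (if m < 0 then mode Zeta F m else 0)))"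
      unfolding normal_mode_def \<gamma>_def
      by (simp only: times_lsum[OF lsummable2_times[OF lsummable2_normal_minus[OF F(1) c(1) inj_Zeta]]])
    also have "\<dots> = lambda_coeff l ?L"
    proof -
      have 1: "(if m \<ge> 0 then mode Zeta F m else 0) * \<gamma> (n - m) = lambda_coeff l ((if m \<ge> 0 then B m else 0) * \<gamma> (n - m))" for m
        by (simp add: Fm lambda_coeff_times[OF \<gamma>s square_free_Zeta])
      have 2: "\<gamma> (n - m) * (if m < 0 then mode Zeta F m else 0) = lambda_coeff l (\<gamma> (n - m) * (if m < 0 then B m else 0))" for m
        by (simp add: Fm times_lambda_coeff[OF \<gamma>s square_free_Zeta])
      have 3: "lam 0 (sgn1 (parity F * ?pc)) * (\<gamma> (n - m) * (if m < 0 then mode Zeta F m else 0))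
          = lam 0 (sgn1 ?\<sigma>) * lambda_coeff l (\<gamma> (n - m) * (if m < 0 then B m else 0))" for m
        by (subst sign) (simp only: 2)
      have s1: "lsummable (\<lambda>m. (if m \<ge> 0 then B m else 0) * \<gamma> (n - m))"
        by (rule lsummable2_times[OF lsummable2_plus[OF \<gamma>b]])
      have s2: "lsummable (\<lambda>m. \<gamma> (n - m) * (if m < 0 then B m else 0))"
        by (rule lsummable2_times[OF lsummable2_minus[OF Bb]])
      show ?thesis
        unfolding 1 3 lambda_coeff_add lam_coeff lambda_coeff_lsum[OF s1] lambda_coeff_lsum[OF s2]
        by (simp only: times_lsum[OF lsummable_lambda_coeff[OF s2]])
    qed
    finally have nm: "normal_mode Zeta F c n = lambda_coeff l ?L" .
    show ?thesis
      unfolding normal_product_left_def F_def[symmetric] unfolding \<kappa>_def normal_product_eq[where 'k = 'k, OF F(1) c(1)] nm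
      by (simp add: coef_lambda_coeff)
  qed

  have right: "normal_product_right \<kappa> b (lambda_bracket \<kappa> N a c) l J n I v
      = sgn1 (?pb * card J) *\<^sub>C pin (card I) (coef ?R (l, ?S) v)"
  proof -
    define G where "G = lambda_bracket \<kappa> N a c l J"
    have G: "is_field N G" "field_homogeneous (?pa + ?pc + card T) G"
      unfolding G_def \<kappa>_def T_def
      by (rule is_field_lambda_bracket[OF a(1) c(1)], rule field_homogeneous_lambda_bracket[OF a(1) c(1) hom(1,3)])
    have Gm: "mode Zeta G m = lambda_coeff l (C m)" for m
      unfolding G_def \<kappa>_def C_def T_def by (rule mode_lambda_bracket[OF a(1) c(1)])
    have Cb: "bounded_below C"
      unfolding C_def by (rule bounded_below_bracket_mode[OF c(1)])
    have sign: "lam 0 (sgn1 (?pb * parity G)) * (mode Zeta G q * x) = lam 0 (sgn1 ?\<tau>) * (mode Zeta G q * x)"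
      for q and x :: "('k, 'u) opseries"
      using parity_sign[OF G(1) inj_Zeta G(2), where 'k = 'k, of ?pb q] by (simp flip: mult.assoc)
    have \<beta>i: "supported (range Zeta) (if P then \<beta> m else 0)" for P m
      by (rule supported_if[OF \<beta>s])
    have "normal_mode Zeta b G n = lsum (\<lambda>m. (if m \<ge> 0 then \<beta> m else 0) * mode Zeta G (n - m))
        + lsum (\<lambda>m. lam 0 (sgn1 (?pb * parity G)) * (mode Zeta G (n - m) * (if m < 0 then \<beta> m else 0)))"
      unfolding normal_mode_def \<beta>_def
      by (simp only: times_lsum[OF lsummable2_times[OF lsummable2_normal_minus[OF b(1) G(1) inj_Zeta]]])
    also have "\<dots> = lambda_coeff l ?R"
    proof -
      have s1: "lsummable (\<lambda>m. (if m \<ge> 0 then \<beta> m else 0) * C (n - m))"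
        by (rule lsummable2_times[OF lsummable2_plus[OF Cb]])
      have s2: "lsummable (\<lambda>m. C (n - m) * (if m < 0 then \<beta> m else 0))"
        by (rule lsummable2_times[OF lsummable2_minus[OF \<beta>b]])
      have s3: "lsummable (\<lambda>m. lambda_coeff l (C (n - m)) * (if m < 0 then \<beta> m else 0))"
        using lsummable_lambda_coeff[OF s2, of l] by (simp only: lambda_coeff_times[OF \<beta>i square_free_Zeta])
      show ?thesis
        unfolding sign unfolding Gm lambda_coeff_add lam_coeff lambda_coeff_lsum[OF s1] lambda_coeff_lsum[OF s2]
          lambda_coeff_times[OF \<beta>i square_free_Zeta] times_lambda_coeff[OF \<beta>i square_free_Zeta]
        by (simp only: times_lsum[OF s3])
    qed
    finally have nm: "normal_mode Zeta b G n = lambda_coeff l ?R" .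
    show ?thesis
      unfolding normal_product_right_def G_def[symmetric] minus_one_power_apply minus_one_power_eq
      unfolding \<kappa>_def normal_product_eq[where 'k = 'k, OF b(1) G(1)] nm
      by (simp add: coef_lambda_coeff)
  qed

  \<comment> \<open>With |T| = N + |J|, the N part is the sign displayed in the formula and the |J|
    part is the sign rule of \<open>normal_product_right\<close>. For infinite J cardinalities mean
    nothing, but the coefficient itself vanishes.\<close>
  have R_sign: "lam 0 (sgn1 ((?pa + card T) * ?pb)) * ?R = lam 0 (sgn1 ((?pa + N) * ?pb) * sgn1 (?pb * card J)) * ?R"
  proof (cases "finite J")
    case True
    have "(?pa + card T) * ?pb = (?pa + N) * ?pb + ?pb * card J"
      by (simp add: T_def card_front_gens[OF True] algebra_simps)
    then show ?thesis
      by (simp only: power_add)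
  next
    case False
    have "part T x = 0" for x :: "('k, 'u) opseries"
      unfolding T_def by (rule part_infinite[OF infinite_front_gens[OF False]])
    then have "C m = 0" for m
      by (simp add: C_def bracket_mode_def res_bracket_def res_comm_def)
    then show ?thesis
      by simp
  qed

  have "lambda_bracket \<kappa> N a bc l J n I v = pin (card I) (coef (bracket_mode T N a bc n :: ('k, 'u) opseries) (l, ?S) v)"
    unfolding \<kappa>_def T_def by (rule lambda_bracket_eq[OF a(1) bc_field])
  also have "\<dots> = pin (card I) (coef ?L (l, ?S) v)
      + sgn1 ((?pa + N) * ?pb) *\<^sub>C (sgn1 (?pb * card J) *\<^sub>C pin (card I) (coef ?R (l, ?S) v))
      + pin (card I) (coef ?M (l, ?S) v)"
    unfolding main R_sign coef_plus endo_add[OF is_endo_pin]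
    by (simp add: coef_lam_times endo_scale[OF is_endo_pin] endo_add[OF is_endo_pin] scaleC_scaleC)
  also have "pin (card I) (coef ?M (l, ?S) v) = lambda_integral N (gamma_bracket \<kappa> N (lambda_bracket \<kappa> N a b) c) l J n I v"
    unfolding \<kappa>_def lambda_integral_eq[where 'k = 'k, OF a(1) b(1) c(1) a(2) b(2) c(2)] B_def \<gamma>_def T_def ..
  finally show "lambda_bracket \<kappa> N a (normal_product \<kappa> b c) l J n I v =
      (normal_product_left \<kappa> (lambda_bracket \<kappa> N a b) c
      + minus_one_power ((parity a + N) * parity b)
          (normal_product_right \<kappa> b (lambda_bracket \<kappa> N a c))
      + lambda_integral N (gamma_bracket \<kappa> N (lambda_bracket \<kappa> N a b) c)) l J n I v"
    unfolding bc_def left[symmetric] right[symmetric] plus_fun_apply minus_one_power_apply minus_one_power_eq .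
qed

text \<open>One phantom type for each value of \<open>index_case\<close>, so that the formula proved
  for all index types can be specialised to the two cases.\<close>

datatype case_w = Case_W
datatype case_k = Case_K

instantiation case_w :: case_index
begin
definition "index_case (_ :: case_w itself) = CaseW"
instance ..
end

instantiation case_k :: case_index
begin
definition "index_case (_ :: case_k itself) = CaseK"
instance ..
end

theorem mainTheorem3:
  fixes a b c :: "'u::superspace field"
    and N :: nat
    and \<kappa> :: supercase
  assumes "\<kappa> = CaseK \<Longrightarrow> N \<ge> 1"
    and "is_field N a" and "homogeneous a"
    and "is_field N b" and "homogeneous b"
    and "is_field N c" and "homogeneous c"
  shows "lambda_bracket \<kappa> N a (normal_product \<kappa> b c) =
      normal_product_left \<kappa> (lambda_bracket \<kappa> N a b) c
      + minus_one_power ((parity a + N) * parity b)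
          (normal_product_right \<kappa> b (lambda_bracket \<kappa> N a c))
      + lambda_integral N (gamma_bracket \<kappa> N (lambda_bracket \<kappa> N a b) c)"
proof (cases \<kappa>)
  case CaseW
  show ?thesis
    unfolding CaseW using wick_formula[where 'k = case_w, OF assms(2-7)]
    by (simp only: index_case_case_w_def)
next
  case CaseK
  show ?thesis
    unfolding CaseK using wick_formula[where 'k = case_k, OF assms(2-7)]
    by (simp only: index_case_case_k_def)
qed

end
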